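(* Let $n\ge 2$ be an integer, let $\mu_n(x)=\frac{n}{\omega_n\left(1+|x|^{\frac{n}{n-1}}\right)^n}$ for $x\in\mathbb{R}^n$, write $\mathrm{d}\mu_n=\mu_n(x)\,\mathrm{d}x$, and set $\beta(n)=n^n\left(\frac{n}{n-1}\right)^{n-1}\omega_n$. For $u\in C^1_c(\mathbb{R}^n)$ define $$H_n(u,\mu_n):=|\nabla u+\nabla(\log\mu_n)|^n-|\nabla(\log\mu_n)|^n-n|\nabla(\log\mu_n)|^{n-2}\,\nabla(\log\mu_n)\cdot\nabla u.$$ Then $$\frac{1}{\beta(n)}\int_{\mathbb{R}^n}H_n(u,\mu_n)\,\mathrm{d}x+\int_{\mathbb{R}^n}u\,\mathrm{d}\mu_n-\log\left(\int_{\mathbb{R}^n}e^u\,\mathrm{d}\mu_n\right)\ge 0\qquad\text{for all }u\in C^1_c(\mathbb{R}^n).$$ The constant $\beta(n)$ is optimal in this inequality, i.e. the inequality does not hold for all $u\in C^1_c(\mathbb{R}^n)$ if $\beta(n)$ is replaced by a larger constant. Moreover, $u=0$ is an optimal function, i.e. equality holds for $u=0$.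
   Context: $\omega_n$ denotes the area (surface measure) of the unit sphere in $\mathbb{R}^n$; with this normalization $\mu_n$ is a probability density on $\mathbb{R}^n$. $C^1_c(\mathbb{R}^n)$ is the space of real-valued continuously differentiable functions with compact support. *)

theory Defs
  imports "HOL-Analysis.Analysis"
begin

definition grad :: "('a::real_inner \<Rightarrow> real) \<Rightarrow> 'a \<Rightarrow> 'a"
  where "grad f x = (THE D. GDERIV f x :> D)"

lemma grad_eqI:
  assumes "GDERIV f x :> D"
  shows "grad f x = D"
  unfolding grad_def
proof (rule the_equality)
  show "GDERIV f x :> D" by (fact assms)
next
  fix D' assume "GDERIV f x :> D'"
  then have "(\<lambda>h. h \<bullet> D') = (\<lambda>h. h \<bullet> D)"
    using assms has_derivative_unique unfolding gderiv_def by blast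
  then show "D' = D"
    by (metis inner_commute vector_eq_rdot)
qed

definition C1c :: "('a::euclidean_space \<Rightarrow> real) set"
  where "C1c = {u. (\<forall>x. u differentiable (at x)) \<and> continuous_on UNIV (grad u)
                  \<and> compact (closure {x. u x \<noteq> 0})}"

(* Surface measure on the unit sphere, as it enters integration in polar coordinates:
   \<sigma>(A) = n |{x. 0 < |x| \<le> 1, x/|x| \<in> A}|. *)
definition sphere_measure :: "'a::euclidean_space measure"
  where "sphere_measure =
    scale_measure (of_nat DIM('a))
      (distr (restrict_space lborel (cball 0 1 - {0})) (restrict_space borel (sphere 0 1)) sgn)"

definition \<omega> :: "'n::finite itself \<Rightarrow> real"
  where "\<omega> _ = measure (sphere_measure :: (real ^ 'n) measure) (sphere 0 1)"

lemma \<omega>_eq_unit_ball_vol: "\<omega> TYPE('n::finite) = CARD('n) * unit_ball_vol CARD('n)"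
proof -
  let ?B = "cball 0 1 - {0} :: (real ^ 'n) set"
  have meas: "sgn \<in> restrict_space lborel ?B \<rightarrow>\<^sub>M restrict_space borel (sphere 0 1)"
  proof (rule measurable_restrict_space3)
    show "(sgn :: real ^ 'n \<Rightarrow> _) \<in> lborel \<rightarrow>\<^sub>M borel"
      unfolding sgn_div_norm by measurable
    show "(sgn :: real ^ 'n \<Rightarrow> _) \<in> ?B \<rightarrow> sphere 0 1"
      by (auto simp: norm_sgn)
  qed
  have "emeasure (sphere_measure :: (real ^ 'n) measure) (sphere 0 1)
      = of_nat CARD('n) * emeasure (restrict_space lborel ?B)
          (sgn -` sphere 0 1 \<inter> space (restrict_space lborel ?B))"
    unfolding sphere_measure_def emeasure_scale_measure
    by (subst emeasure_distr[OF meas]) (auto simp: sets_restrict_space)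
  also have "sgn -` sphere 0 1 \<inter> space (restrict_space lborel ?B) = ?B"
    by (auto simp: space_restrict_space norm_sgn)
  also have "emeasure (restrict_space lborel ?B) ?B = emeasure lborel ?B"
    by (rule emeasure_restrict_space) auto
  also have "\<dots> = emeasure lborel (cball 0 1 :: (real ^ 'n) set)"
    by (subst emeasure_Diff) auto
  also have "\<dots> = ennreal (unit_ball_vol CARD('n))"
    using emeasure_cball[of 1 "0 :: real ^ 'n"] by simp
  finally show ?thesis
    by (simp add: \<omega>_def measure_def enn2real_mult)
qed

definition \<mu> :: "real ^ 'n::finite \<Rightarrow> real"
  where "\<mu> x = (let n = CARD('n) in
           n / (\<omega> TYPE('n) * (1 + norm x powr (n / (real n - 1))) ^ n))"

definition M\<mu> :: "(real ^ 'n::finite) measure"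
  where "M\<mu> = density lborel (\<lambda>x. ennreal (\<mu> x))"

definition \<beta> :: "'n::finite itself \<Rightarrow> real"
  where "\<beta> _ = (let n = CARD('n) in
           real n ^ n * (n / (real n - 1)) ^ (n - 1) * \<omega> TYPE('n))"

definition H :: "(real ^ 'n::finite \<Rightarrow> real) \<Rightarrow> (real ^ 'n \<Rightarrow> real) \<Rightarrow> real ^ 'n \<Rightarrow> real"
  where "H u m x = (let n = CARD('n); V = grad (\<lambda>y. ln (m y)) x in
           norm (grad u x + V) ^ n - norm V ^ n - n * norm V ^ (n - 2) * (V \<bullet> grad u x))"

end

theory Submission
  imports Defs
begin

text \<open>Write $f = \log\mu_n$ and $v = u + f$. As $f$ solves $\Delta_n f = -c\,\mu_n$, an integration
  by parts turns the inequality into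
  $\frac{1}{\beta(n)} \int (|\nabla v|^n - |\nabla f|^n) \ge \log \int e^v$.
  On a large ball, $e^v$ is transported to the density $(a + |x|^{n/(n-1)})^{-n}$, with $a$ chosen such
  that the masses agree, by the Knothe map $T$. Its diagonal derivatives have the product
  $\det DT$, so the arithmetic-geometric mean inequality, an integration by parts against
  $e^{v (n-1)/n}$ and Young's inequality bound $\int |\nabla v|^n$ over the ball from below by an
  explicit integral of the target density plus a boundary term; $\log \int e^v$ appears as the
  limit of a difference of two such integrals when the radius tends to infinity.
  For the optimality of $\beta(n)$, the functional is evaluated along truncations of
  $n \log\bigl((1 + |x|^{n/(n-1)}) / (a + |x|^{n/(n-1)})\bigr)$ as $a \to 0$.\<close>

section \<open>Monotone transport on the line\<close>

text \<open>The obstacle is that the energies of v and f both diverge: in the variable t =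
  |x|^(n/(n-1)) the energy of f is, up to a constant, the integral of t^(n-1) / (1+t)^n, which grows
  like log t. Only differences make sense, so the transport is done on balls, with errors explicit
  enough to vanish in the limit. With V the volume of the unit ball, the target with parameter a has
  total mass V/a, and its energy integral over t <= X is V (n-1) (log X - log a) up to a constant
  independent of a and a vanishing error. Matching masses forces a towards V / mass, and the gap to
  a = 1 becomes -V (n-1) log a: this is the origin of the logarithm. With p = n/(n-1), (n p)^n V
  (n-1) = \<open>\<beta>\<close>. Knothe's map is built from quantile maps on lines, one coordinate
  at a time, so no regularity theory of transport is needed; an inequality for its weak divergence
  suffices, and this is the direction that survives jumps of the map. For b above
  \<open>\<beta>\<close> put r = \<open>\<beta>\<close> / b < 1. Energy and log-mass of the test
  family both grow like log(1/a) with coefficient 1, the mean of u with a smaller one, and the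
  energy enters with weight r only.\<close>

definition bounded_density :: "real \<Rightarrow> real \<Rightarrow> (real \<Rightarrow> real) \<Rightarrow> bool"
  where "bounded_density C R f \<longleftrightarrow>
    f \<in> borel_measurable borel \<and> (\<forall>x. 0 \<le> f x \<and> f x \<le> C * indicator {-R..R} x)"

text \<open>The cumulative distribution function of the density \<open>f\<close>. The height bound
  in \<open>bounded_density\<close> makes it Lipschitz, hence free of jumps.\<close>

definition lower_mass :: "(real \<Rightarrow> real) \<Rightarrow> real \<Rightarrow> real"
  where "lower_mass f x = (LINT s|lborel. indicator {..x} s * f s)"

lemma bounded_density_integrable:
  assumes "bounded_density C R f"
  shows "integrable lborel f"
proof (rule Bochner_Integration.integrable_bound)
  show "integrable lborel (\<lambda>x. C * indicator {-R..R} x :: real)"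
    by (intro integrable_mult_right integrable_real_indicator) (auto simp: emeasure_lborel_Icc_eq)
  show "f \<in> borel_measurable lborel"
    using assms by (simp add: bounded_density_def)
  show "AE x in lborel. norm (f x) \<le> norm (C * indicator {-R..R} x :: real)"
  proof (intro AE_I2)
    fix x
    have "0 \<le> f x" "f x \<le> C * indicator {-R..R} x"
      using assms by (auto simp: bounded_density_def)
    then show "norm (f x) \<le> norm (C * indicator {-R..R} x :: real)" by simp
  qed
qed

section \<open>Distribution functions of bounded densities\<close>

context
  fixes C R :: real and f :: "real \<Rightarrow> real"
  assumes dens: "bounded_density C R f" and R: "0 \<le> R"
begin

lemma bounded_density_measurable: "f \<in> borel_measurable borel"
  and bounded_density_nonneg: "0 \<le> f x"
  and bounded_density_bound: "f x \<le> C * indicator {-R..R} x"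
  using dens by (auto simp: bounded_density_def)

lemma bounded_density_bound_nonneg: "0 \<le> C"
  using bounded_density_nonneg[of 0] bounded_density_bound[of 0] R by simp

lemma bounded_density_zero: "x \<notin> {-R..R} \<Longrightarrow> f x = 0"
  using bounded_density_nonneg[of x] bounded_density_bound[of x] by simp

lemma integrable_lower_mass: "integrable lborel (\<lambda>s. indicator {..x} s * f s)"
  using bounded_density_integrable[OF dens] integrable_real_mult_indicator[of "{..x}" lborel f]
  by (simp add: mult.commute)

lemma lower_mass_diff:
  assumes "x \<le> y"
  shows "lower_mass f y - lower_mass f x = (LINT s|lborel. indicator {x<..y} s * f s)"
  unfolding lower_mass_def
  by (subst Bochner_Integration.integral_diff[OF integrable_lower_mass integrable_lower_mass, symmetric])
     (use assms in \<open>intro Bochner_Integration.integral_cong; auto simp: indicator_def\<close>)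

lemma lower_mass_mono: "x \<le> y \<Longrightarrow> lower_mass f x \<le> lower_mass f y"
  using lower_mass_diff[of x y]
  by (metis (no_types, lifting) bounded_density_nonneg diff_ge_0_iff_ge indicator_pos_le
      integral_nonneg_AE AE_I2 mult_nonneg_nonneg)

lemma lower_mass_lipschitz:
  assumes "x \<le> y"
  shows "lower_mass f y - lower_mass f x \<le> C * (y - x)"
proof -
  have "(LINT s|lborel. indicator {x<..y} s * f s) \<le> (LINT s|lborel. C * indicator {x<..y} s)"
  proof (rule integral_mono)
    show "integrable lborel (\<lambda>s. indicator {x<..y} s * f s)"
      using bounded_density_integrable[OF dens] integrable_real_mult_indicator[of "{x<..y}" lborel f]
      by (simp add: mult.commute)
    show "integrable lborel (\<lambda>s. C * indicator {x<..y} s)"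
      by (intro integrable_mult_right integrable_real_indicator) (use assms in auto)
    fix s
    have "f s \<le> C"
      using bounded_density_bound[of s] bounded_density_bound_nonneg
      by (cases "s \<in> {-R..R}") auto
    then show "indicator {x<..y} s * f s \<le> C * indicator {x<..y} s"
      by (auto simp: indicator_def)
  qed
  also have "\<dots> = C * (y - x)"
    using assms by simp
  finally show ?thesis by (simp add: lower_mass_diff[OF assms])
qed

lemma continuous_lower_mass: "continuous_on UNIV (lower_mass f)"
proof -
  have "C-lipschitz_on UNIV (lower_mass f)"
  proof (rule lipschitz_onI)
    fix x y :: real
    show "dist (lower_mass f x) (lower_mass f y) \<le> C * dist x y"
      using lower_mass_lipschitz[of x y] lower_mass_mono[of x y]
        lower_mass_lipschitz[of y x] lower_mass_mono[of y x]
      by (cases "x \<le> y") (auto simp: dist_real_def)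
  qed (rule bounded_density_bound_nonneg)
  then show ?thesis by (rule lipschitz_on_continuous_on)
qed

lemma lower_mass_left: "lower_mass f (-R) = 0"
proof -
  have "(LINT s|lborel. indicator {..-R} s * f s) = (LINT s|(lborel::real measure). 0::real)"
  proof (rule integral_cong_AE)
    show "AE s in lborel. indicator {..- R} s * f s = 0"
      using AE_lborel_singleton[of "-R"]
    proof eventually_elim
      case (elim s)
      then show ?case using bounded_density_zero[of s] by (auto simp: indicator_def)
    qed
  qed (use bounded_density_measurable in measurable)
  then show ?thesis by (simp add: lower_mass_def)
qed

lemma lower_mass_right: "lower_mass f R = (LINT s|lborel. f s)"
  unfolding lower_mass_def
  by (intro Bochner_Integration.integral_cong)
     (use bounded_density_zero in \<open>force simp: indicator_def\<close>)+

lemma lower_mass_nonneg: "0 \<le> lower_mass f x"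
  unfolding lower_mass_def
  by (intro integral_nonneg_AE AE_I2) (simp add: bounded_density_nonneg)

lemma lower_mass_le: "lower_mass f x \<le> (LINT s|lborel. f s)"
  unfolding lower_mass_def
  by (intro integral_mono integrable_lower_mass bounded_density_integrable[OF dens])
     (auto simp: bounded_density_nonneg indicator_def)

lemma emeasure_density_atMost:
  "emeasure (density lborel (\<lambda>x. ennreal (f x))) {..x} = ennreal (lower_mass f x)"
proof -
  note [measurable] = bounded_density_measurable
  have "emeasure (density lborel (\<lambda>x. ennreal (f x))) {..x}
      = (\<integral>\<^sup>+s. ennreal (indicator {..x} s * f s) \<partial>lborel)"
    by (subst emeasure_density) (auto intro!: nn_integral_cong simp: indicator_def)
  also have "\<dots> = ennreal (lower_mass f x)"
    unfolding lower_mass_def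
    by (intro nn_integral_eq_integral integrable_lower_mass) (simp add: bounded_density_nonneg)
  finally show ?thesis .
qed

lemma emeasure_density_UNIV:
  "emeasure (density lborel (\<lambda>x. ennreal (f x))) UNIV = ennreal (LINT s|lborel. f s)"
  using bounded_density_measurable
  by (subst emeasure_density)
     (auto intro!: nn_integral_eq_integral bounded_density_integrable[OF dens] simp: bounded_density_nonneg)

text \<open>By continuity and monotonicity a proper superlevel set is an open ray. Its end
  \<open>s\<close> is the supremum of the closed sublevel set, that is, the rightmost point of level
  \<open>c\<close>; the intermediate value theorem shows that the level is attained.\<close>

lemma lower_mass_superlevel:
  fixes c :: real
  obtains "{x. c < lower_mass f x} = {}" | "{x. c < lower_mass f x} = UNIV"
  | s where "{x. c < lower_mass f x} = {s<..}" "{x. lower_mass f x \<le> c} = {..s}" "lower_mass f s = c"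
proof -
  let ?U = "{x. c < lower_mass f x}" and ?D = "{x. lower_mass f x \<le> c}"
  have "?U = {} \<or> ?U = UNIV \<or> ?U \<noteq> {} \<and> ?D \<noteq> {}"
    by (auto simp: set_eq_iff not_less)
  then consider "?U = {}" | "?U = UNIV" | "?U \<noteq> {}" "?D \<noteq> {}" by blast
  then show ?thesis
  proof cases
    case 3
    then obtain u d where u: "c < lower_mass f u" and d: "lower_mass f d \<le> c" by auto
    have bdd: "bdd_above ?D"
    proof (rule bdd_aboveI[of _ u])
      fix x assume "x \<in> ?D"
      then show "x \<le> u" using u lower_mass_mono[of u x] by force
    qed
    have cl: "closed ?D"
      by (intro closed_Collect_le continuous_intros continuous_lower_mass)
    define s where "s = Sup ?D"
    have sD: "lower_mass f s \<le> c"
      using closed_contains_Sup[OF 3(2) bdd cl] by (simp add: s_def)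
    have "d \<le> u" using u d lower_mass_mono[of u d] by linarith
    then obtain z where z: "lower_mass f z = c"
      using IVT'[of "lower_mass f" d c u] u d continuous_on_subset[OF continuous_lower_mass] by auto
    have "z \<le> s" unfolding s_def using z by (intro cSup_upper bdd) auto
    then have eq: "lower_mass f s = c" using sD z lower_mass_mono[of z s] by simp
    have D: "?D = {..s}"
    proof (intro set_eqI iffI)
      fix x assume "x \<in> ?D"
      then show "x \<in> {..s}" by (auto simp: s_def intro!: cSup_upper bdd)
    next
      fix x assume "x \<in> {..s}"
      then show "x \<in> ?D" using eq lower_mass_mono[of x s] by simp
    qed
    then have "?U = {s<..}" by (auto simp: set_eq_iff not_le[symmetric])
    with D eq show ?thesis using that(3) by blast
  qed (use that in auto)
qed

lemma emeasure_lower_mass_le: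
  assumes "0 \<le> c" "c \<le> (LINT s|lborel. f s)"
  shows "emeasure (density lborel (\<lambda>x. ennreal (f x))) {x. lower_mass f x \<le> c} = ennreal c"
proof (cases "c = (LINT s|lborel. f s)")
  case True
  then have "{x. lower_mass f x \<le> c} = UNIV" using lower_mass_le by auto
  then show ?thesis using emeasure_density_UNIV True by simp
next
  case False
  then have "R \<in> {x. c < lower_mass f x}" "-R \<notin> {x. c < lower_mass f x}"
    using assms by (auto simp: lower_mass_left lower_mass_right)
  then show ?thesis
    using lower_mass_superlevel[of c] emeasure_density_atMost by (metis UNIV_I empty_iff)
qed

lemma lower_mass_borel: "lower_mass f \<in> borel_measurable borel"
  by (rule borel_measurable_continuous_onI[OF continuous_lower_mass])

text \<open>The level set lies between the sublevel sets of \<open>c - e\<close> and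
  \<open>c\<close>, whose measures differ by at most \<open>e\<close>, and \<open>e\<close> is
  arbitrary: a flat piece of the distribution function is a gap of the density.\<close>

lemma emeasure_lower_mass_eq:
  "emeasure (density lborel (\<lambda>x. ennreal (f x))) {x. lower_mass f x = c} = 0"
proof (cases "0 \<le> c \<and> c \<le> (LINT s|lborel. f s)")
  case False
  then have "{x. lower_mass f x = c} = {}"
    using lower_mass_nonneg lower_mass_le by auto
  then show ?thesis by (metis emeasure_empty)
next
  case True
  note [measurable] = bounded_density_measurable lower_mass_borel
  let ?D = "density lborel (\<lambda>x. ennreal (f x))"
  let ?S = "\<lambda>c. {x. lower_mass f x \<le> c}"
  have bound: "emeasure ?D {x. lower_mass f x = c} \<le> ennreal e" if e: "e > 0" for e
  proof (cases "c - e \<ge> 0")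
    case c: True
    have "emeasure ?D {x. lower_mass f x = c} \<le> emeasure ?D (?S c - ?S (c - e))"
      using e by (intro emeasure_mono) auto
    also have "\<dots> = ennreal c - ennreal (c - e)"
    proof (subst emeasure_Diff)
      show "?S (c - e) \<subseteq> ?S c" using e by auto
    qed (use e True c in \<open>auto simp: emeasure_lower_mass_le\<close>)
    also have "\<dots> = ennreal e" using c by (subst ennreal_minus) auto
    finally show ?thesis .
  next
    case c: False
    have "emeasure ?D {x. lower_mass f x = c} \<le> emeasure ?D (?S c)"
      by (intro emeasure_mono) auto
    also have "\<dots> = ennreal c" using True by (intro emeasure_lower_mass_le) auto
    also have "\<dots> \<le> ennreal e" using c by (intro ennreal_leI) auto
    finally show ?thesis .
  qed
  have "emeasure ?D {x. lower_mass f x = c} \<le> 0"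
    by (rule ennreal_le_epsilon) (use bound in auto)
  then show ?thesis by simp
qed

text \<open>If strictness fails at \<open>x\<close>, the distribution function is constant up to
  some \<open>y > x\<close> and so shares its value at \<open>x\<close> with a rational point in
  between. There are only countably many such levels, each of measure zero.\<close>

lemma AE_lower_mass_strict:
  "AE x in density lborel (\<lambda>x. ennreal (f x)). \<forall>y>x. lower_mass f x < lower_mass f y"
proof -
  note [measurable] = bounded_density_measurable lower_mass_borel
  let ?D = "density lborel (\<lambda>x. ennreal (f x))"
  have "AE x in ?D. \<forall>q\<in>\<rat>. lower_mass f x \<noteq> lower_mass f q"
  proof (subst AE_ball_countable[OF countable_rat], intro ballI)
    fix q :: real
    show "AE x in ?D. lower_mass f x \<noteq> lower_mass f q"
      by (rule AE_I[OF _ emeasure_lower_mass_eq[of "lower_mass f q"]]) auto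
  qed
  then show ?thesis
  proof (rule eventually_mono, intro allI impI)
    fix x y :: real assume *: "\<forall>q\<in>\<rat>. lower_mass f x \<noteq> lower_mass f q" and "x < y"
    then obtain q where q: "q \<in> \<rat>" "x < q" "q < y" using Rats_dense_in_real by blast
    then show "lower_mass f x < lower_mass f y"
      using * lower_mass_mono[of x q] lower_mass_mono[of q y] by force
  qed
qed

end


text \<open>The generalized inverse of the distribution function of \<open>g\<close>, applied to
  that of \<open>f\<close>. The infimum is taken inside \<open>{-R..R}\<close>, which keeps the
  values bounded also where \<open>f\<close> has no mass.\<close>

definition quantile_map :: "real \<Rightarrow> (real \<Rightarrow> real) \<Rightarrow> (real \<Rightarrow> real) \<Rightarrow> real \<Rightarrow> real"
  where "quantile_map R f g x = Inf {y\<in>{-R..R}. lower_mass f x \<le> lower_mass g y}"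

text \<open>Nonnegative C^1 functions of compact support. The derivative is an explicit argument, so
  that it can be a partial derivative restricted to a coordinate line.\<close>

definition line_test :: "(real \<Rightarrow> real) \<Rightarrow> (real \<Rightarrow> real) \<Rightarrow> bool"
  where "line_test p p' \<longleftrightarrow> (\<forall>t. 0 \<le> p t) \<and> (\<forall>t. (p has_real_derivative p' t) (at t)) \<and>
    continuous_on UNIV p' \<and> (\<exists>K. \<forall>t. K < \<bar>t\<bar> \<longrightarrow> p t = 0 \<and> p' t = 0)"

context
  fixes p p' :: "real \<Rightarrow> real"
  assumes test: "line_test p p'"
begin

lemma line_test_nonneg: "0 \<le> p t"
  using test by (simp add: line_test_def)

lemma line_test_borel: "p' \<in> borel_measurable borel" "p \<in> borel_measurable borel"
proof -
  show "p' \<in> borel_measurable borel"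
    using test by (intro borel_measurable_continuous_onI) (simp add: line_test_def)
  show "p \<in> borel_measurable borel"
    using test by (intro borel_measurable_continuous_onI)
      (auto simp: line_test_def intro!: continuous_at_imp_continuous_on DERIV_isCont)
qed

text \<open>The fundamental theorem of calculus on an interval from \<open>s\<close> to a point
  beyond the support; the endpoint \<open>s\<close> itself is a null set.\<close>

lemma line_test_ray:
  "has_bochner_integral lborel (\<lambda>x. - p' x * indicator {s<..} x) (p s)"
proof -
  note [measurable] = line_test_borel
  obtain K where K: "\<And>t. K < \<bar>t\<bar> \<Longrightarrow> p t = 0 \<and> p' t = 0"
    using test unfolding line_test_def by blast
  define L where "L = \<bar>s\<bar> + \<bar>K\<bar> + 1"
  have "s \<le> L" by (simp add: L_def)
  have L0: "p L = 0" "\<And>t. t > L \<Longrightarrow> p' t = 0"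
    by (use K[of L] in \<open>simp add: L_def\<close>) (use K in \<open>auto simp: L_def\<close>)
  have "has_bochner_integral lborel (\<lambda>x. p' x * indicator {s..L} x) (p L - p s)"
    by (rule has_bochner_integral_FTC_Icc_real[OF \<open>s \<le> L\<close>])
       (use test in \<open>auto simp: line_test_def continuous_on_eq_continuous_at\<close>)
  from has_bochner_integral_minus[OF this]
  have *: "has_bochner_integral lborel (\<lambda>x. - (p' x * indicator {s..L} x)) (p s)"
    by (simp add: L0)
  have "AE x in lborel. - (p' x * indicator {s..L} x) = - p' x * indicator {s<..} x"
    using AE_lborel_singleton[of s]
    by eventually_elim (use L0 in \<open>auto simp: indicator_def not_le\<close>)
  then show ?thesis
    using has_bochner_integral_cong_AE[of "\<lambda>x. - (p' x * indicator {s..L} x)" lborel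
      "\<lambda>x. - p' x * indicator {s<..} x" "p s"] * by simp
qed

lemma line_test_total: "has_bochner_integral lborel (\<lambda>x. - p' x) 0"
proof -
  obtain K where K: "\<And>t. K < \<bar>t\<bar> \<Longrightarrow> p t = 0 \<and> p' t = 0"
    using test unfolding line_test_def by blast
  have "(\<lambda>x. - p' x * indicator {- \<bar>K\<bar> - 1<..} x) = (\<lambda>x. - p' x)"
    using K by (fastforce simp: indicator_def)
  moreover have "p (- \<bar>K\<bar> - 1) = 0" using K by simp
  ultimately show ?thesis using line_test_ray[of "- \<bar>K\<bar> - 1"] by simp
qed

end

text \<open>The decomposition into positive and negative part in additive form, because subtraction
  in \<open>ennreal\<close> is truncated.\<close>

lemma nn_integral_pos_part_eq:
  fixes h :: "'a \<Rightarrow> real"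
  assumes "integrable M h" "0 \<le> integral\<^sup>L M h"
  shows "(\<integral>\<^sup>+x. ennreal (max 0 (h x)) \<partial>M) =
    (\<integral>\<^sup>+x. ennreal (max 0 (- h x)) \<partial>M) + ennreal (integral\<^sup>L M h)"
proof -
  have i: "integrable M (\<lambda>x. max 0 (h x))" "integrable M (\<lambda>x. max 0 (- h x))"
    using assms(1) by auto
  have "integral\<^sup>L M h = (LINT x|M. max 0 (h x) - max 0 (- h x))"
    by (intro Bochner_Integration.integral_cong) (auto simp: max_def)
  also have "\<dots> = (LINT x|M. max 0 (h x)) - (LINT x|M. max 0 (- h x))"
    using i by simp
  finally have "(LINT x|M. max 0 (h x)) = (LINT x|M. max 0 (- h x)) + integral\<^sup>L M h" by simp
  moreover have "0 \<le> (LINT x|M. max 0 (- h x))"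
    by (intro integral_nonneg_AE) simp
  ultimately show ?thesis
    using i assms(2) by (simp add: nn_integral_eq_integral)
qed

section \<open>The quantile map as a transport map\<close>

context
  fixes C C' R :: real and f g :: "real \<Rightarrow> real"
  assumes f: "bounded_density C R f" and g: "bounded_density C' R g" and R: "0 \<le> R"
    and mass: "(LINT s|lborel. f s) = 1" "(LINT s|lborel. g s) = 1"
begin

lemma quantile_map_set:
  defines "S \<equiv> \<lambda>x. {y\<in>{-R..R}. lower_mass f x \<le> lower_mass g y}"
  shows "R \<in> S x" "closed (S x)" "bdd_below (S x)" "quantile_map R f g x \<in> S x"
proof -
  show 1: "R \<in> S x"
    using lower_mass_le[OF f R, of x] lower_mass_right[OF g R] mass R by (simp add: S_def)
  have "S x = {-R..R} \<inter> {y. lower_mass f x \<le> lower_mass g y}" by (auto simp: S_def)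
  then show 2: "closed (S x)"
    by (simp add: closed_Int closed_Collect_le continuous_lower_mass[OF g R])
  show 3: "bdd_below (S x)" by (auto simp: S_def intro!: bdd_belowI[of _ "-R"])
  show "quantile_map R f g x \<in> S x"
  proof -
    have "Inf (S x) \<in> S x"
      using 1 by (intro closed_contains_Inf 2 3) blast
    then show ?thesis by (simp add: quantile_map_def S_def)
  qed
qed

lemma quantile_map_range: "quantile_map R f g x \<in> {-R..R}"
  using quantile_map_set(4) by simp

text \<open>A Galois connection: it converts sublevel sets of the map into conditions on
  distribution functions. Monotonicity, the image measure and the layer-cake argument below all rest
  on it.\<close>

lemma quantile_map_le_iff:
  assumes "y \<in> {-R..R}"
  shows "quantile_map R f g x \<le> y \<longleftrightarrow> lower_mass f x \<le> lower_mass g y"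
proof
  assume "quantile_map R f g x \<le> y"
  then show "lower_mass f x \<le> lower_mass g y"
    using quantile_map_set(4)[of x] lower_mass_mono[OF g R] by force
next
  assume "lower_mass f x \<le> lower_mass g y"
  then show "quantile_map R f g x \<le> y"
    unfolding quantile_map_def using assms quantile_map_set(3)[of x] by (intro cInf_lower) auto
qed

lemma quantile_map_mono: "mono (quantile_map R f g)"
proof (rule monoI)
  fix x y :: real assume "x \<le> y"
  then show "quantile_map R f g x \<le> quantile_map R f g y"
    using quantile_map_le_iff[OF quantile_map_range, of x y] quantile_map_set(4)[of y]
      lower_mass_mono[OF f R, of x y] by simp
qed

lemma quantile_map_borel: "quantile_map R f g \<in> borel_measurable borel"
  using quantile_map_mono by (rule borel_measurable_mono)

text \<open>The target distribution function is continuous, so the map cannot overshoot: a larger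
  value at the image point would force an earlier point of level \<open>lower_mass f x\<close>,
  against the minimality of the infimum.\<close>

lemma lower_mass_quantile_map: "lower_mass g (quantile_map R f g x) = lower_mass f x"
proof (rule antisym)
  let ?T = "quantile_map R f g x"
  show "lower_mass f x \<le> lower_mass g ?T" using quantile_map_set(4) by simp
  show "lower_mass g ?T \<le> lower_mass f x"
  proof (rule ccontr)
    assume *: "\<not> lower_mass g ?T \<le> lower_mass f x"
    have "\<exists>y\<ge>-R. y \<le> ?T \<and> lower_mass g y = lower_mass f x"
    proof (rule IVT')
      show "lower_mass g (-R) \<le> lower_mass f x"
        by (simp add: lower_mass_left[OF g R] lower_mass_nonneg[OF f R])
      show "continuous_on {-R..?T} (lower_mass g)"
        using continuous_lower_mass[OF g R] continuous_on_subset by blast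
    qed (use * quantile_map_range[of x] in auto)
    then obtain y where y: "-R \<le> y" "y \<le> ?T" "lower_mass g y = lower_mass f x" by blast
    then have "?T \<le> y"
      using quantile_map_le_iff[of y x] quantile_map_range[of x] by simp
    with y * show False by force
  qed
qed

lemma distr_quantile_map:
  "distr (density lborel (\<lambda>x. ennreal (f x))) borel (quantile_map R f g)
    = density lborel (\<lambda>x. ennreal (g x))" (is "?L = ?G")
proof -
  note [measurable] = bounded_density_measurable[OF f R] bounded_density_measurable[OF g R]
    quantile_map_borel
  have UL: "emeasure ?L UNIV = 1"
    by (subst emeasure_distr) (auto simp: emeasure_density_UNIV[OF f R, unfolded space_borel] mass)
  have UG: "emeasure ?G UNIV = 1"
    by (simp add: emeasure_density_UNIV[OF g R] mass)
  have eq: "emeasure ?L {..y} = emeasure ?G {..y}" for y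
  proof -
    have L: "emeasure ?L {..y} = emeasure (density lborel (\<lambda>x. ennreal (f x))) {x. quantile_map R f g x \<le> y}"
      by (subst emeasure_distr) (auto intro!: arg_cong2[where f = emeasure])
    consider "y < -R" | "y \<in> {-R..R}" | "y > R" by fastforce
    then show ?thesis
    proof cases
      case 1
      then have "\<not> quantile_map R f g x \<le> y" for x using quantile_map_range[of x] by simp
      then have "{x. quantile_map R f g x \<le> y} = {}" by simp
      moreover have "lower_mass g y = 0"
        using lower_mass_mono[OF g R, of y "-R"] 1 lower_mass_left[OF g R] lower_mass_nonneg[OF g R, of y]
        by simp
      ultimately show ?thesis
        unfolding L by (simp add: emeasure_density_atMost[OF g R])
    next
      case 2
      then show ?thesis
        unfolding L emeasure_density_atMost[OF g R]
        using lower_mass_nonneg[OF g R, of y] lower_mass_le[OF g R, of y]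
        by (simp add: quantile_map_le_iff emeasure_lower_mass_le[OF f R] mass)
    next
      case 3
      then have "quantile_map R f g x \<le> y" for x using quantile_map_range[of x] by simp
      then have "{x. quantile_map R f g x \<le> y} = UNIV" by simp
      moreover have "lower_mass g y = 1"
        using lower_mass_mono[OF g R, of R y] 3 lower_mass_right[OF g R] lower_mass_le[OF g R, of y] mass
        by simp
      ultimately show ?thesis
        unfolding L by (simp add: emeasure_density_atMost[OF g R] emeasure_density_UNIV[OF f R] mass)
    qed
  qed
  \<comment> \<open>Complements are taken because the uniqueness rule used at the end compares
    measures on the half-lines \<open>{y<..}\<close>.\<close>
  have c: "emeasure M {y<..} = 1 - emeasure M {..y}" if "sets M = sets borel" "emeasure M UNIV = 1"
    for M :: "real measure" and y
  proof -
    have "space M = UNIV" using sets_eq_imp_space_eq[OF that(1)] by simp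
    moreover have "{y<..} = UNIV - {..y}" by auto
    moreover have "emeasure M {..y} \<le> 1"
      using emeasure_mono[of "{..y}" UNIV M] that sets.top by auto
    then have "emeasure M {..y} \<noteq> \<infinity>" by (auto simp: top_unique)
    ultimately show ?thesis
      using emeasure_Diff[of M "{..y}" UNIV] that by auto
  qed
  show ?thesis
  proof (rule measure_eqI_lessThan)
    fix y
    show "emeasure ?L {y<..} = emeasure ?G {y<..}"
      by (simp add: c UL UG eq)
    show "emeasure ?L {y<..} < \<infinity>"
      by (simp add: c UL order_le_less_trans[OF diff_le_self_ennreal])
  qed auto
qed

lemma nn_integral_quantile_map:
  assumes [measurable]: "\<phi> \<in> borel_measurable borel"
  shows "(\<integral>\<^sup>+x. \<phi> (quantile_map R f g x) * ennreal (f x) \<partial>lborel) = (\<integral>\<^sup>+y. \<phi> y * ennreal (g y) \<partial>lborel)"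
proof -
  note [measurable] = bounded_density_measurable[OF f R] bounded_density_measurable[OF g R]
    quantile_map_borel
  have "(\<integral>\<^sup>+x. \<phi> (quantile_map R f g x) * ennreal (f x) \<partial>lborel)
      = (\<integral>\<^sup>+x. \<phi> (quantile_map R f g x) \<partial>density lborel (\<lambda>x. ennreal (f x)))"
    by (subst nn_integral_density) (auto simp: mult.commute)
  also have "\<dots> = (\<integral>\<^sup>+y. \<phi> y \<partial>density lborel (\<lambda>x. ennreal (g x)))"
    by (subst distr_quantile_map[symmetric], subst nn_integral_distr) auto
  also have "\<dots> = (\<integral>\<^sup>+y. \<phi> y * ennreal (g y) \<partial>lborel)"
    by (subst nn_integral_density) (auto simp: mult.commute)
  finally show ?thesis .
qed

text \<open>The derivative of the monotone map is $f / g(T)$; the inequality below is its weak form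
  $\int p\, T' \le - \int p' (T + R)$, which follows from a layer-cake representation of $T + R$
  and therefore needs no regularity of $f$ and $g$.\<close>

lemma quantile_map_weak_derivative:
  assumes test: "line_test p p'"
  shows "(\<integral>\<^sup>+x. ennreal (p x * (f x / g (quantile_map R f g x)))
            + ennreal (max 0 (p' x) * (quantile_map R f g x + R)) \<partial>lborel)
    \<le> (\<integral>\<^sup>+x. ennreal (max 0 (- p' x) * (quantile_map R f g x + R)) \<partial>lborel)"
proof -
  note [measurable] = bounded_density_measurable[OF f R] bounded_density_measurable[OF g R]
    quantile_map_borel
    line_test_borel[OF test] quantile_map_borel
  define T where "T = quantile_map R f g"
  have [measurable]: "T \<in> borel_measurable borel" by (simp add: T_def)
  have T: "-R \<le> T x" "T x \<le> R" for x using quantile_map_range[of x] by (auto simp: T_def)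
  \<comment> \<open>If \<open>{x. y < T x}\<close> is a ray starting at \<open>s\<close>, then
    \<open>E y = p s\<close>; so \<open>E\<close> plays the role of \<open>p\<close> composed with
    the inverse of \<open>T\<close>.\<close>
  define E where "E y = (LINT x|lborel. - p' x * indicator {x. y < T x} x)" for y
  have [measurable]: "E \<in> borel_measurable borel"
    unfolding E_def by measurable
  have i': "integrable lborel (\<lambda>x. - p' x)"
    using line_test_total[OF test] by (simp add: has_bochner_integral_iff)
  have iE: "integrable lborel (\<lambda>x. - p' x * indicator {x. y < T x} x)" for y
    using i' by (intro integrable_real_mult_indicator) auto
  have level: "{x. y < T x} = {x. lower_mass g y < lower_mass f x}" if "y \<in> {-R..R}" for y
    using quantile_map_le_iff[OF that] by (auto simp: T_def not_le[symmetric])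
  have E_ray: "E y = p s" if "{x. y < T x} = {s<..}" for y s
    using line_test_ray[OF test, of s] by (simp add: E_def that has_bochner_integral_iff)
  have E_nonneg: "0 \<le> E y" if "y \<in> {-R..R}" for y
  proof (rule lower_mass_superlevel[OF f R, of "lower_mass g y"])
    assume "{x. lower_mass g y < lower_mass f x} = {}"
    then show ?thesis by (simp add: E_def level[OF that])
  next
    assume "{x. lower_mass g y < lower_mass f x} = UNIV"
    then show ?thesis
      using line_test_total[OF test] by (simp add: E_def level[OF that] has_bochner_integral_iff)
  next
    fix s assume "{x. lower_mass g y < lower_mass f x} = {s<..}"
    then show ?thesis
      using E_ray[of y s] line_test_nonneg[OF test] by (simp add: level[OF that])
  qed
  \<comment> \<open>Layer cake: \<open>T x + R\<close> is the length of \<open>{-R..<T x}\<close>,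
    and Tonelli exchanges the integrations over \<open>x\<close> and \<open>y\<close>.\<close>
  have cake: "(\<integral>\<^sup>+x. ennreal (q x * (T x + R)) \<partial>lborel)
      = (\<integral>\<^sup>+y. indicator {-R..R} y * (\<integral>\<^sup>+x. ennreal (q x * indicator {x. y < T x} x) \<partial>lborel) \<partial>lborel)"
    if [measurable]: "q \<in> borel_measurable borel" and q: "\<And>x. 0 \<le> q x" for q :: "real \<Rightarrow> real"
  proof -
    have "(\<integral>\<^sup>+x. ennreal (q x * (T x + R)) \<partial>lborel)
        = (\<integral>\<^sup>+x. (\<integral>\<^sup>+y. ennreal (q x) * indicator {-R..<T x} y \<partial>lborel) \<partial>lborel)"
      using q T by (intro nn_integral_cong, subst nn_integral_cmult_indicator)
        (auto simp: ennreal_mult' emeasure_lborel_Ico)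
    also have "\<dots> = (\<integral>\<^sup>+x. (\<integral>\<^sup>+y. indicator {-R..R} y * ennreal (q x * indicator {x. y < T x} x) \<partial>lborel) \<partial>lborel)"
    proof (intro nn_integral_cong)
      fix x y
      show "ennreal (q x) * indicator {-R..<T x} y
          = indicator {-R..R} y * ennreal (q x * indicator {x. y < T x} x)"
        using T(2)[of x] by (cases "y < T x"; cases "- R \<le> y") auto
    qed
    also have "\<dots> = (\<integral>\<^sup>+y. (\<integral>\<^sup>+x. indicator {-R..R} y * ennreal (q x * indicator {x. y < T x} x) \<partial>lborel) \<partial>lborel)"
      by (rule lborel_pair.Fubini') measurable
    also have "\<dots> = (\<integral>\<^sup>+y. indicator {-R..R} y * (\<integral>\<^sup>+x. ennreal (q x * indicator {x. y < T x} x) \<partial>lborel) \<partial>lborel)"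
      by (intro nn_integral_cong nn_integral_cmult) measurable
    finally show ?thesis .
  qed
  have split: "(\<integral>\<^sup>+x. ennreal (max 0 (- p' x) * indicator {x. y < T x} x) \<partial>lborel)
      = (\<integral>\<^sup>+x. ennreal (max 0 (p' x) * indicator {x. y < T x} x) \<partial>lborel) + ennreal (E y)"
    if "y \<in> {-R..R}" for y
  proof -
    have *: "max 0 (- p' x) * indicator {x. y < T x} x = max 0 (- p' x * indicator {x. y < T x} x)"
      "max 0 (p' x) * indicator {x. y < T x} x = max 0 (- (- p' x * indicator {x. y < T x} x))" for x
      by (auto simp: indicator_def)
    show ?thesis
      unfolding * E_def using iE E_nonneg[OF that]
      by (intro nn_integral_pos_part_eq) (auto simp: E_def)
  qed
  have "(\<integral>\<^sup>+x. ennreal (p x * (f x / g (T x))) \<partial>lborel)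
      \<le> (\<integral>\<^sup>+x. (ennreal (E (T x)) / ennreal (g (T x))) * ennreal (f x) \<partial>lborel)"
  proof (rule nn_integral_mono_AE)
    \<comment> \<open>Where the distribution function of \<open>f\<close> increases strictly to the
      right of \<open>x\<close>, every later point has a larger image, so the ray defining
      \<open>E (T x)\<close> starts exactly at \<open>x\<close> and
      \<open>E (T x) = p x\<close>.\<close>
    have "AE x in lborel. 0 < f x \<longrightarrow> (\<forall>y>x. lower_mass f x < lower_mass f y)"
      using AE_lower_mass_strict[OF f R] by (subst (asm) AE_density) (auto simp: ennreal_less_zero_iff)
    then show "AE x in lborel. ennreal (p x * (f x / g (T x)))
        \<le> ennreal (E (T x)) / ennreal (g (T x)) * ennreal (f x)"
    proof eventually_elim
      case (elim x)
      have nn: "0 \<le> f x" "0 \<le> g (T x)" "0 \<le> p x"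
        using bounded_density_nonneg[OF f R] bounded_density_nonneg[OF g R] line_test_nonneg[OF test]
        by auto
      show ?case
      proof (cases "f x = 0 \<or> g (T x) = 0")
        case False
        then have pos: "0 < f x" "0 < g (T x)" using nn by auto
        have "{z. T x < T z} = {z. lower_mass f x < lower_mass f z}"
          using level[of "T x"] T[of x] lower_mass_quantile_map[of x] by (simp add: T_def)
        also have "\<dots> = {x<..}"
          using elim pos lower_mass_mono[OF f R] by (auto simp: not_le[symmetric])
        finally have "E (T x) = p x" by (rule E_ray)
        then show ?thesis
          using pos nn by (simp add: divide_ennreal ennreal_mult[symmetric])
      qed auto
    qed
  qed
  also have "\<dots> = (\<integral>\<^sup>+y. ennreal (E y) / ennreal (g y) * ennreal (g y) \<partial>lborel)"
    unfolding T_def by (rule nn_integral_quantile_map) measurable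
  \<comment> \<open>Here the statement becomes an inequality: where \<open>g\<close> vanishes the
    left integrand is 0, but \<open>E\<close> may be positive, as happens in a gap of
    \<open>g\<close> over which \<open>T\<close> jumps.\<close>
  also have "\<dots> \<le> (\<integral>\<^sup>+y. indicator {-R..R} y * ennreal (E y) \<partial>lborel)"
  proof (rule nn_integral_mono)
    fix y
    show "ennreal (E y) / ennreal (g y) * ennreal (g y) \<le> indicator {-R..R} y * ennreal (E y)"
    proof (cases "g y = 0")
      case False
      then have "y \<in> {-R..R}" "0 < g y"
        using bounded_density_zero[OF g R, of y] bounded_density_nonneg[OF g R, of y] by auto
      then show ?thesis
        using E_nonneg[of y] by (simp add: divide_ennreal ennreal_mult[symmetric])
    qed simp
  qed
  finally have main: "(\<integral>\<^sup>+x. ennreal (p x * (f x / g (T x))) \<partial>lborel)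
      \<le> (\<integral>\<^sup>+y. indicator {-R..R} y * ennreal (E y) \<partial>lborel)" .
  have "(\<integral>\<^sup>+x. ennreal (max 0 (- p' x) * (T x + R)) \<partial>lborel)
     = (\<integral>\<^sup>+y. indicator {-R..R} y * (\<integral>\<^sup>+x. ennreal (max 0 (- p' x) * indicator {x. y < T x} x) \<partial>lborel) \<partial>lborel)"
    by (rule cake) auto
  also have "\<dots> = (\<integral>\<^sup>+y. indicator {-R..R} y * (\<integral>\<^sup>+x. ennreal (max 0 (p' x) * indicator {x. y < T x} x) \<partial>lborel)
        + indicator {-R..R} y * ennreal (E y) \<partial>lborel)"
  proof (intro nn_integral_cong)
    fix y :: real
    show "indicator {-R..R} y * (\<integral>\<^sup>+x. ennreal (max 0 (- p' x) * indicator {x. y < T x} x) \<partial>lborel)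
      = indicator {-R..R} y * (\<integral>\<^sup>+x. ennreal (max 0 (p' x) * indicator {x. y < T x} x) \<partial>lborel)
        + indicator {-R..R} y * ennreal (E y)"
      by (cases "y \<in> {-R..R}") (simp_all add: split distrib_left del: atLeastAtMost_iff)
  qed
  also have "\<dots> = (\<integral>\<^sup>+y. indicator {-R..R} y * (\<integral>\<^sup>+x. ennreal (max 0 (p' x) * indicator {x. y < T x} x) \<partial>lborel) \<partial>lborel)
        + (\<integral>\<^sup>+y. indicator {-R..R} y * ennreal (E y) \<partial>lborel)"
    by (rule nn_integral_add) measurable
  also have "(\<integral>\<^sup>+y. indicator {-R..R} y * (\<integral>\<^sup>+x. ennreal (max 0 (p' x) * indicator {x. y < T x} x) \<partial>lborel) \<partial>lborel)
     = (\<integral>\<^sup>+x. ennreal (max 0 (p' x) * (T x + R)) \<partial>lborel)"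
    by (rule cake[symmetric]) auto
  finally have "(\<integral>\<^sup>+x. ennreal (max 0 (- p' x) * (T x + R)) \<partial>lborel)
     = (\<integral>\<^sup>+x. ennreal (max 0 (p' x) * (T x + R)) \<partial>lborel)
        + (\<integral>\<^sup>+y. indicator {-R..R} y * ennreal (E y) \<partial>lborel)" .
  with main show ?thesis
    unfolding T_def[symmetric]
    by (subst nn_integral_add) (auto simp: add.commute intro: add_left_mono)
qed

end

section \<open>The Knothe map\<close>

interpretation lborel_product: product_sigma_finite "\<lambda>_. lborel :: real measure"
  by standard

abbreviation lborelP :: "'i set \<Rightarrow> ('i \<Rightarrow> real) measure"
  where "lborelP I \<equiv> Pi\<^sub>M I (\<lambda>_. lborel)"

definition box_density :: "'i set \<Rightarrow> real \<Rightarrow> real \<Rightarrow> (('i \<Rightarrow> real) \<Rightarrow> real) \<Rightarrow> bool"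
  where "box_density I C R f \<longleftrightarrow> f \<in> borel_measurable (lborelP I) \<and>
    (\<forall>x\<in>space (lborelP I). 0 \<le> f x \<and> f x \<le> C \<and> (f x \<noteq> 0 \<longrightarrow> (\<forall>i\<in>I. \<bar>x i\<bar> \<le> R)))"

text \<open>Regularity is required along the lines in direction \<open>i\<close> only, together with
  joint measurability. Freezing another coordinate therefore yields a test function on the smaller
  index set, as the induction over coordinates needs.\<close>

definition coord_test :: "'i set \<Rightarrow> 'i \<Rightarrow> (('i \<Rightarrow> real) \<Rightarrow> real) \<Rightarrow> (('i \<Rightarrow> real) \<Rightarrow> real) \<Rightarrow> bool"
  where "coord_test I i \<psi> \<psi>' \<longleftrightarrow>
    \<psi> \<in> borel_measurable (lborelP I) \<and> \<psi>' \<in> borel_measurable (lborelP I) \<and>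
    (\<forall>x\<in>space (lborelP I). line_test (\<lambda>t. \<psi> (x(i := t))) (\<lambda>t. \<psi>' (x(i := t))))"

definition marginal :: "'i \<Rightarrow> (('i \<Rightarrow> real) \<Rightarrow> real) \<Rightarrow> ('i \<Rightarrow> real) \<Rightarrow> real"
  where "marginal i f z = (LINT s|lborel. f (z(i := s)))"

text \<open>In the last clause, $-\int \partial_i\psi\, T_i \ge \int \psi\, d_i$ is stated with $T_i$ shifted by $R$
  and $\partial_i\psi$ split into its positive and negative part: all integrals are then of
  nonnegative functions, and Tonelli's theorem applies without integrability conditions.\<close>

definition knothe_map ::
    "'i set \<Rightarrow> real \<Rightarrow> (('i \<Rightarrow> real) \<Rightarrow> real) \<Rightarrow> (('i \<Rightarrow> real) \<Rightarrow> real) \<Rightarrow>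
      (('i \<Rightarrow> real) \<Rightarrow> 'i \<Rightarrow> real) \<Rightarrow> ('i \<Rightarrow> ('i \<Rightarrow> real) \<Rightarrow> real) \<Rightarrow> bool"
  where "knothe_map I R f g T d \<longleftrightarrow>
    T \<in> lborelP I \<rightarrow>\<^sub>M lborelP I \<and>
    (\<forall>x\<in>space (lborelP I). \<forall>i\<in>I. \<bar>T x i\<bar> \<le> R) \<and>
    (\<forall>\<phi>\<in>borel_measurable (lborelP I).
      (\<integral>\<^sup>+x. \<phi> (T x) * ennreal (f x) \<partial>lborelP I) = (\<integral>\<^sup>+y. \<phi> y * ennreal (g y) \<partial>lborelP I)) \<and>
    (\<forall>i\<in>I. d i \<in> borel_measurable (lborelP I) \<and> (\<forall>x\<in>space (lborelP I). 0 \<le> d i x)) \<and>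
    (AE x in lborelP I. 0 < f x \<longrightarrow> 0 < g (T x) \<and> (\<Prod>i\<in>I. d i x) = f x / g (T x)) \<and>
    (\<forall>i\<in>I. \<forall>\<psi> \<psi>'. coord_test I i \<psi> \<psi>' \<longrightarrow>
      (\<integral>\<^sup>+x. ennreal (\<psi> x * d i x) + ennreal (max 0 (\<psi>' x) * (T x i + R)) \<partial>lborelP I)
        \<le> (\<integral>\<^sup>+x. ennreal (max 0 (- \<psi>' x) * (T x i + R)) \<partial>lborelP I))"

lemma fun_upd_space_lborelP:
  "z \<in> space (lborelP J) \<Longrightarrow> z(i := s) \<in> space (lborelP (insert i J))"
  by (auto simp: space_PiM PiE_iff extensional_def)

lemma measurable_fun_upd_lborelP [measurable (raw)]:
  assumes "h \<in> M \<rightarrow>\<^sub>M lborelP J" "k \<in> borel_measurable M"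
  shows "(\<lambda>x. (h x)(i := k x)) \<in> M \<rightarrow>\<^sub>M lborelP (insert i J)"
proof -
  have "(\<lambda>x. (h x, k x)) \<in> M \<rightarrow>\<^sub>M (lborelP J \<Otimes>\<^sub>M lborel)"
    using assms by simp
  from measurable_compose[OF this measurable_add_dim[of i J "\<lambda>_. lborel"]]
  show ?thesis by simp
qed

lemma measurable_slice_lborelP:
  assumes "z \<in> space (lborelP J)"
  shows "(\<lambda>s. z(i := s)) \<in> borel \<rightarrow>\<^sub>M lborelP (insert i J)"
  using assms by (intro measurable_fun_upd_lborelP) auto

text \<open>Tonelli for the indicator of the exceptional set: if almost every fibre of it is null,
  the set is null.\<close>

lemma AE_lborelP_insert:
  assumes J: "finite J" "i \<notin> J"
    and [measurable]: "Measurable.pred (lborelP (insert i J)) Q"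
    and ae: "AE z in lborelP J. AE s in lborel. Q (z(i := s))"
  shows "AE x in lborelP (insert i J). Q x"
proof -
  have "emeasure (lborelP (insert i J)) {x\<in>space (lborelP (insert i J)). \<not> Q x}
      = (\<integral>\<^sup>+x. indicator {x\<in>space (lborelP (insert i J)). \<not> Q x} x \<partial>lborelP (insert i J))"
    by (intro nn_integral_indicator[symmetric]) measurable
  also have "\<dots> = (\<integral>\<^sup>+z. \<integral>\<^sup>+s. indicator {x\<in>space (lborelP (insert i J)). \<not> Q x} (z(i := s)) \<partial>lborel \<partial>lborelP J)"
    by (intro lborel_product.product_nn_integral_insert J) measurable
  also have "\<dots> = (\<integral>\<^sup>+z. 0 \<partial>lborelP J)"
  proof (rule nn_integral_cong_AE)
    show "AE z in lborelP J. (\<integral>\<^sup>+s. indicator {x\<in>space (lborelP (insert i J)). \<not> Q x} (z(i := s)) \<partial>lborel) = 0"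
      using ae
    proof eventually_elim
      case (elim z)
      have "(\<integral>\<^sup>+s. indicator {x\<in>space (lborelP (insert i J)). \<not> Q x} (z(i := s)) \<partial>lborel)
          = (\<integral>\<^sup>+s. 0 \<partial>(lborel :: real measure))"
        using elim by (intro nn_integral_cong_AE) (auto elim!: eventually_mono)
      then show ?case by simp
    qed
  qed
  finally show ?thesis
    by (intro AE_I[of _ _ "{x\<in>space (lborelP (insert i J)). \<not> Q x}"]) auto
qed

section \<open>Slices, marginals and conditional densities\<close>

context
  fixes J :: "'i set" and i :: 'i and C R :: real and f :: "('i \<Rightarrow> real) \<Rightarrow> real"
  assumes J: "finite J" "i \<notin> J" and R: "0 \<le> R" and f: "box_density (insert i J) C R f"
begin

lemma box_density_measurable: "f \<in> borel_measurable (lborelP (insert i J))"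
  using f by (simp add: box_density_def)

lemma box_density_slice:
  assumes "z \<in> space (lborelP J)"
  shows "bounded_density C R (\<lambda>s. f (z(i := s)))"
  unfolding bounded_density_def
proof (intro conjI allI)
  show "(\<lambda>s. f (z(i := s))) \<in> borel_measurable borel"
    using measurable_compose[OF measurable_slice_lborelP[OF assms] box_density_measurable] .
  fix s
  have "z(i := s) \<in> space (lborelP (insert i J))" using assms by (rule fun_upd_space_lborelP)
  then have *: "0 \<le> f (z(i := s))" "f (z(i := s)) \<le> C"
    "f (z(i := s)) \<noteq> 0 \<Longrightarrow> \<forall>j\<in>insert i J. \<bar>(z(i := s)) j\<bar> \<le> R"
    using f unfolding box_density_def by blast+
  show "0 \<le> f (z(i := s))" by fact
  show "f (z(i := s)) \<le> C * indicator {-R..R} s"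
  proof (cases "s \<in> {-R..R}")
    case False
    then have "f (z(i := s)) = 0" using *(3) by force
    then show ?thesis using False by simp
  qed (use * in simp)
qed

lemma ennreal_marginal:
  assumes "z \<in> space (lborelP J)"
  shows "ennreal (marginal i f z) = (\<integral>\<^sup>+s. ennreal (f (z(i := s))) \<partial>lborel)"
  unfolding marginal_def
  using bounded_density_integrable[OF box_density_slice[OF assms]]
    bounded_density_nonneg[OF box_density_slice[OF assms] R]
  by (intro nn_integral_eq_integral[symmetric]) auto

lemma marginal_nonneg:
  assumes "z \<in> space (lborelP J)"
  shows "0 \<le> marginal i f z"
  unfolding marginal_def
  using bounded_density_nonneg[OF box_density_slice[OF assms] R]
  by (intro integral_nonneg_AE) auto

lemma marginal_eq_0_AE:
  assumes z: "z \<in> space (lborelP J)" and 0: "marginal i f z = 0"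
  shows "AE s in lborel. f (z(i := s)) = 0"
  using integral_nonneg_eq_0_iff_AE[OF bounded_density_integrable[OF box_density_slice[OF z]]]
    bounded_density_nonneg[OF box_density_slice[OF z] R] 0
  by (simp add: marginal_def)

lemma box_density_marginal: "box_density J (2 * R * C) R (marginal i f)"
  unfolding box_density_def
proof (intro conjI ballI)
  note [measurable] = box_density_measurable
  show "marginal i f \<in> borel_measurable (lborelP J)"
    unfolding marginal_def by measurable
  fix z assume z: "z \<in> space (lborelP J)"
  note slice = box_density_slice[OF z]
  show "0 \<le> marginal i f z" by (rule marginal_nonneg[OF z])
  have "marginal i f z \<le> (LINT s|lborel. C * indicator {-R..R} s)"
    unfolding marginal_def
    by (intro integral_mono bounded_density_integrable[OF slice] integrable_mult_right
        integrable_real_indicator bounded_density_bound[OF slice R])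
       (auto simp: emeasure_lborel_Icc_eq)
  then show "marginal i f z \<le> 2 * R * C" using R by (simp add: mult_ac)
  show "marginal i f z \<noteq> 0 \<longrightarrow> (\<forall>j\<in>J. \<bar>z j\<bar> \<le> R)"
  proof (rule impI, rule ccontr)
    assume "marginal i f z \<noteq> 0" "\<not> (\<forall>j\<in>J. \<bar>z j\<bar> \<le> R)"
    then obtain j where j: "j \<in> J" "\<not> \<bar>z j\<bar> \<le> R" by blast
    have "f (z(i := s)) = 0" for s
    proof (rule ccontr)
      assume "f (z(i := s)) \<noteq> 0"
      then have "\<forall>j\<in>insert i J. \<bar>(z(i := s)) j\<bar> \<le> R"
        using f fun_upd_space_lborelP[OF z] unfolding box_density_def by blast
      then have "\<bar>(z(i := s)) j\<bar> \<le> R" using j by blast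
      then show False using j J by (auto split: if_splits)
    qed
    with \<open>marginal i f z \<noteq> 0\<close> show False by (simp add: marginal_def)
  qed
qed

lemma nn_integral_marginal:
  "(\<integral>\<^sup>+x. ennreal (f x) \<partial>lborelP (insert i J)) = (\<integral>\<^sup>+z. ennreal (marginal i f z) \<partial>lborelP J)"
  by (subst lborel_product.product_nn_integral_insert[OF J])
     (use box_density_measurable in \<open>auto intro!: nn_integral_cong simp: ennreal_marginal\<close>)

lemma box_density_conditional:
  assumes "z \<in> space (lborelP J)" "0 < marginal i f z"
  shows "bounded_density (C / marginal i f z) R (\<lambda>s. f (z(i := s)) / marginal i f z)"
    and "(LINT s|lborel. f (z(i := s)) / marginal i f z) = 1"
proof -
  note slice = box_density_slice[OF assms(1)]
  show "bounded_density (C / marginal i f z) R (\<lambda>s. f (z(i := s)) / marginal i f z)"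
    unfolding bounded_density_def
  proof (intro conjI allI)
    show "(\<lambda>s. f (z(i := s)) / marginal i f z) \<in> borel_measurable borel"
      using bounded_density_measurable[OF slice R] by measurable
    fix s
    show "0 \<le> f (z(i := s)) / marginal i f z"
      using bounded_density_nonneg[OF slice R] assms(2) by simp
    show "f (z(i := s)) / marginal i f z \<le> C / marginal i f z * indicator {- R..R} s"
      using divide_right_mono[OF bounded_density_bound[OF slice R, of s], of "marginal i f z"] assms(2)
      by simp
  qed
  show "(LINT s|lborel. f (z(i := s)) / marginal i f z) = 1"
    using assms(2) by (simp add: marginal_def)
qed

end

text \<open>In this form joint measurability in the argument and in parameters of the density is
  found automatically; it is used for the fibrewise quantile maps.\<close>

lemma lower_mass_eq: "lower_mass f x = (LINT s|lborel. (if s \<le> x then f s else 0))"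
  unfolding lower_mass_def by (intro Bochner_Integration.integral_cong) auto

text \<open>The map is triangular: \<open>TJ\<close> transports the marginals, and the fibre over
  \<open>z\<close> goes to the fibre over \<open>TJ z\<close> by the quantile map between the
  conditional densities. Marginal and conditional densities multiply to the full density, and so do
  their ratios. The weak inequality in direction \<open>i\<close> is the one-dimensional one on each
  fibre; in a direction of \<open>J\<close> it is the induction hypothesis at fixed
  \<open>x i\<close>, since \<open>TJ\<close> does not depend on that coordinate.\<close>

lemma knothe_map_insert:
  fixes J :: "'i set" and i :: 'i
  assumes J: "finite J" "i \<notin> J" and R: "0 \<le> R"
    and f: "box_density (insert i J) C R f" and g: "box_density (insert i J) C' R g"
    and IH: "knothe_map J R (marginal i f) (marginal i g) TJ dJ"
  shows "\<exists>T d. knothe_map (insert i J) R f g T d"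
proof -
  let ?I = "insert i J"
  note [measurable] = box_density_measurable[OF J R f] box_density_measurable[OF J R g]
  define fJ gJ where "fJ = marginal i f" and "gJ = marginal i g"
  have fJ [measurable]: "fJ \<in> borel_measurable (lborelP J)"
    and gJ [measurable]: "gJ \<in> borel_measurable (lborelP J)"
    using box_density_marginal[OF J R f] box_density_marginal[OF J R g]
    by (auto simp: box_density_def fJ_def gJ_def)
  have TJ [measurable]: "TJ \<in> lborelP J \<rightarrow>\<^sub>M lborelP J"
    and TJ_bound: "\<And>z j. z \<in> space (lborelP J) \<Longrightarrow> j \<in> J \<Longrightarrow> \<bar>TJ z j\<bar> \<le> R"
    and TJ_push: "\<And>\<phi>. \<phi> \<in> borel_measurable (lborelP J) \<Longrightarrow>
      (\<integral>\<^sup>+x. \<phi> (TJ x) * ennreal (fJ x) \<partial>lborelP J) = (\<integral>\<^sup>+y. \<phi> y * ennreal (gJ y) \<partial>lborelP J)"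
    and dJ [measurable]: "\<And>j. j \<in> J \<Longrightarrow> dJ j \<in> borel_measurable (lborelP J)"
    and dJ_nonneg: "\<And>j x. j \<in> J \<Longrightarrow> x \<in> space (lborelP J) \<Longrightarrow> 0 \<le> dJ j x"
    and TJ_AE: "AE x in lborelP J. 0 < fJ x \<longrightarrow> 0 < gJ (TJ x) \<and> (\<Prod>i\<in>J. dJ i x) = fJ x / gJ (TJ x)"
    and TJ_weak: "\<And>j \<psi> \<psi>'. j \<in> J \<Longrightarrow> coord_test J j \<psi> \<psi>' \<Longrightarrow>
      (\<integral>\<^sup>+x. ennreal (\<psi> x * dJ j x) + ennreal (max 0 (\<psi>' x) * (TJ x j + R)) \<partial>lborelP J)
        \<le> (\<integral>\<^sup>+x. ennreal (max 0 (- \<psi>' x) * (TJ x j + R)) \<partial>lborelP J)"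
    using IH unfolding knothe_map_def fJ_def gJ_def by blast+
  have TJ_space: "TJ z \<in> space (lborelP J)" if "z \<in> space (lborelP J)" for z
    using measurable_space[OF TJ that] .
  \<comment> \<open>The fibres on which both conditional densities exist. Up to null sets the others
    carry no mass of \<open>f\<close>, so the default value 0 of \<open>Ti\<close> and
    \<open>di\<close> there does not disturb the transport.\<close>
  define good where "good z \<longleftrightarrow> 0 < fJ z \<and> 0 < gJ (TJ z)" for z
  have [measurable]: "Measurable.pred (lborelP J) good"
    unfolding good_def by measurable
  define fn where "fn z s = f (z(i := s)) / fJ z" for z s
  define gn where "gn w s = g (w(i := s)) / gJ w" for w s
  define Ti where "Ti z s = (if good z then quantile_map R (fn z) (gn (TJ z)) s else 0)" for z s
  define di where "di z s = (if good z then fn z s / gn (TJ z) (Ti z s) else 0)" for z s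
  define T where "T x = (TJ (restrict x J))(i := Ti (restrict x J) (x i))" for x
  define d where "d j x = (if j = i then di (restrict x J) (x i) else dJ j (restrict x J))" for j x

  have fn_meas: "(\<lambda>x. fn (h x) (k x)) \<in> borel_measurable M"
    if [measurable]: "h \<in> M \<rightarrow>\<^sub>M lborelP J" "k \<in> borel_measurable M" for h k and M :: "'z measure"
    unfolding fn_def by measurable
  have gn_meas: "(\<lambda>x. gn (h x) (k x)) \<in> borel_measurable M"
    if [measurable]: "h \<in> M \<rightarrow>\<^sub>M lborelP J" "k \<in> borel_measurable M" for h k and M :: "'z measure"
    unfolding gn_def by measurable
  have fn: "bounded_density (C / fJ z) R (fn z)" "(LINT s|lborel. fn z s) = 1"
    if "z \<in> space (lborelP J)" "good z" for z
    using box_density_conditional[OF J R f that(1)] that(2)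
    by (simp_all add: fn_def[abs_def] fJ_def good_def)
  have gn: "bounded_density (C' / gJ (TJ z)) R (gn (TJ z))" "(LINT s|lborel. gn (TJ z) s) = 1"
    if "z \<in> space (lborelP J)" "good z" for z
    using box_density_conditional[OF J R g TJ_space[OF that(1)]] that(2)
    by (simp_all add: gn_def[abs_def] gJ_def good_def)
  have fJ_nonneg: "0 \<le> fJ z" if "z \<in> space (lborelP J)" for z
    using marginal_nonneg[OF J R f that] by (simp add: fJ_def)
  have gJ_nonneg: "0 \<le> gJ z" if "z \<in> space (lborelP J)" for z
    using marginal_nonneg[OF J R g that] by (simp add: gJ_def)

  have Ti_le: "Ti z s \<le> y \<longleftrightarrow> (if good z then R \<le> y \<or> -R \<le> y \<and> lower_mass (fn z) s \<le> lower_mass (gn (TJ z)) y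
      else 0 \<le> y)" if z: "z \<in> space (lborelP J)" for z s y
    using quantile_map_le_iff[OF fn(1)[OF z] gn(1)[OF z] R fn(2)[OF z] gn(2)[OF z], of y s]
      quantile_map_range[OF fn(1)[OF z] gn(1)[OF z] R fn(2)[OF z] gn(2)[OF z], of s]
    by (cases "y \<in> {-R..R}") (auto simp: Ti_def)
  \<comment> \<open>Joint measurability in the fibre and the point: by \<open>Ti_le\<close> the
    sublevel sets are described by distribution functions, which avoids the infimum over an
    uncountable set.\<close>
  have Ti_meas: "(\<lambda>x. Ti (h x) (k x)) \<in> borel_measurable M"
    if [measurable]: "h \<in> M \<rightarrow>\<^sub>M lborelP J" "k \<in> borel_measurable M" for h k and M :: "'z measure"
  proof (subst borel_measurable_iff_le, intro allI)
    fix y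
    note [measurable] = fn_meas gn_meas
    have "{x \<in> space M. Ti (h x) (k x) \<le> y} = {x \<in> space M. if good (h x) then R \<le> y \<or> -R \<le> y \<and>
        lower_mass (fn (h x)) (k x) \<le> lower_mass (gn (TJ (h x))) y else 0 \<le> y}"
      using Ti_le measurable_space[OF that(1)] by blast
    also have "\<dots> \<in> sets M"
      unfolding lower_mass_eq by measurable
    finally show "{x \<in> space M. Ti (h x) (k x) \<le> y} \<in> sets M" .
  qed
  have di_meas: "(\<lambda>x. di (h x) (k x)) \<in> borel_measurable M"
    if [measurable]: "h \<in> M \<rightarrow>\<^sub>M lborelP J" "k \<in> borel_measurable M" for h k and M :: "'z measure"
  proof -
    note [measurable] = fn_meas gn_meas Ti_meas
    show ?thesis unfolding di_def by measurable
  qed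
  have restrict_J [measurable]: "(\<lambda>x. restrict x J) \<in> lborelP ?I \<rightarrow>\<^sub>M lborelP J"
    by (rule measurable_restrict_subset) auto
  have component_i [measurable]: "(\<lambda>x. x i) \<in> borel_measurable (lborelP ?I)"
    using measurable_component_singleton[of i ?I "\<lambda>_. lborel"] by simp
  note [measurable] = Ti_meas di_meas
  have T [measurable]: "T \<in> lborelP ?I \<rightarrow>\<^sub>M lborelP ?I"
    unfolding T_def by measurable
  have d [measurable]: "d j \<in> borel_measurable (lborelP ?I)" if "j \<in> ?I" for j
    using that unfolding d_def by (cases "j = i") auto
  have restr: "restrict (z(i := s)) J = z" if "z \<in> space (lborelP J)" for z s
    using that J by (auto simp: space_PiM PiE_iff extensional_def restrict_def fun_eq_iff)
  have T_upd: "T (z(i := s)) = (TJ z)(i := Ti z s)" if "z \<in> space (lborelP J)" for z s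
    using that by (simp add: T_def restr)
  have d_upd: "d j (z(i := s)) = (if j = i then di z s else dJ j z)" if "z \<in> space (lborelP J)" for j z s
    using that by (simp add: d_def restr)
  have Ti_bound: "\<bar>Ti z s\<bar> \<le> R" if z: "z \<in> space (lborelP J)" for z s
    using quantile_map_range[OF fn(1)[OF z] gn(1)[OF z] R fn(2)[OF z] gn(2)[OF z], of s] R
    by (auto simp: Ti_def abs_le_iff)
  have split_x: "\<exists>z\<in>space (lborelP J). x = z(i := x i)" if "x \<in> space (lborelP ?I)" for x
    using that J by (intro bexI[of _ "restrict x J"])
      (auto simp: space_PiM PiE_iff extensional_def restrict_def fun_eq_iff)

  have push: "(\<integral>\<^sup>+x. \<phi> (T x) * ennreal (f x) \<partial>lborelP ?I) = (\<integral>\<^sup>+y. \<phi> y * ennreal (g y) \<partial>lborelP ?I)"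
    if [measurable]: "\<phi> \<in> borel_measurable (lborelP ?I)" for \<phi>
  proof -
    note [measurable] = fn_meas gn_meas
    \<comment> \<open>Averaging over the conditional target density on the fibre reduces the claim
      to the transport property of \<open>TJ\<close>, applied to this function of the remaining
      coordinates.\<close>
    define \<Phi> where "\<Phi> w = (\<integral>\<^sup>+y. \<phi> (w(i := y)) * ennreal (gn w y) \<partial>lborel)" for w
    have [measurable]: "\<Phi> \<in> borel_measurable (lborelP J)"
      unfolding \<Phi>_def by measurable
    have "(\<integral>\<^sup>+x. \<phi> (T x) * ennreal (f x) \<partial>lborelP ?I)
        = (\<integral>\<^sup>+z. \<integral>\<^sup>+s. \<phi> (T (z(i := s))) * ennreal (f (z(i := s))) \<partial>lborel \<partial>lborelP J)"
      by (intro lborel_product.product_nn_integral_insert J) measurable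
    also have "\<dots> = (\<integral>\<^sup>+z. \<Phi> (TJ z) * ennreal (fJ z) \<partial>lborelP J)"
    proof (rule nn_integral_cong_AE)
      show "AE z in lborelP J. (\<integral>\<^sup>+s. \<phi> (T (z(i := s))) * ennreal (f (z(i := s))) \<partial>lborel)
          = \<Phi> (TJ z) * ennreal (fJ z)"
        using TJ_AE AE_space
      proof eventually_elim
        case (elim z)
        note z = elim(2)
        show ?case
        proof (cases "fJ z = 0")
          case True
          have "(\<integral>\<^sup>+s. \<phi> (T (z(i := s))) * ennreal (f (z(i := s))) \<partial>lborel) = (\<integral>\<^sup>+s. 0 \<partial>(lborel :: real measure))"
            using marginal_eq_0_AE[OF J R f z] True
            by (intro nn_integral_cong_AE) (auto simp: fJ_def elim!: eventually_mono)
          then show ?thesis using True by simp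
        next
          case False
          then have good: "good z" using fJ_nonneg[OF z] elim(1) by (simp add: good_def)
          have pos: "0 < fJ z" using good by (simp add: good_def)
          have sl [measurable]: "(\<lambda>y. (TJ z)(i := y)) \<in> borel \<rightarrow>\<^sub>M lborelP ?I"
            by (rule measurable_slice_lborelP[OF TJ_space[OF z]])
          have [measurable]: "(\<lambda>y. \<phi> ((TJ z)(i := y))) \<in> borel_measurable borel" by measurable
          have qm: "quantile_map R (fn z) (gn (TJ z)) \<in> borel_measurable borel"
            by (rule quantile_map_borel[OF fn(1)[OF z good] gn(1)[OF z good] R fn(2)[OF z good] gn(2)[OF z good]])
          have m1: "(\<lambda>s. \<phi> ((TJ z)(i := quantile_map R (fn z) (gn (TJ z)) s))) \<in> borel_measurable borel"
            by (rule measurable_compose[OF qm]) measurable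
          note m2 = bounded_density_measurable[OF fn(1)[OF z good] R]
          have "(\<integral>\<^sup>+s. \<phi> (T (z(i := s))) * ennreal (f (z(i := s))) \<partial>lborel)
             = (\<integral>\<^sup>+s. \<phi> ((TJ z)(i := quantile_map R (fn z) (gn (TJ z)) s)) * ennreal (fn z s) * ennreal (fJ z) \<partial>lborel)"
          proof (intro nn_integral_cong)
            fix s
            have "ennreal (f (z(i := s))) = ennreal (fn z s) * ennreal (fJ z)"
              using pos bounded_density_nonneg[OF fn(1)[OF z good] R, of s]
              by (simp add: ennreal_mult[symmetric] fn_def)
            then show "\<phi> (T (z(i := s))) * ennreal (f (z(i := s)))
              = \<phi> ((TJ z)(i := quantile_map R (fn z) (gn (TJ z)) s)) * ennreal (fn z s) * ennreal (fJ z)"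
              using good by (simp add: T_upd[OF z] Ti_def mult.assoc)
          qed
          also have "\<dots> = (\<integral>\<^sup>+s. \<phi> ((TJ z)(i := quantile_map R (fn z) (gn (TJ z)) s)) * ennreal (fn z s) \<partial>lborel) * ennreal (fJ z)"
            using m1 m2 by (intro nn_integral_multc) simp
          also have "(\<integral>\<^sup>+s. \<phi> ((TJ z)(i := quantile_map R (fn z) (gn (TJ z)) s)) * ennreal (fn z s) \<partial>lborel) = \<Phi> (TJ z)"
            unfolding \<Phi>_def
            by (rule nn_integral_quantile_map[OF fn(1)[OF z good] gn(1)[OF z good] R fn(2)[OF z good] gn(2)[OF z good]])
               measurable
          finally show ?thesis .
        qed
      qed
    qed
    also have "\<dots> = (\<integral>\<^sup>+w. \<Phi> w * ennreal (gJ w) \<partial>lborelP J)"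
      by (rule TJ_push) measurable
    also have "\<dots> = (\<integral>\<^sup>+w. \<integral>\<^sup>+y. \<phi> (w(i := y)) * ennreal (g (w(i := y))) \<partial>lborel \<partial>lborelP J)"
    proof (rule nn_integral_cong)
      fix w assume w: "w \<in> space (lborelP J)"
      note sl [measurable] = measurable_slice_lborelP[OF w, of i]
      show "\<Phi> w * ennreal (gJ w) = (\<integral>\<^sup>+y. \<phi> (w(i := y)) * ennreal (g (w(i := y))) \<partial>lborel)"
      proof (cases "gJ w = 0")
        case True
        have "(\<integral>\<^sup>+y. \<phi> (w(i := y)) * ennreal (g (w(i := y))) \<partial>lborel) = (\<integral>\<^sup>+s. 0 \<partial>(lborel :: real measure))"
          using marginal_eq_0_AE[OF J R g w] True
          by (intro nn_integral_cong_AE) (auto simp: gJ_def elim!: eventually_mono)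
        then show ?thesis using True by simp
      next
        case False
        then have pos: "0 < gJ w" using gJ_nonneg[OF w] by simp
        have "\<Phi> w * ennreal (gJ w) = (\<integral>\<^sup>+y. \<phi> (w(i := y)) * ennreal (gn w y) * ennreal (gJ w) \<partial>lborel)"
        proof -
          have "(\<lambda>y. gn w y) \<in> borel_measurable borel"
            unfolding gn_def by measurable
          moreover have "(\<lambda>y. \<phi> (w(i := y))) \<in> borel_measurable borel" by measurable
          ultimately show ?thesis
            unfolding \<Phi>_def by (intro nn_integral_multc[symmetric]) simp
        qed
        also have "\<dots> = (\<integral>\<^sup>+y. \<phi> (w(i := y)) * ennreal (g (w(i := y))) \<partial>lborel)"
          using pos bounded_density_nonneg[OF box_density_slice[OF J R g w] R]
          by (intro nn_integral_cong) (simp add: gn_def mult.assoc ennreal_mult[symmetric])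
        finally show ?thesis .
      qed
    qed
    also have "\<dots> = (\<integral>\<^sup>+y. \<phi> y * ennreal (g y) \<partial>lborelP ?I)"
      by (intro lborel_product.product_nn_integral_insert[symmetric] J) measurable
    finally show ?thesis .
  qed

  have ae: "AE x in lborelP ?I. 0 < f x \<longrightarrow> 0 < g (T x) \<and> (\<Prod>j\<in>?I. d j x) = f x / g (T x)"
  proof (rule AE_lborelP_insert[OF J])
    have [measurable]: "(\<lambda>x. \<Prod>j\<in>?I. d j x) \<in> borel_measurable (lborelP ?I)"
      by (rule borel_measurable_prod) (rule d)
    have q: "(\<lambda>x. f x / g (T x)) \<in> borel_measurable (lborelP ?I)" by measurable
    have [measurable]: "Measurable.pred (lborelP ?I) (\<lambda>x. (\<Prod>j\<in>?I. d j x) = f x / g (T x))"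
      unfolding pred_def by (rule borel_measurable_eq[OF _ q]) measurable
    show "Measurable.pred (lborelP ?I) (\<lambda>x. 0 < f x \<longrightarrow> 0 < g (T x) \<and> (\<Prod>j\<in>?I. d j x) = f x / g (T x))"
      by measurable
    show "AE z in lborelP J. AE s in lborel. 0 < f (z(i := s)) \<longrightarrow> 0 < g (T (z(i := s))) \<and>
        (\<Prod>j\<in>?I. d j (z(i := s))) = f (z(i := s)) / g (T (z(i := s)))"
      using TJ_AE AE_space
    proof eventually_elim
      case (elim z)
      note z = elim(2)
      show ?case
      proof (cases "fJ z = 0")
        case True
        then show ?thesis
          using marginal_eq_0_AE[OF J R f z] by (auto simp: fJ_def elim!: eventually_mono)
      next
        case False
        then have good: "good z" using fJ_nonneg[OF z] elim(1) by (simp add: good_def)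
        then have pos: "0 < fJ z" "0 < gJ (TJ z)" by (auto simp: good_def)
        let ?q = "quantile_map R (fn z) (gn (TJ z))"
        note nD = fn(1)[OF z good] gn(1)[OF z good] R fn(2)[OF z good] gn(2)[OF z good]
        note gm = bounded_density_measurable[OF nD(2) R]
        \<comment> \<open>Transporting the indicator of the zero set of the target density gives
          integral 0, so almost no mass of the source lands where the target density
          vanishes.\<close>
        let ?\<phi> = "\<lambda>y. if gn (TJ z) y = 0 then 1 else 0 :: ennreal"
        have [measurable]: "?\<phi> \<in> borel_measurable borel" using gm by measurable
        have "(\<integral>\<^sup>+s. ?\<phi> (?q s) * ennreal (fn z s) \<partial>lborel)
            = (\<integral>\<^sup>+y. ?\<phi> y * ennreal (gn (TJ z) y) \<partial>lborel)"
          by (rule nn_integral_quantile_map[OF nD]) measurable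
        also have "\<dots> = (\<integral>\<^sup>+y. 0 \<partial>(lborel :: real measure))"
          by (intro nn_integral_cong) auto
        finally have 0: "(\<integral>\<^sup>+s. ?\<phi> (?q s) * ennreal (fn z s) \<partial>lborel) = 0" by simp
        have "(\<lambda>s. ?\<phi> (?q s)) \<in> borel_measurable borel"
          by (rule measurable_compose[OF quantile_map_borel[OF nD]]) measurable
        moreover have "(\<lambda>s. ennreal (fn z s)) \<in> borel_measurable borel"
          using bounded_density_measurable[OF nD(1) R] by simp
        ultimately have "(\<lambda>s. ?\<phi> (?q s) * ennreal (fn z s)) \<in> borel_measurable lborel" by simp
        from nn_integral_0_iff_AE[OF this] 0
        have "AE s in lborel. ?\<phi> (?q s) * ennreal (fn z s) = 0" by simp
        then show ?thesis
        proof eventually_elim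
          case (elim s)
          show ?case
          proof
            assume "0 < f (z(i := s))"
            then have fpos: "0 < fn z s" using pos by (simp add: fn_def)
            then have "gn (TJ z) (?q s) \<noteq> 0" using elim by (auto split: if_splits)
            then have gpos: "0 < gn (TJ z) (?q s)"
              using bounded_density_nonneg[OF nD(2) R, of "?q s"] by simp
            have geq: "g (T (z(i := s))) = gn (TJ z) (?q s) * gJ (TJ z)"
              using good pos by (simp add: T_upd[OF z] Ti_def gn_def)
            have "(\<Prod>j\<in>?I. d j (z(i := s))) = di z s * (\<Prod>j\<in>J. dJ j z)"
              using J by (simp add: d_upd[OF z]) (intro disjI2 prod.cong; auto)
            also have "\<dots> = f (z(i := s)) / g (T (z(i := s)))"
              using \<open>0 < fJ z \<longrightarrow> 0 < gJ (TJ z) \<and> (\<Prod>i\<in>J. dJ i z) = fJ z / gJ (TJ z)\<close> pos gpos good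
              by (simp add: geq di_def Ti_def fn_def field_simps)
            finally show "0 < g (T (z(i := s))) \<and>
                (\<Prod>j\<in>?I. d j (z(i := s))) = f (z(i := s)) / g (T (z(i := s)))"
              using geq gpos pos by simp
          qed
        qed
      qed
    qed
  qed

  have weak: "(\<integral>\<^sup>+x. ennreal (\<psi> x * d j x) + ennreal (max 0 (\<psi>' x) * (T x j + R)) \<partial>lborelP ?I)
        \<le> (\<integral>\<^sup>+x. ennreal (max 0 (- \<psi>' x) * (T x j + R)) \<partial>lborelP ?I)"
    if j: "j \<in> ?I" and test: "coord_test ?I j \<psi> \<psi>'" for j \<psi> \<psi>'
  proof -
    have [measurable]: "\<psi> \<in> borel_measurable (lborelP ?I)" "\<psi>' \<in> borel_measurable (lborelP ?I)"
      and line: "\<And>x. x \<in> space (lborelP ?I) \<Longrightarrow> line_test (\<lambda>t. \<psi> (x(j := t))) (\<lambda>t. \<psi>' (x(j := t)))"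
      using test by (auto simp: coord_test_def)
    have Tj [measurable]: "(\<lambda>x. T x j) \<in> borel_measurable (lborelP ?I)"
      using measurable_compose[OF T measurable_component_singleton[OF j, of "\<lambda>_. lborel"]] by simp
    note [measurable] = d[OF j]
    let ?l = "\<lambda>x. ennreal (\<psi> x * d j x) + ennreal (max 0 (\<psi>' x) * (T x j + R))"
    let ?r = "\<lambda>x. ennreal (max 0 (- \<psi>' x) * (T x j + R))"
    show ?thesis
    proof (cases "j = i")
      case True
      have "(\<integral>\<^sup>+x. ?l x \<partial>lborelP ?I) = (\<integral>\<^sup>+z. \<integral>\<^sup>+s. ?l (z(i := s)) \<partial>lborel \<partial>lborelP J)"
        by (intro lborel_product.product_nn_integral_insert J) measurable
      also have "\<dots> \<le> (\<integral>\<^sup>+z. \<integral>\<^sup>+s. ?r (z(i := s)) \<partial>lborel \<partial>lborelP J)"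
      proof (rule nn_integral_mono)
        fix z assume z: "z \<in> space (lborelP J)"
        have lt: "line_test (\<lambda>s. \<psi> (z(i := s))) (\<lambda>s. \<psi>' (z(i := s)))"
          using line[OF fun_upd_space_lborelP[OF z, of i undefined]] True by simp
        show "(\<integral>\<^sup>+s. ?l (z(i := s)) \<partial>lborel) \<le> (\<integral>\<^sup>+s. ?r (z(i := s)) \<partial>lborel)"
        proof (cases "good z")
          case good: True
          note nD = fn(1)[OF z good] gn(1)[OF z good] R fn(2)[OF z good] gn(2)[OF z good]
          show ?thesis
            using quantile_map_weak_derivative[OF nD lt] good
            by (simp add: True T_upd[OF z] d_upd[OF z] Ti_def di_def)
        next
          case False
          \<comment> \<open>On the exceptional fibres the map is constantly 0 and \<open>di\<close>
            vanishes. The inequality is then an equality, because the derivative of a compactly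
            supported function has integral zero.\<close>
          let ?h = "\<lambda>s. - \<psi>' (z(i := s)) * R"
          have i0: "integrable lborel ?h" and e0: "integral\<^sup>L lborel ?h = 0"
            using line_test_total[OF lt] by (auto simp: has_bochner_integral_iff)
          have "(\<integral>\<^sup>+s. ennreal (max 0 (?h s)) \<partial>lborel) = (\<integral>\<^sup>+s. ennreal (max 0 (- ?h s)) \<partial>lborel)"
            using nn_integral_pos_part_eq[OF i0, unfolded e0] by simp
          moreover have "max 0 (?h s) = max 0 (- \<psi>' (z(i := s))) * R"
            "max 0 (- ?h s) = max 0 (\<psi>' (z(i := s))) * R" for s
            using R by (auto simp: max_def zero_le_mult_iff mult_le_0_iff)
          ultimately show ?thesis
            using False by (simp add: True T_upd[OF z] d_upd[OF z] Ti_def di_def)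
        qed
      qed
      also have "\<dots> = (\<integral>\<^sup>+x. ?r x \<partial>lborelP ?I)"
        by (intro lborel_product.product_nn_integral_insert[symmetric] J) measurable
      finally show ?thesis .
    next
      case False
      then have jJ: "j \<in> J" using j by simp
      have "(\<integral>\<^sup>+x. ?l x \<partial>lborelP ?I) = (\<integral>\<^sup>+s. \<integral>\<^sup>+z. ?l (z(i := s)) \<partial>lborelP J \<partial>lborel)"
        by (intro lborel_product.product_nn_integral_insert_rev J) measurable
      also have "\<dots> \<le> (\<integral>\<^sup>+s. \<integral>\<^sup>+z. ?r (z(i := s)) \<partial>lborelP J \<partial>lborel)"
      proof (rule nn_integral_mono)
        fix s :: real
        have "coord_test J j (\<lambda>z. \<psi> (z(i := s))) (\<lambda>z. \<psi>' (z(i := s)))"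
          unfolding coord_test_def
        proof (intro conjI ballI)
          fix z assume z: "z \<in> space (lborelP J)"
          show "line_test (\<lambda>t. \<psi> (z(j := t, i := s))) (\<lambda>t. \<psi>' (z(j := t, i := s)))"
            using line[OF fun_upd_space_lborelP[OF z, of i s]] False by (simp add: fun_upd_twist)
        qed measurable
        from TJ_weak[OF jJ this]
        have "(\<integral>\<^sup>+z. ennreal (\<psi> (z(i := s)) * dJ j z) + ennreal (max 0 (\<psi>' (z(i := s))) * (TJ z j + R)) \<partial>lborelP J)
          \<le> (\<integral>\<^sup>+z. ennreal (max 0 (- \<psi>' (z(i := s))) * (TJ z j + R)) \<partial>lborelP J)" .
        moreover have "?l (z(i := s)) = ennreal (\<psi> (z(i := s)) * dJ j z) + ennreal (max 0 (\<psi>' (z(i := s))) * (TJ z j + R))"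
          "?r (z(i := s)) = ennreal (max 0 (- \<psi>' (z(i := s))) * (TJ z j + R))" if "z \<in> space (lborelP J)" for z
          using False that by (simp_all add: T_upd d_upd)
        ultimately show "(\<integral>\<^sup>+z. ?l (z(i := s)) \<partial>lborelP J) \<le> (\<integral>\<^sup>+z. ?r (z(i := s)) \<partial>lborelP J)"
          by (simp cong: nn_integral_cong)
      qed
      also have "\<dots> = (\<integral>\<^sup>+x. ?r x \<partial>lborelP ?I)"
        by (intro lborel_product.product_nn_integral_insert_rev[symmetric] J) measurable
      finally show ?thesis .
    qed
  qed

  have "\<bar>T x j\<bar> \<le> R" if x: "x \<in> space (lborelP ?I)" and j: "j \<in> ?I" for x j
  proof -
    obtain z where z: "z \<in> space (lborelP J)" "x = z(i := x i)" using split_x[OF x] by blast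
    have "T x = (TJ z)(i := Ti z (x i))" using T_upd[OF z(1), of "x i"] z(2) by simp
    then show ?thesis using j TJ_bound[OF z(1)] Ti_bound[OF z(1)] by auto
  qed
  moreover have "0 \<le> d j x" if x: "x \<in> space (lborelP ?I)" and j: "j \<in> ?I" for x j
  proof -
    obtain z where z: "z \<in> space (lborelP J)" "x = z(i := x i)" using split_x[OF x] by blast
    have "0 \<le> di z s" for s
      using bounded_density_nonneg[OF fn(1)[OF z(1)] R] bounded_density_nonneg[OF gn(1)[OF z(1)] R]
      by (auto simp: di_def)
    then have "0 \<le> d j (z(i := x i))" using dJ_nonneg[OF _ z(1)] j by (auto simp: d_upd[OF z(1)])
    then show ?thesis using z(2) by simp
  qed
  ultimately have "knothe_map ?I R f g T d"
    unfolding knothe_map_def using T push d ae weak by blast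
  then show ?thesis by blast
qed

lemma knothe_map_exists:
  assumes "finite I" "0 \<le> R" "box_density I C R f" "box_density I C' R g"
    and "(\<integral>\<^sup>+x. ennreal (f x) \<partial>lborelP I) = (\<integral>\<^sup>+x. ennreal (g x) \<partial>lborelP I)"
  shows "\<exists>T d. knothe_map I R f g T d"
  using assms(1,3-5)
proof (induction I arbitrary: f g C C' rule: finite_induct)
  case empty
  let ?u = "\<lambda>_. undefined :: real"
  have sp: "space (lborelP ({} :: 'a set)) = {?u}" by (simp add: space_PiM)
  have u: "ennreal (f ?u) = ennreal (g ?u)"
    using empty.prems(3) by (simp add: lborel_product.nn_integral_empty)
  moreover have "0 \<le> f ?u" "0 \<le> g ?u"
    using empty.prems(1,2) by (auto simp: box_density_def sp)
  ultimately have fg: "f ?u = g ?u" by simp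
  have "knothe_map {} R f g (\<lambda>x. x) (\<lambda>_ _. 0)"
    unfolding knothe_map_def
  proof (intro conjI)
    show "\<forall>\<phi>\<in>borel_measurable (lborelP {}).
      (\<integral>\<^sup>+x. \<phi> x * ennreal (f x) \<partial>lborelP {}) = (\<integral>\<^sup>+y. \<phi> y * ennreal (g y) \<partial>lborelP {})"
      by (intro ballI nn_integral_cong) (simp add: sp fg)
    show "AE x in lborelP {}. 0 < f x \<longrightarrow> 0 < g x \<and> (\<Prod>i\<in>{}. 0) = f x / g x"
      by (intro AE_I2) (simp add: sp fg)
  qed auto
  then show ?case by blast
next
  case (insert i J)
  note f = insert.prems(1) and g = insert.prems(2)
  have "\<exists>T d. knothe_map J R (marginal i f) (marginal i g) T d"
    using insert.prems(3)
    by (intro insert.IH[OF box_density_marginal[OF insert.hyps \<open>0 \<le> R\<close> f]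
          box_density_marginal[OF insert.hyps \<open>0 \<le> R\<close> g]])
       (simp add: nn_integral_marginal[OF insert.hyps \<open>0 \<le> R\<close> f] nn_integral_marginal[OF insert.hyps \<open>0 \<le> R\<close> g])
  then show ?case
    using knothe_map_insert[OF insert.hyps \<open>0 \<le> R\<close> f g] by blast
qed

section \<open>Weak divergence of the Knothe map on a Euclidean space\<close>

text \<open>Difference quotients of \<open>w\<close> have integral zero by translation invariance of
  the Lebesgue measure, and dominated convergence carries this to the derivative. The mean value
  theorem bounds the quotients by \<open>M\<close>; the steps are at most 1, so all quotients vanish
  outside one ball.\<close>

lemma integral_directional_derivative:
  fixes w w' :: "'a::euclidean_space \<Rightarrow> real"
  assumes der: "\<And>x. ((\<lambda>s. w (x + s *\<^sub>R b)) has_real_derivative w' x) (at 0)"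
    and w: "continuous_on UNIV w" and w' [measurable]: "w' \<in> borel_measurable borel"
    and bound: "\<And>x. \<bar>w' x\<bar> \<le> M" and supp: "\<And>x. K < norm x \<Longrightarrow> w x = 0"
  shows "integrable lborel w'" "(LINT x|lborel. w' x) = 0"
proof -
  have [measurable]: "w \<in> borel_measurable borel"
    by (rule borel_measurable_continuous_onI[OF w])
  have der': "((\<lambda>s. w (x + s *\<^sub>R b)) has_real_derivative w' (x + s *\<^sub>R b)) (at s)" for x s
  proof -
    have "w ((x + s *\<^sub>R b) + (r + - s) *\<^sub>R b) = w (x + r *\<^sub>R b)" for r
      by (simp add: scaleR_left_diff_distrib)
    then show ?thesis
      using der[of "x + s *\<^sub>R b"]
        DERIV_shift[of "\<lambda>r. w ((x + s *\<^sub>R b) + r *\<^sub>R b)" "w' (x + s *\<^sub>R b)" s "- s"] by simp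
  qed
  have M: "0 \<le> M" using bound[of 0] by linarith
  define s where "s k = 1 / (real k + 1)" for k :: nat
  have s: "0 < s k" "s k \<le> 1" for k by (auto simp: s_def)
  have s_lim: "s \<longlonglongrightarrow> 0"
    unfolding s_def using LIMSEQ_inverse_real_of_nat by (simp add: inverse_eq_divide add.commute)
  define q where "q k x = (w (x + s k *\<^sub>R b) - w x) / s k" for k x
  define B where "B x = M * indicator (cball 0 (\<bar>K\<bar> + norm b)) x" for x :: 'a
  have q_lim: "(\<lambda>k. q k x) \<longlonglongrightarrow> w' x" for x
  proof -
    have "((\<lambda>r. (w (x + r *\<^sub>R b) - w x) / r) \<longlongrightarrow> w' x) (at 0)"
      using der[of x] by (simp add: has_field_derivative_iff)
    moreover have "filterlim s (at 0) sequentially"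
      unfolding filterlim_at using s_lim s(1) by (auto simp: less_imp_neq[symmetric])
    ultimately show ?thesis
      unfolding q_def by (rule filterlim_compose)
  qed
  have q_bound: "norm (q k x) \<le> B x" for k x
  proof (cases "norm x \<le> \<bar>K\<bar> + norm b")
    case True
    have "norm (w (x + s k *\<^sub>R b) - w (x + 0 *\<^sub>R b)) \<le> M * norm (s k - 0)"
    proof (rule differentiable_bound[where S = UNIV and f' = "\<lambda>r h. w' (x + r *\<^sub>R b) * h"])
      show "((\<lambda>r. w (x + r *\<^sub>R b)) has_derivative (*) (w' (x + r *\<^sub>R b))) (at r within UNIV)" for r
        using der'[of x r] by (simp add: has_field_derivative_def)
      show "onorm ((*) (w' (x + r *\<^sub>R b))) \<le> M" for r
        by (rule onorm_le) (simp add: abs_mult bound mult_right_mono)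
    qed auto
    then have "\<bar>w (x + s k *\<^sub>R b) - w x\<bar> / s k \<le> M"
      using s[of k] by (simp add: divide_le_eq mult.commute)
    then show ?thesis
      using True s[of k] by (simp add: q_def B_def)
  next
    case False
    have "norm x - norm b \<le> norm (x + s k *\<^sub>R b)"
    proof -
      have "norm (s k *\<^sub>R b) \<le> norm b"
        using s[of k] by (simp add: mult_left_le_one_le)
      then show ?thesis using norm_diff_ineq[of x "s k *\<^sub>R b"] by linarith
    qed
    then have "K < norm x" "K < norm (x + s k *\<^sub>R b)"
      using False norm_ge_zero[of b] by linarith+
    then show ?thesis using M by (simp add: q_def B_def supp)
  qed
  have B: "integrable lborel B"
    unfolding B_def
    by (intro integrable_mult_right integrable_real_indicator)
       (auto simp: emeasure_cball add_nonneg_nonneg)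
  have w_int: "integrable lborel w"
  proof -
    have "integrable lborel (\<lambda>x. indicator (cball 0 \<bar>K\<bar>) x *\<^sub>R w x)"
      by (rule borel_integrable_compact) (auto intro: continuous_on_subset[OF w])
    moreover have "(\<lambda>x. indicator (cball 0 \<bar>K\<bar>) x *\<^sub>R w x) = w"
      using supp by (fastforce simp: indicator_def)
    ultimately show ?thesis by simp
  qed
  have q_meas: "q k \<in> borel_measurable lborel" for k unfolding q_def by measurable
  have q_int: "(LINT x|lborel. q k x) = 0" for k
  proof -
    have e: "lborel = distr lborel borel (\<lambda>x :: 'a. s k *\<^sub>R b + x)"
      by (rule lborel_distr_plus[symmetric])
    have "integrable (distr lborel borel (\<lambda>x :: 'a. s k *\<^sub>R b + x)) w"
      using w_int e by simp
    then have i: "integrable lborel (\<lambda>x. w (x + s k *\<^sub>R b))"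
      by (subst (asm) integrable_distr_eq) (auto simp: add.commute)
    have "(LINT x|distr lborel borel (\<lambda>x :: 'a. s k *\<^sub>R b + x). w x) = (LINT x|lborel. w (x + s k *\<^sub>R b))"
      by (subst integral_distr) (auto simp: add.commute)
    then have "(LINT x|lborel. w (x + s k *\<^sub>R b)) = (LINT x|lborel. w x)"
      using e by simp
    then show ?thesis using i w_int by (simp add: q_def)
  qed
  show "integrable lborel w'"
    by (rule integrable_dominated_convergence[where s = q, OF _ q_meas B])
       (use q_lim q_bound in auto)
  have "(\<lambda>k. LINT x|lborel. q k x) \<longlonglongrightarrow> (LINT x|lborel. w' x)"
    by (rule integral_dominated_convergence[where s = q, OF _ q_meas B])
       (use q_lim q_bound in auto)
  then show "(LINT x|lborel. w' x) = 0"
    by (simp add: q_int LIMSEQ_const_iff)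
qed

text \<open>Compactly supported C^1 functions again, but with the gradient as an explicit argument
  and the support given by a radius. This spares evaluations of \<open>grad\<close> until the final
  statement; the passage to \<open>C1c\<close> and back is made near the end.\<close>

definition bump :: "('a::euclidean_space \<Rightarrow> real) \<Rightarrow> ('a \<Rightarrow> 'a) \<Rightarrow> bool"
  where "bump \<psi> G \<longleftrightarrow> (\<forall>x. GDERIV \<psi> x :> G x) \<and> continuous_on UNIV G \<and>
    (\<exists>K. \<forall>x. K < norm x \<longrightarrow> \<psi> x = 0 \<and> G x = 0)"

context
  fixes \<psi> :: "'a::euclidean_space \<Rightarrow> real" and G :: "'a \<Rightarrow> 'a"
  assumes bump: "bump \<psi> G"
begin

lemma bump_continuous: "continuous_on UNIV \<psi>" "continuous_on UNIV G"
proof -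
  have "continuous (at x) \<psi>" for x
    using bump by (auto simp: bump_def gderiv_def intro: has_derivative_continuous)
  then show "continuous_on UNIV \<psi>" by (simp add: continuous_at_imp_continuous_on)
  show "continuous_on UNIV G" using bump by (simp add: bump_def)
qed

lemma bump_borel: "\<psi> \<in> borel_measurable borel" "G \<in> borel_measurable borel"
  using bump_continuous by (auto intro: borel_measurable_continuous_onI)

lemma bump_line:
  "((\<lambda>s. \<psi> (x + s *\<^sub>R b)) has_real_derivative G (x + s *\<^sub>R b) \<bullet> b) (at s)"
proof -
  have "(\<psi> has_derivative (\<lambda>h. h \<bullet> G (x + s *\<^sub>R b))) (at (x + s *\<^sub>R b))"
    using bump by (simp add: bump_def gderiv_def)
  then have "((\<lambda>s. \<psi> (x + s *\<^sub>R b)) has_derivative (\<lambda>r. (r *\<^sub>R b) \<bullet> G (x + s *\<^sub>R b))) (at s)"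
    by (intro has_derivative_compose[where f = "\<lambda>s. x + s *\<^sub>R b" and g = \<psi>])
       (auto intro!: derivative_eq_intros)
  then show ?thesis
    by (simp add: has_field_derivative_def inner_commute mult.commute[of _ "b \<bullet> _"])
qed

lemma bump_integrable_inner:
  assumes h: "h \<in> borel_measurable borel" "\<And>x. \<bar>h x\<bar> \<le> R"
  shows "integrable lborel (\<lambda>x. G x \<bullet> b * h x)"
proof -
  obtain K where K: "\<And>x. K < norm x \<Longrightarrow> G x = 0" using bump unfolding bump_def by blast
  have "integrable lborel (\<lambda>x. indicator (cball 0 \<bar>K\<bar>) x *\<^sub>R (G x \<bullet> b))"
    by (rule borel_integrable_compact)
       (auto intro!: continuous_intros continuous_on_subset[OF bump_continuous(2)])
  moreover have "(\<lambda>x. indicator (cball 0 \<bar>K\<bar>) x *\<^sub>R (G x \<bullet> b)) = (\<lambda>x. G x \<bullet> b)"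
    using K by (fastforce simp: indicator_def)
  ultimately have "integrable lborel (\<lambda>x. G x \<bullet> b)" by simp
  then have "integrable lborel (\<lambda>x. R * \<bar>G x \<bullet> b\<bar>)"
    by (intro integrable_mult_right integrable_abs)
  then show ?thesis
  proof (rule Bochner_Integration.integrable_bound)
    show "(\<lambda>x. G x \<bullet> b * h x) \<in> borel_measurable lborel"
      using bump_borel h by measurable
    have "\<bar>h x\<bar> * \<bar>G x \<bullet> b\<bar> \<le> \<bar>R\<bar> * \<bar>G x \<bullet> b\<bar>" for x
      by (intro mult_right_mono order_trans[OF h(2)]) auto
    then show "AE x in lborel. norm (G x \<bullet> b * h x) \<le> norm (R * \<bar>G x \<bullet> b\<bar>)"
      by (intro AE_I2) (simp add: abs_mult mult.commute)
  qed
qed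

lemma bump_integral_inner: "(LINT x|lborel. G x \<bullet> b) = 0"
proof -
  obtain K where K: "\<And>x. K < norm x \<Longrightarrow> \<psi> x = 0 \<and> G x = 0"
    using bump unfolding bump_def by blast
  have "compact ((\<lambda>x. G x \<bullet> b) ` cball 0 \<bar>K\<bar>)"
    by (intro compact_continuous_image continuous_intros continuous_on_subset[OF bump_continuous(2)]) auto
  then obtain M where M: "\<And>x. x \<in> cball 0 \<bar>K\<bar> \<Longrightarrow> \<bar>G x \<bullet> b\<bar> \<le> M"
    by (force dest: compact_imp_bounded simp: bounded_iff)
  have "\<bar>G x \<bullet> b\<bar> \<le> \<bar>M\<bar>" for x
    using M[of x] K[of x] by (cases "norm x \<le> \<bar>K\<bar>") force+
  then show ?thesis
    using K bump_borel bump_line[of _ b 0]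
    by (intro integral_directional_derivative(2)[OF _ bump_continuous(1), where M = "\<bar>M\<bar>" and K = K and b = b]) auto
qed

end

section \<open>From the product of lines to a Euclidean space\<close>

definition of_coords :: "('a::euclidean_space \<Rightarrow> real) \<Rightarrow> 'a"
  where "of_coords w = (\<Sum>b\<in>Basis. w b *\<^sub>R b)"

definition to_coords :: "'a::euclidean_space \<Rightarrow> 'a \<Rightarrow> real"
  where "to_coords x = restrict (\<lambda>b. x \<bullet> b) Basis"

lemma of_coords_measurable [measurable]:
  "(of_coords :: _ \<Rightarrow> 'a::euclidean_space) \<in> lborelP Basis \<rightarrow>\<^sub>M borel"
  unfolding of_coords_def[abs_def] by measurable

lemma to_coords_measurable [measurable]: "to_coords \<in> borel \<rightarrow>\<^sub>M lborelP Basis"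
  unfolding to_coords_def[abs_def] by (intro measurable_restrict) measurable

lemma of_to_coords [simp]: "of_coords (to_coords x) = x"
  by (simp add: of_coords_def to_coords_def euclidean_representation)

lemma to_of_coords: "w \<in> space (lborelP Basis) \<Longrightarrow> to_coords (of_coords w) = w"
  by (auto simp: of_coords_def to_coords_def inner_sum_left_Basis space_PiM PiE_iff extensional_def fun_eq_iff)

lemma of_coords_inner [simp]: "b \<in> Basis \<Longrightarrow> of_coords w \<bullet> b = w b"
  by (simp add: of_coords_def inner_sum_left_Basis)

lemma of_coords_upd:
  assumes "b \<in> Basis"
  shows "of_coords (w(b := t)) = of_coords w + (t - w b) *\<^sub>R b"
proof (rule euclidean_eqI)
  fix c :: 'a assume "c \<in> Basis"
  then show "of_coords (w(b := t)) \<bullet> c = (of_coords w + (t - w b) *\<^sub>R b) \<bullet> c"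
    using assms by (cases "c = b") (simp_all add: inner_add_left inner_not_same_Basis)
qed

lemma distr_of_coords: "distr (lborelP Basis) borel of_coords = lborel"
  unfolding of_coords_def[abs_def] by (rule lborel_eq[symmetric])

lemma nn_integral_of_coords:
  assumes "h \<in> borel_measurable borel"
  shows "(\<integral>\<^sup>+x. h x \<partial>lborel) = (\<integral>\<^sup>+w. h (of_coords w) \<partial>lborelP Basis)"
  using nn_integral_distr[OF of_coords_measurable, of h] assms by (simp add: distr_of_coords)

lemma AE_of_coords:
  assumes Q: "AE w in lborelP Basis. Q w" and meas: "Measurable.pred (lborelP Basis) Q"
  shows "AE x in lborel. Q (to_coords x)"
proof -
  have [measurable]: "Measurable.pred (lborelP Basis) Q" by fact
  have "AE w in lborelP Basis. Q (to_coords (of_coords w :: 'a))"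
    using Q AE_space by eventually_elim (simp add: to_of_coords)
  then have "AE x in distr (lborelP Basis) borel of_coords. Q (to_coords (x :: 'a))"
    by (subst AE_distr_iff) (auto simp: pred_def[symmetric])
  then show ?thesis by (simp only: distr_of_coords)
qed

text \<open>The diagonal derivatives disappear from the statement: only their product, the ratio of
  the densities, is explicit, and the arithmetic-geometric mean inequality bounds its n-th root by
  their average. Adding the weak inequalities over the basis produces the inner product of the
  gradient with \<open>T\<close>.\<close>

theorem knothe_transport:
  fixes f g :: "'a::euclidean_space \<Rightarrow> real"
  assumes f [measurable]: "f \<in> borel_measurable borel" and g [measurable]: "g \<in> borel_measurable borel"
    and fC: "\<And>x. 0 \<le> f x \<and> f x \<le> C \<and> (f x \<noteq> 0 \<longrightarrow> norm x \<le> R)"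
    and gC: "\<And>x. 0 \<le> g x \<and> g x \<le> C' \<and> (g x \<noteq> 0 \<longrightarrow> norm x \<le> R)"
    and R: "0 \<le> R"
    and mass: "(\<integral>\<^sup>+x. ennreal (f x) \<partial>lborel) = (\<integral>\<^sup>+x. ennreal (g x) \<partial>lborel)"
  obtains T :: "'a \<Rightarrow> 'a" where
    "T \<in> borel_measurable borel"
    "\<And>x b. b \<in> Basis \<Longrightarrow> \<bar>T x \<bullet> b\<bar> \<le> R"
    "\<And>\<phi>. \<phi> \<in> borel_measurable borel \<Longrightarrow>
      (\<integral>\<^sup>+x. \<phi> (T x) * ennreal (f x) \<partial>lborel) = (\<integral>\<^sup>+y. \<phi> y * ennreal (g y) \<partial>lborel)"
    "\<And>(\<psi> :: 'a \<Rightarrow> real) G. bump \<psi> G \<Longrightarrow> (\<And>x. 0 \<le> \<psi> x) \<Longrightarrow>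
      (\<integral>\<^sup>+x. ennreal (real DIM('a) * \<psi> x * (f x / g (T x)) powr (1 / DIM('a))) \<partial>lborel)
        \<le> ennreal (- (LINT x|lborel. G x \<bullet> T x))"
proof -
  let ?P = "lborelP (Basis :: 'a set)"
  let ?f = "\<lambda>w. f (of_coords w)" and ?g = "\<lambda>w. g (of_coords w)"
  have box: "box_density Basis c R (\<lambda>w. h (of_coords w))"
    if [measurable]: "h \<in> borel_measurable borel"
      and h: "\<And>x. 0 \<le> h x \<and> h x \<le> c \<and> (h x \<noteq> 0 \<longrightarrow> norm x \<le> R)" for h :: "'a \<Rightarrow> real" and c
    unfolding box_density_def
  proof (intro conjI ballI impI)
    fix w b assume "h (of_coords w) \<noteq> 0" and b: "b \<in> (Basis :: 'a set)"
    then have "norm (of_coords w) \<le> R" using h by blast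
    then show "\<bar>w b\<bar> \<le> R"
      using Basis_le_norm[OF b, of "of_coords w"] b by simp
  qed (use h in auto)
  obtain TP d where "knothe_map Basis R ?f ?g TP d"
  proof -
    have "\<exists>T d. knothe_map Basis R ?f ?g T d"
      using mass by (intro knothe_map_exists[OF finite_Basis R box[OF f fC] box[OF g gC]])
        (simp add: nn_integral_of_coords)
    then show thesis using that by blast
  qed
  then have TP [measurable]: "TP \<in> ?P \<rightarrow>\<^sub>M ?P"
    and TP_bound: "\<And>x j. x \<in> space ?P \<Longrightarrow> j \<in> Basis \<Longrightarrow> \<bar>TP x j\<bar> \<le> R"
    and TP_push: "\<And>\<phi>. \<phi> \<in> borel_measurable ?P \<Longrightarrow>
      (\<integral>\<^sup>+x. \<phi> (TP x) * ennreal (?f x) \<partial>?P) = (\<integral>\<^sup>+y. \<phi> y * ennreal (?g y) \<partial>?P)"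
    and d [measurable]: "\<And>b. b \<in> Basis \<Longrightarrow> d b \<in> borel_measurable ?P"
    and d_nonneg: "\<And>b x. b \<in> Basis \<Longrightarrow> x \<in> space ?P \<Longrightarrow> 0 \<le> d b x"
    and TP_AE: "AE x in ?P. 0 < ?f x \<longrightarrow> 0 < ?g (TP x) \<and> (\<Prod>b\<in>Basis. d b x) = ?f x / ?g (TP x)"
    and TP_weak: "\<And>b \<psi> \<psi>'. b \<in> Basis \<Longrightarrow> coord_test Basis b \<psi> \<psi>' \<Longrightarrow>
      (\<integral>\<^sup>+x. ennreal (\<psi> x * d b x) + ennreal (max 0 (\<psi>' x) * (TP x b + R)) \<partial>?P)
        \<le> (\<integral>\<^sup>+x. ennreal (max 0 (- \<psi>' x) * (TP x b + R)) \<partial>?P)"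
    unfolding knothe_map_def by blast+
  define T where "T x = of_coords (TP (to_coords x))" for x :: 'a
  define D where "D b x = d b (to_coords x)" for b x
  have T [measurable]: "T \<in> borel_measurable borel" unfolding T_def by measurable
  have to_space: "to_coords x \<in> space ?P" for x :: 'a
    using measurable_space[OF to_coords_measurable, of x] by simp
  have T_bound: "\<bar>T x \<bullet> b\<bar> \<le> R" if "b \<in> Basis" for x b
    using TP_bound[OF to_space that] that by (simp add: T_def)
  have T_of: "T (of_coords w) = of_coords (TP w)" if "w \<in> space ?P" for w
    using that by (simp add: T_def to_of_coords)
  have push: "(\<integral>\<^sup>+x. \<phi> (T x) * ennreal (f x) \<partial>lborel) = (\<integral>\<^sup>+y. \<phi> y * ennreal (g y) \<partial>lborel)"
    if [measurable]: "\<phi> \<in> borel_measurable borel" for \<phi>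
  proof -
    have "(\<integral>\<^sup>+x. \<phi> (T x) * ennreal (f x) \<partial>lborel)
        = (\<integral>\<^sup>+w. \<phi> (T (of_coords w)) * ennreal (?f w) \<partial>?P)"
      by (rule nn_integral_of_coords) measurable
    also have "\<dots> = (\<integral>\<^sup>+w. \<phi> (of_coords (TP w)) * ennreal (?f w) \<partial>?P)"
      by (intro nn_integral_cong) (simp add: T_of)
    also have "\<dots> = (\<integral>\<^sup>+w. \<phi> (of_coords w) * ennreal (?g w) \<partial>?P)"
      by (rule TP_push) measurable
    also have "\<dots> = (\<integral>\<^sup>+y. \<phi> y * ennreal (g y) \<partial>lborel)"
      by (rule nn_integral_of_coords[symmetric]) measurable
    finally show ?thesis .
  qed
  have D [measurable]: "D b \<in> borel_measurable borel" if "b \<in> Basis" for b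
    unfolding D_def using measurable_compose[OF to_coords_measurable d[OF that]] .
  have D_nonneg: "0 \<le> D b x" if "b \<in> Basis" for b x
    using d_nonneg[OF that to_space] by (simp add: D_def)
  have ae: "AE x in lborel. 0 < f x \<longrightarrow> 0 < g (T x) \<and> (\<Prod>b\<in>Basis. D b x) = f x / g (T x)"
  proof -
    have [measurable]: "(\<lambda>w. \<Prod>b\<in>Basis. d b w) \<in> borel_measurable ?P"
      by (rule borel_measurable_prod) (rule d)
    have q: "(\<lambda>w. ?f w / ?g (TP w)) \<in> borel_measurable ?P" by measurable
    have [measurable]: "Measurable.pred ?P (\<lambda>w. (\<Prod>b\<in>Basis. d b w) = ?f w / ?g (TP w))"
      unfolding pred_def by (rule borel_measurable_eq[OF _ q]) measurable
    have "AE x in lborel. 0 < ?f (to_coords x) \<longrightarrow> 0 < ?g (TP (to_coords x)) \<and>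
        (\<Prod>b\<in>Basis. d b (to_coords x)) = ?f (to_coords x) / ?g (TP (to_coords x))"
      by (rule AE_of_coords[OF TP_AE]) measurable
    then show ?thesis by (simp add: T_def D_def)
  qed
  \<comment> \<open>The sign in the second conjunct is recorded because \<open>ennreal\<close> sends
    negative numbers to 0; it allows the bounds for the single coordinates to be added inside one
    \<open>ennreal\<close> later.\<close>
  have weak: "(\<integral>\<^sup>+x. ennreal (\<psi> x * D b x) \<partial>lborel) \<le> ennreal (- (LINT x|lborel. (G x \<bullet> b) * (T x \<bullet> b)))
      \<and> 0 \<le> - (LINT x|lborel. (G x \<bullet> b) * (T x \<bullet> b))"
    if bump: "bump \<psi> G" and nonneg: "\<And>x. 0 \<le> \<psi> x" and b: "b \<in> Basis" for \<psi> G b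
  proof -
    note [measurable] = bump_borel[OF bump] D[OF b]
    have test: "coord_test Basis b (\<lambda>w. \<psi> (of_coords w)) (\<lambda>w. G (of_coords w) \<bullet> b)"
      unfolding coord_test_def
    proof (intro conjI ballI)
      fix w :: "'a \<Rightarrow> real" 
      let ?x = "of_coords w - w b *\<^sub>R b"
      have eq: "of_coords (w(b := t)) = ?x + t *\<^sub>R b" for t
        using of_coords_upd[OF b, of w t] by (simp add: algebra_simps)
      obtain K where K: "\<And>x. K < norm x \<Longrightarrow> \<psi> x = 0 \<and> G x = 0"
        using bump unfolding bump_def by blast
      have far: "K < norm (?x + t *\<^sub>R b)" if "\<bar>K\<bar> + norm ?x < \<bar>t\<bar>" for t
      proof -
        have "norm (t *\<^sub>R b) = \<bar>t\<bar>" using b by simp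
        then show ?thesis
          unfolding add.commute[of ?x "t *\<^sub>R b"]
          using that norm_diff_ineq[of "t *\<^sub>R b" ?x] by linarith
      qed
      show "line_test (\<lambda>t. \<psi> (of_coords (w(b := t)))) (\<lambda>t. G (of_coords (w(b := t))) \<bullet> b)"
        unfolding line_test_def eq
        using bump_line[OF bump, of ?x b] nonneg K far
        by (auto intro!: exI[of _ "\<bar>K\<bar> + norm ?x"] continuous_intros
            continuous_on_compose2[OF bump_continuous(2)[OF bump]])
    qed measurable
    have i: "integrable lborel (\<lambda>x. max 0 (G x \<bullet> b) * (T x \<bullet> b + R))"
      "integrable lborel (\<lambda>x. max 0 (- (G x \<bullet> b)) * (T x \<bullet> b + R))"
      "integrable lborel (\<lambda>x. (G x \<bullet> b) * (T x \<bullet> b))" "integrable lborel (\<lambda>x. (G x \<bullet> b) * R)"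
    proof -
      have *: "integrable lborel (\<lambda>x. (G x \<bullet> b) * h x)"
        if "h \<in> borel_measurable borel" "\<And>x. \<bar>h x\<bar> \<le> 2 * R" for h
        using bump_integrable_inner[OF bump that] .
      have Tb: "\<bar>T x \<bullet> b + R\<bar> \<le> 2 * R" "\<bar>T x \<bullet> b\<bar> \<le> 2 * R"
        "\<bar>- (T x \<bullet> b) - R\<bar> \<le> 2 * R" for x using T_bound[OF b, of x] R by auto
      show "integrable lborel (\<lambda>x. (G x \<bullet> b) * (T x \<bullet> b))"
        using Tb(2) by (intro *) auto
      show "integrable lborel (\<lambda>x. (G x \<bullet> b) * R)"
        using R by (intro *) auto
      \<comment> \<open>The positive part is written as the component of \<open>G\<close> times a
        bounded measurable function, so that \<open>bump_integrable_inner\<close> applies.\<close>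
      have "integrable lborel (\<lambda>x. (G x \<bullet> b) * (if 0 \<le> G x \<bullet> b then T x \<bullet> b + R else 0))"
        using Tb(1) R by (intro *) auto
      moreover have "(\<lambda>x. (G x \<bullet> b) * (if 0 \<le> G x \<bullet> b then T x \<bullet> b + R else 0))
          = (\<lambda>x. max 0 (G x \<bullet> b) * (T x \<bullet> b + R))"
        by (auto simp: fun_eq_iff max_def)
      ultimately show "integrable lborel (\<lambda>x. max 0 (G x \<bullet> b) * (T x \<bullet> b + R))" by simp
      have "integrable lborel (\<lambda>x. (G x \<bullet> b) * (if G x \<bullet> b \<le> 0 then - (T x \<bullet> b + R) else 0))"
        using Tb(3) R by (intro *) auto
      moreover have "(\<lambda>x. (G x \<bullet> b) * (if G x \<bullet> b \<le> 0 then - (T x \<bullet> b + R) else 0))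
          = (\<lambda>x. max 0 (- (G x \<bullet> b)) * (T x \<bullet> b + R))"
        by (auto simp: fun_eq_iff max_def algebra_simps)
      ultimately show "integrable lborel (\<lambda>x. max 0 (- (G x \<bullet> b)) * (T x \<bullet> b + R))" by simp
    qed
    have TR: "0 \<le> T x \<bullet> b + R" for x using T_bound[OF b, of x] by auto
    define Ap where "Ap = (LINT x|lborel. max 0 (G x \<bullet> b) * (T x \<bullet> b + R))"
    define Am where "Am = (LINT x|lborel. max 0 (- (G x \<bullet> b)) * (T x \<bullet> b + R))"
    have A0: "0 \<le> Ap" "0 \<le> Am"
      unfolding Ap_def Am_def by (auto intro!: integral_nonneg_AE simp: TR)
    have "Am - Ap = (LINT x|lborel. max 0 (- (G x \<bullet> b)) * (T x \<bullet> b + R) - max 0 (G x \<bullet> b) * (T x \<bullet> b + R))"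
      unfolding Am_def Ap_def using i by simp
    also have "\<dots> = (LINT x|lborel. - ((G x \<bullet> b) * (T x \<bullet> b)) - (G x \<bullet> b) * R)"
      by (intro Bochner_Integration.integral_cong) (auto simp: max_def algebra_simps)
    also have "\<dots> = - (LINT x|lborel. (G x \<bullet> b) * (T x \<bullet> b)) - (LINT x|lborel. (G x \<bullet> b) * R)"
      using i by simp
    \<comment> \<open>The shift of \<open>T\<close> by \<open>R\<close> drops out, because the
      components of \<open>G\<close> have integral zero.\<close>
    finally have diff: "Am - Ap = - (LINT x|lborel. (G x \<bullet> b) * (T x \<bullet> b))"
      by (simp add: bump_integral_inner[OF bump])
    have "(\<integral>\<^sup>+x. ennreal (\<psi> x * D b x) \<partial>lborel) + ennreal Ap
        = (\<integral>\<^sup>+x. ennreal (\<psi> x * D b x) + ennreal (max 0 (G x \<bullet> b) * (T x \<bullet> b + R)) \<partial>lborel)"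
      unfolding Ap_def using i TR
      by (subst nn_integral_add) (auto simp: nn_integral_eq_integral)
    also have "\<dots> = (\<integral>\<^sup>+w. ennreal (\<psi> (of_coords w) * d b w)
        + ennreal (max 0 (G (of_coords w) \<bullet> b) * (TP w b + R)) \<partial>?P)"
      by (subst nn_integral_of_coords, measurable, intro nn_integral_cong)
         (use b in \<open>simp add: T_of D_def to_of_coords\<close>)
    also have "\<dots> \<le> (\<integral>\<^sup>+w. ennreal (max 0 (- (G (of_coords w) \<bullet> b)) * (TP w b + R)) \<partial>?P)"
      by (rule TP_weak[OF b test])
    also have "\<dots> = (\<integral>\<^sup>+x. ennreal (max 0 (- (G x \<bullet> b)) * (T x \<bullet> b + R)) \<partial>lborel)"
      by (subst nn_integral_of_coords, measurable, intro nn_integral_cong)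
         (use b in \<open>simp add: T_of\<close>)
    also have "\<dots> = ennreal Am"
      unfolding Am_def using i TR by (intro nn_integral_eq_integral) auto
    finally have le: "(\<integral>\<^sup>+x. ennreal (\<psi> x * D b x) \<partial>lborel) + ennreal Ap \<le> ennreal Am" .
    have "ennreal Ap \<le> ennreal Am"
      using order_trans[OF _ le] by (simp add: add_increasing)
    then have "Ap \<le> Am" using A0 by simp
    moreover have "(\<integral>\<^sup>+x. ennreal (\<psi> x * D b x) \<partial>lborel) \<le> ennreal Am - ennreal Ap"
      using le A0 by (simp add: ennreal_le_minus_iff)
    ultimately show ?thesis
      using A0 by (simp add: diff[symmetric] ennreal_minus)
  qed
  have final: "(\<integral>\<^sup>+x. ennreal (real DIM('a) * \<psi> x * (f x / g (T x)) powr (1 / DIM('a))) \<partial>lborel)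
        \<le> ennreal (- (LINT x|lborel. G x \<bullet> T x))"
    if bump: "bump \<psi> G" and nonneg: "\<And>x. 0 \<le> \<psi> x" for \<psi> :: "'a \<Rightarrow> real" and G
  proof -
    note [measurable] = bump_borel[OF bump]
    have "(\<integral>\<^sup>+x. ennreal (real DIM('a) * \<psi> x * (f x / g (T x)) powr (1 / DIM('a))) \<partial>lborel)
        \<le> (\<integral>\<^sup>+x. (\<Sum>b\<in>Basis. ennreal (\<psi> x * D b x)) \<partial>lborel)"
    proof (rule nn_integral_mono_AE)
      show "AE x in lborel. ennreal (real DIM('a) * \<psi> x * (f x / g (T x)) powr (1 / DIM('a)))
          \<le> (\<Sum>b\<in>Basis. ennreal (\<psi> x * D b x))"
        using ae
      proof eventually_elim
        case (elim x)
        have "DIM('a) * \<psi> x * (f x / g (T x)) powr (1 / DIM('a)) \<le> (\<Sum>b\<in>Basis. \<psi> x * D b x)"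
        proof (cases "f x = 0")
          case True
          then show ?thesis using D_nonneg nonneg by (auto intro!: sum_nonneg)
        next
          case False
          then have "0 < f x" using fC[of x] by simp
          with elim have "(f x / g (T x)) powr (1 / DIM('a)) = (\<Prod>b\<in>Basis. D b x) powr (1 / DIM('a))"
            by simp
          also have "\<dots> \<le> (\<Sum>b\<in>Basis. D b x / DIM('a))"
            by (rule arith_geom_mean) (auto simp: D_nonneg)
          finally have "DIM('a) * (f x / g (T x)) powr (1 / DIM('a)) \<le> (\<Sum>b\<in>Basis. D b x)"
            by (simp add: sum_divide_distrib[symmetric] pos_le_divide_eq mult.commute)
          then have "\<psi> x * (DIM('a) * (f x / g (T x)) powr (1 / DIM('a))) \<le> \<psi> x * (\<Sum>b\<in>Basis. D b x)"
            using nonneg[of x] by (intro mult_left_mono)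
          then show ?thesis
            by (simp add: sum_distrib_left mult_ac)
        qed
        then show ?case
          using D_nonneg nonneg by (subst sum_ennreal) (auto intro!: ennreal_leI)
      qed
    qed
    also have "\<dots> = (\<Sum>b\<in>Basis. \<integral>\<^sup>+x. ennreal (\<psi> x * D b x) \<partial>lborel)"
      by (rule nn_integral_sum) (use D in measurable)
    also have "\<dots> \<le> (\<Sum>b\<in>Basis. ennreal (- (LINT x|lborel. (G x \<bullet> b) * (T x \<bullet> b))))"
      using weak[OF bump nonneg] by (intro sum_mono) blast
    also have "\<dots> = ennreal (\<Sum>b\<in>Basis. - (LINT x|lborel. (G x \<bullet> b) * (T x \<bullet> b)))"
      using weak[OF bump nonneg] by (intro sum_ennreal) blast
    also have "(\<Sum>b\<in>Basis. - (LINT x|lborel. (G x \<bullet> b) * (T x \<bullet> b)))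
        = - (LINT x|lborel. (\<Sum>b\<in>Basis. (G x \<bullet> b) * (T x \<bullet> b)))"
      using bump_integrable_inner[OF bump _ T_bound]
      by (subst Bochner_Integration.integral_sum) (auto simp: sum_negf)
    also have "\<dots> = - (LINT x|lborel. G x \<bullet> T x)"
      by (simp add: euclidean_inner[symmetric])
    finally show ?thesis .
  qed
  show thesis by (rule that[OF T T_bound push final])
qed

section \<open>Radial integrals\<close>

text \<open>A piecewise quadratic C^1 step: 0 up to 0, 2 s^2 up to 1/2, 1 - 2 (1-s)^2 up to 1, and 1
  from there on. One continuous derivative is all that test functions need here.\<close>

definition ramp :: "real \<Rightarrow> real"
  where "ramp s = 2 * (max 0 s)\<^sup>2 - 4 * (max 0 (s - 1/2))\<^sup>2 + 2 * (max 0 (s - 1))\<^sup>2"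

definition ramp' :: "real \<Rightarrow> real"
  where "ramp' s = 4 * max 0 s - 8 * max 0 (s - 1/2) + 4 * max 0 (s - 1)"

lemma DERIV_max_0_square: "((\<lambda>s::real. (max 0 s)\<^sup>2) has_real_derivative 2 * max 0 s) (at s)"
proof -
  consider "s < 0" | "s = 0" | "s > 0" by linarith
  then show ?thesis
  proof cases
    case 1
    have "((\<lambda>s::real. 0) has_real_derivative 2 * max 0 s) (at s)" using 1 by simp
    then show ?thesis
      by (rule has_field_derivative_transform_within_open[of _ _ _ "{..<0}"]) (use 1 in auto)
  next
    case 3
    have "((\<lambda>s::real. s\<^sup>2) has_real_derivative 2 * max 0 s) (at s)"
      using 3 by (auto intro!: derivative_eq_intros)
    then show ?thesis
      by (rule has_field_derivative_transform_within_open[of _ _ _ "{0<..}"]) (use 3 in auto)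
  next
    case 2
    have "((\<lambda>h::real. (max 0 h)\<^sup>2 / h) \<longlongrightarrow> 0) (at 0)"
    proof (rule Lim_null_comparison)
      have "norm ((max 0 h)\<^sup>2 / h) \<le> \<bar>h\<bar>" for h :: real
        by (cases "h > 0") (auto simp: max_def power2_eq_square)
      then show "\<forall>\<^sub>F h in at 0. norm ((max 0 h)\<^sup>2 / h) \<le> \<bar>h::real\<bar>" by simp
      show "((\<lambda>h. \<bar>h::real\<bar>) \<longlongrightarrow> 0) (at 0)"
        using tendsto_rabs[OF tendsto_ident_at[of "0::real" UNIV]] by simp
    qed
    then show ?thesis using 2 by (simp add: DERIV_def)
  qed
qed

lemma DERIV_ramp: "(ramp has_real_derivative ramp' s) (at s)"
proof -
  have shift: "((\<lambda>s. (max 0 (s - c))\<^sup>2) has_real_derivative 2 * max 0 (s - c)) (at s)" for c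
    using DERIV_shift[of "\<lambda>s. (max 0 s)\<^sup>2" "2 * max 0 (s - c)" s "-c"] DERIV_max_0_square[of "s - c"]
    by simp
  show ?thesis
  proof -
    have "(ramp has_real_derivative 2 * (2 * max 0 s) - 4 * (2 * max 0 (s - 1/2)) + 2 * (2 * max 0 (s - 1))) (at s)"
      unfolding ramp_def[abs_def]
      by (intro DERIV_add DERIV_diff DERIV_cmult shift DERIV_max_0_square)
    then show ?thesis by (simp add: ramp'_def)
  qed
qed

lemma continuous_ramp': "continuous_on S ramp'"
  unfolding ramp'_def[abs_def] by (intro continuous_intros)

lemma ramp_eq_0: "s \<le> 0 \<Longrightarrow> ramp s = 0" and ramp_eq_1: "1 \<le> s \<Longrightarrow> ramp s = 1"
  and ramp'_eq_0: "s \<le> 0 \<or> 1 \<le> s \<Longrightarrow> ramp' s = 0"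
  by (auto simp: ramp_def ramp'_def max_def power2_eq_square algebra_simps)

lemma ramp'_bounds: "0 \<le> ramp' s" "ramp' s \<le> 2"
  by (auto simp: ramp'_def max_def)

lemma ramp_bounds: "0 \<le> ramp s" "ramp s \<le> 1"
proof -
  consider "s \<le> 0" | "0 \<le> s" "s \<le> 1/2" | "1/2 \<le> s" "s \<le> 1" | "1 \<le> s" by linarith
  then have "0 \<le> ramp s \<and> ramp s \<le> 1"
  proof cases
    case 2
    then have "ramp s = 2 * s\<^sup>2" by (auto simp: ramp_def max_def)
    moreover have "s\<^sup>2 \<le> (1/2)\<^sup>2" using 2 by (intro power_mono) auto
    ultimately show ?thesis by (simp add: power2_eq_square)
  next
    case 3
    then have eq: "ramp s = 1 - 2 * (1 - s)\<^sup>2"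
      by (auto simp: ramp_def max_def power2_eq_square algebra_simps)
    have "(1 - s)\<^sup>2 \<le> (1/2)\<^sup>2" using 3 by (intro power_mono) auto
    then show ?thesis using eq by (simp add: power2_eq_square)
  qed (simp_all add: ramp_eq_0 ramp_eq_1)
  then show "0 \<le> ramp s" "ramp s \<le> 1" by auto
qed

lemma DERIV_inverse_power:
  fixes t :: real
  assumes "1 + t \<noteq> 0"
  shows "((\<lambda>t. 1 / (1 + t) ^ k) has_real_derivative - real k / (1 + t) ^ Suc k) (at t)"
proof -
  have "((\<lambda>t. inverse (1 + t)) has_real_derivative - (inverse (1 + t))\<^sup>2) (at t)"
    using assms by (auto intro!: derivative_eq_intros simp: power2_eq_square)
  then have "((\<lambda>t. inverse (1 + t) ^ k) has_real_derivative
      real k * (- (inverse (1 + t))\<^sup>2 * inverse (1 + t) ^ (k - Suc 0))) (at t)"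
    by (rule DERIV_power)
  also have "real k * (- (inverse (1 + t))\<^sup>2 * inverse (1 + t) ^ (k - Suc 0)) = - real k / (1 + t) ^ Suc k"
    by (cases k) (simp_all add: power2_eq_square power_inverse divide_inverse mult_ac del: of_nat_Suc)
  finally show ?thesis by (simp add: inverse_eq_divide power_one_over)
qed

text \<open>The exponent conjugate to the dimension: the reciprocals of the two add up to 1.\<close>

definition conj_exp :: "'a::euclidean_space itself \<Rightarrow> real"
  where "conj_exp _ = real DIM('a) / (real DIM('a) - 1)"

text \<open>The function $\tau$ is $|x|^{n/(n-1)}$. Its distribution under the Lebesgue measure has the
  polynomial density $t^{n-2}$ up to a factor, so all radial integrals below are integrals of
  rational functions of $\tau$.\<close>

definition \<tau> :: "'a::euclidean_space \<Rightarrow> real"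
  where "\<tau> x = norm x powr conj_exp TYPE('a)"

text \<open>At the origin the formula gives 0, which is the true gradient because the exponent of
  \<open>\<tau>\<close> exceeds 1.\<close>

definition grad_\<tau> :: "'a::euclidean_space \<Rightarrow> 'a"
  where "grad_\<tau> x = (conj_exp TYPE('a) * norm x powr (conj_exp TYPE('a) - 2)) *\<^sub>R x"

lemma \<tau>_nonneg [simp]: "0 \<le> \<tau> x"
  by (simp add: \<tau>_def)

lemma \<tau>_measurable [measurable]: "\<tau> \<in> borel_measurable borel"
  unfolding \<tau>_def[abs_def] by measurable

text \<open>The derivative in \<open>t\<close> of the volume of the ball on which
  \<open>\<tau>\<close> is at most \<open>t\<close>; that volume is
  \<open>unit_ball_vol n * t ^ (n - 1)\<close>.\<close>

definition radial_weight :: "nat \<Rightarrow> real \<Rightarrow> real"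
  where "radial_weight n t = unit_ball_vol n * (real n - 1) * t ^ (n - 2)"

text \<open>A primitive of (n-1) t^(n-1) / (a+t)^n, that is, of the energy density of the target
  with the radial weight. The sum is what remains beside the logarithm after expanding in powers of
  t/(a+t).\<close>

definition log_profile :: "nat \<Rightarrow> real \<Rightarrow> real \<Rightarrow> real"
  where "log_profile n a t = (real n - 1) * (ln (a + t) - (\<Sum>j=1..n-1. (t / (a + t)) ^ j / real j))"

lemma radial_weight_measurable [measurable]: "radial_weight n \<in> borel_measurable borel"
  unfolding radial_weight_def[abs_def] by measurable

lemma DERIV_ratio:
  fixes a t :: real
  assumes "0 < a" "0 \<le> t"
  shows "((\<lambda>t. t / (a + t)) has_real_derivative a / (a + t)\<^sup>2) (at t)"
  using assms by (auto intro!: derivative_eq_intros simp: field_simps power2_eq_square)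

text \<open>With q = t/(a+t) one has q' = a/(a+t)^2, so the derivative of q^(n-1)/a is (n-1) q^(n-2)
  / (a+t)^2.\<close>

lemma DERIV_mass:
  fixes a t :: real
  assumes dim: "2 \<le> n" and "0 < a" "0 \<le> t"
  shows "((\<lambda>t. (t / (a + t)) ^ (n - 1) / a) has_real_derivative (real n - 1) * t ^ (n - 2) * (1 / (a + t) ^ n)) (at t)"
proof -
  have e: "n - Suc (Suc 0) = n - 2" by simp
  have split: "(a + t) ^ n = (a + t) ^ (n - 2) * (a + t)\<^sup>2"
    using dim by (metis power_add le_add_diff_inverse2)
  have "((\<lambda>t. (t / (a + t)) ^ (n - 1) / a) has_real_derivative
      real (n - 1) * (a / (a + t)\<^sup>2 * (t / (a + t)) ^ (n - 1 - Suc 0)) / a) (at t)"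
    by (intro DERIV_cdivide DERIV_power DERIV_ratio assms(2,3))
  also have "real (n - 1) * (a / (a + t)\<^sup>2 * (t / (a + t)) ^ (n - 1 - Suc 0)) / a
      = (real n - 1) * t ^ (n - 2) * (1 / (a + t) ^ n)"
    using assms dim by (simp add: split power_divide of_nat_diff numeral_2_eq_2)
  finally show ?thesis .
qed

text \<open>With q = t/(a+t) the differentiated sum is a geometric sum, equal to (1 -
  q^(n-1))/(a+t). Subtracting it from 1/(a+t) leaves q^(n-1)/(a+t).\<close>

lemma DERIV_log_profile:
  fixes a t :: real
  assumes dim: "2 \<le> n" and "0 < a" "0 \<le> t"
  shows "(log_profile n a has_real_derivative (real n - 1) * t ^ (n - 2) * (t / (a + t) ^ n)) (at t)"
proof -
  let ?q = "t / (a + t)"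
  have q1: "1 - ?q = a / (a + t)" "?q \<noteq> 1" using assms by (auto simp: field_simps)
  have "(\<Sum>j=1..n-1. ?q ^ (j - 1)) = (\<Sum>j<n-1. ?q ^ j)"
    by (rule sum.reindex_bij_witness[of _ Suc "\<lambda>j. j - 1"]) auto
  also have "\<dots> = (1 - ?q ^ (n - 1)) / (1 - ?q)"
    using q1(2) by (simp only: sum_gp_strict if_False)
  finally have geo: "(\<Sum>j=1..n-1. ?q ^ (j - 1)) = (1 - ?q ^ (n - 1)) / (a / (a + t))"
    by (simp only: q1(1))
  have "((\<lambda>t. \<Sum>j=1..n-1. (t / (a + t)) ^ j / real j) has_real_derivative
      (\<Sum>j=1..n-1. real j * (a / (a + t)\<^sup>2 * ?q ^ (j - Suc 0)) / real j)) (at t)"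
    by (intro DERIV_sum DERIV_cdivide DERIV_power DERIV_ratio assms(2,3))
  also have "(\<Sum>j=1..n-1. real j * (a / (a + t)\<^sup>2 * ?q ^ (j - Suc 0)) / real j)
      = (\<Sum>j=1..n-1. ?q ^ (j - 1)) * (a / (a + t)\<^sup>2)"
    unfolding sum_distrib_right by (intro sum.cong) (auto simp: mult.commute)
  also have "\<dots> = (1 - ?q ^ (n - 1)) / (a + t)"
    unfolding geo using assms by (simp add: power2_eq_square)
  finally have "(log_profile n a has_real_derivative
      (real n - 1) * (1 / (a + t) - (1 - ?q ^ (n - 1)) / (a + t))) (at t)"
    unfolding log_profile_def[abs_def]
  proof (intro DERIV_cmult DERIV_diff)
    show "((\<lambda>t. ln (a + t)) has_real_derivative 1 / (a + t)) (at t)"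
      using assms by (auto intro!: derivative_eq_intros)
  qed
  also have "1 / (a + t) - (1 - ?q ^ (n - 1)) / (a + t) = t ^ (n - 2) * (t / (a + t) ^ n)"
  proof -
    have "t ^ (n - 1) = t ^ (n - 2) * t" "(a + t) ^ n = (a + t) ^ (n - 1) * (a + t)"
      using dim by (metis power_Suc2 Suc_diff_le diff_Suc_Suc numeral_2_eq_2 One_nat_def)
        (use dim in \<open>simp flip: power_Suc2\<close>)
    then show ?thesis using assms by (simp add: diff_divide_distrib power_divide)
  qed
  finally show ?thesis by (simp add: mult.assoc)
qed

lemma ratio_tendsto_1:
  assumes "0 < (a::real)"
  shows "((\<lambda>t. t / (a + t)) \<longlongrightarrow> 1) at_top"
proof -
  have "((\<lambda>t. 1 - a / (a + t)) \<longlongrightarrow> 1 - 0) at_top"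
    by (intro tendsto_intros tendsto_divide_0[OF tendsto_const]
        filterlim_at_top_imp_at_infinity filterlim_tendsto_add_at_top[OF tendsto_const] filterlim_ident)
  then have "((\<lambda>t. 1 - a / (a + t)) \<longlongrightarrow> 1) at_top" by simp
  then show ?thesis
  proof (rule Lim_transform_eventually)
    show "\<forall>\<^sub>F t in at_top. 1 - a / (a + t) = t / (a + t)"
      using eventually_gt_at_top[of 0]
      by eventually_elim (use assms in \<open>simp add: field_simps\<close>)
  qed
qed

section \<open>Calculus of \<tau> and integrals of its functions\<close>

context
  fixes n :: nat and p :: real
  assumes n: "DIM('a::euclidean_space) = n" and dim: "2 \<le> n" and p: "conj_exp TYPE('a) = p"
begin

lemma conj_exp_eq: "p = real n / (real n - 1)"
  using p n by (simp add: conj_exp_def)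

lemma conj_exp_gt_1: "1 < p"
  using dim by (simp add: conj_exp_eq divide_simps)

lemma conj_exp_minus_1: "p - 1 = 1 / (real n - 1)"
  using dim by (simp add: conj_exp_eq field_simps)

lemma conj_exp_powers: "p * (real n - 1) = real n" "real n / p = real n - 1"
  using dim by (simp_all add: conj_exp_eq)

lemma \<tau>_powr_inverse: "\<tau> (x::'a) powr (1 / p) = norm x"
  using conj_exp_gt_1 by (simp add: \<tau>_def p powr_powr)

lemma \<tau>_powr: "\<tau> (x::'a) powr (1 / real n) = norm x powr (p - 1)"
  using dim conj_exp_minus_1 by (simp add: \<tau>_def p powr_powr) (simp add: conj_exp_eq)

lemma norm_grad_\<tau>: "norm (grad_\<tau> (x::'a)) = p * norm x powr (p - 1)"
proof (cases "x = 0")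
  case False
  then have "norm x powr (p - 2) * norm x = norm x powr (p - 1)"
    using powr_add[of "norm x" "p - 2" 1] by (simp add: )
  then show ?thesis using conj_exp_gt_1 by (simp add: grad_\<tau>_def p mult.assoc)
qed (simp add: grad_\<tau>_def p)

text \<open>Conjugacy gives n (p - 1) = p. This is why energies become integrals of rational
  functions of \<open>\<tau>\<close>.\<close>

lemma norm_grad_\<tau>_power: "norm (grad_\<tau> (x::'a)) ^ n = p ^ n * \<tau> x"
proof -
  have "(norm x powr (p - 1)) ^ n = \<tau> x"
  proof -
    have "real n * (p - 1) = p" using dim by (simp add: conj_exp_eq field_simps)
    then show ?thesis using dim by (cases "x = 0") (simp_all add: \<tau>_def p powr_power)
  qed
  then show ?thesis by (simp add: norm_grad_\<tau> power_mult_distrib)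
qed

lemma inner_grad_\<tau>: "(x::'a) \<bullet> grad_\<tau> x = p * \<tau> x"
proof (cases "x = 0")
  case False
  then have "norm x powr (p - 2) * (norm x * norm x) = norm x powr p"
    using powr_add[of "norm x" "p - 2" 2] by (simp add: power2_eq_square)
  then show ?thesis
    by (simp add: grad_\<tau>_def p \<tau>_def p dot_square_norm power2_eq_square mult.assoc)
qed (simp add: grad_\<tau>_def p \<tau>_def p)

text \<open>Away from the origin this is the chain rule. At the origin the difference quotient is
  |h|^(p-1), which tends to 0 since p > 1.\<close>

lemma GDERIV_\<tau>: "GDERIV \<tau> (x::'a) :> grad_\<tau> x"
proof (cases "x = 0")
  case False
  have "(norm has_derivative (\<lambda>h. h \<bullet> sgn x)) (at x)"
    using GDERIV_norm[OF False] by (simp add: gderiv_def)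
  moreover have "((\<lambda>r. r powr p) has_derivative (*) (p * norm x powr (p - 1))) (at (norm x))"
    using has_real_derivative_powr[of "norm x" p] False by (simp add: has_field_derivative_def)
  ultimately have "((\<lambda>y. norm y powr p) has_derivative (\<lambda>h. p * norm x powr (p - 1) * (h \<bullet> sgn x))) (at x)"
    by (rule has_derivative_compose)
  moreover have "p * norm x powr (p - 1) * (h \<bullet> sgn x) = h \<bullet> grad_\<tau> x" for h
    using False powr_add[of "norm x" "p - 2" 1]
    by (simp add: sgn_div_norm grad_\<tau>_def p divide_simps)
  ultimately show ?thesis by (simp add: gderiv_def \<tau>_def[abs_def] p)
next
  case True
  have "((\<lambda>h. norm (\<tau> (0 + h) - \<tau> (0::'a) - h \<bullet> 0) / norm h) \<longlongrightarrow> 0) (at (0::'a))"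
  proof (rule Lim_null_comparison)
    have "norm (norm (\<tau> (0 + h) - \<tau> (0::'a) - h \<bullet> 0) / norm h) \<le> norm h powr (p - 1)" for h :: 'a
      using powr_add[of "norm h" "p - 1" 1] by (cases "h = 0") (simp_all add: \<tau>_def p)
    then show "\<forall>\<^sub>F h in at 0. norm (norm (\<tau> (0 + h) - \<tau> (0::'a) - h \<bullet> 0) / norm h) \<le> norm (h::'a) powr (p - 1)"
      by simp
    show "((\<lambda>h::'a. norm h powr (p - 1)) \<longlongrightarrow> 0) (at 0)"
      using conj_exp_gt_1 by (intro tendsto_eq_intros | simp)+
  qed
  then have "(\<tau> has_derivative (\<lambda>h. h \<bullet> 0)) (at (0::'a))"
    by (simp add: has_derivative_at)
  then show ?thesis using True by (simp add: gderiv_def grad_\<tau>_def p)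
qed

lemma continuous_\<tau>: "continuous_on S (\<tau> :: 'a \<Rightarrow> real)"
  using GDERIV_\<tau> has_derivative_continuous unfolding gderiv_def
  by (blast intro: continuous_at_imp_continuous_on)

lemma continuous_grad_\<tau>: "continuous_on S (grad_\<tau> :: 'a \<Rightarrow> 'a)"
proof (rule continuous_at_imp_continuous_on, rule ballI)
  fix x :: 'a
  show "isCont grad_\<tau> x"
  proof (cases "x = 0")
    case False
    then show ?thesis unfolding grad_\<tau>_def[abs_def] p by (intro continuous_intros) auto
  next
    case True
    have "(grad_\<tau> \<longlongrightarrow> 0) (at (0::'a))"
    proof (rule Lim_null_comparison)
      show "\<forall>\<^sub>F h in at 0. norm (grad_\<tau> (h::'a)) \<le> p * norm h powr (p - 1)"
        by (simp add: norm_grad_\<tau>)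
      show "((\<lambda>h::'a. p * norm h powr (p - 1)) \<longlongrightarrow> 0) (at 0)"
        using conj_exp_gt_1 by (intro tendsto_eq_intros | simp)+
    qed
    then show ?thesis using True by (simp add: isCont_def grad_\<tau>_def p)
  qed
qed

lemma GDERIV_comp_\<tau>:
  assumes "(k has_real_derivative k') (at (\<tau> (x::'a)))"
  shows "GDERIV (\<lambda>x. k (\<tau> x)) x :> k' *\<^sub>R grad_\<tau> x"
proof -
  have "((\<lambda>x. k (\<tau> x)) has_derivative (\<lambda>h. k' * (h \<bullet> grad_\<tau> x))) (at x)"
    using GDERIV_\<tau>[of x] assms
    by (auto simp: gderiv_def has_field_derivative_def intro: has_derivative_compose)
  then show ?thesis by (simp add: gderiv_def)
qed

lemma \<tau>_le_iff: "0 \<le> X \<Longrightarrow> \<tau> (x::'a) \<le> X \<longleftrightarrow> norm x \<le> X powr (1 / p)"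
proof
  assume "0 \<le> X" "\<tau> x \<le> X"
  then have "\<tau> x powr (1 / p) \<le> X powr (1 / p)" using conj_exp_gt_1 by (intro powr_mono2) auto
  then show "norm x \<le> X powr (1 / p)" by (simp add: \<tau>_powr_inverse)
next
  assume "0 \<le> X" "norm x \<le> X powr (1 / p)"
  then have "norm x powr p \<le> (X powr (1 / p)) powr p" using conj_exp_gt_1 by (intro powr_mono2) auto
  then show "\<tau> x \<le> X" using \<open>0 \<le> X\<close> conj_exp_gt_1 by (simp add: \<tau>_def p powr_powr)
qed

text \<open>The set is a ball of radius X^(1/p), and n/p = n - 1.\<close>

lemma emeasure_\<tau>_le:
  assumes "0 \<le> X"
  shows "emeasure lborel {x::'a. \<tau> x \<le> X} = ennreal (unit_ball_vol n * X ^ (n - 1))"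
proof -
  have "{x::'a. \<tau> x \<le> X} = cball 0 (X powr (1 / p))"
    by (auto simp: \<tau>_le_iff[OF assms])
  moreover have "(X powr (1 / p)) ^ n = X ^ (n - 1)"
  proof (cases "X = 0")
    case False
    then have "(X powr (1 / p)) ^ n = X powr (real n / p)"
      using assms by (simp add: powr_power)
    also have "\<dots> = X powr real (n - 1)"
      using dim by (simp add: conj_exp_powers)
    also have "\<dots> = X ^ (n - 1)"
      using False assms by (simp add: powr_realpow)
    finally show ?thesis .
  qed (use dim in \<open>simp add: power_0_left\<close>)
  ultimately show ?thesis by (simp add: emeasure_cball n)
qed

lemma radial_weight_nonneg: "0 \<le> t \<Longrightarrow> 0 \<le> radial_weight n t"
  using dim unfolding radial_weight_def by (intro mult_nonneg_nonneg) auto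

lemma radial_weight_mult:
  "0 \<le> t \<Longrightarrow> 0 \<le> h \<Longrightarrow> ennreal h * ennreal (radial_weight n t)
    = ennreal (unit_ball_vol n * ((real n - 1) * t ^ (n - 2) * h))"
  by (subst ennreal_mult[symmetric]) (auto simp: radial_weight_nonneg, simp add: radial_weight_def mult_ac)

lemma distr_\<tau>:
  "distr (lborel :: 'a measure) borel \<tau>
    = density lborel (\<lambda>t. ennreal (radial_weight n t) * indicator {0..} t)" (is "?L = ?R")
proof (rule measure_eqI_generator_eq[where E = "range (\<lambda>a::real. {..a})" and A = "\<lambda>i. {..real i}" and \<Omega> = UNIV])
  show "Int_stable (range (\<lambda>a::real. {..a}))"
    by (auto simp: Int_stable_def)
  show "sets ?L = sigma_sets UNIV (range (\<lambda>a::real. {..a}))"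
    "sets ?R = sigma_sets UNIV (range (\<lambda>a::real. {..a}))"
    by (simp_all add: borel_eq_atMost)
  have L: "emeasure ?L {..X} = ennreal (unit_ball_vol n * X ^ (n - 1))" if "0 \<le> X" for X
  proof -
    have "emeasure ?L {..X} = emeasure lborel {x::'a. \<tau> x \<le> X}"
      by (subst emeasure_distr) (auto intro!: arg_cong2[where f = emeasure])
    then show ?thesis using emeasure_\<tau>_le[OF that] by simp
  qed
  have L0: "emeasure ?L {..X} = 0" if "X < 0" for X
  proof -
    have "\<not> \<tau> x \<le> X" for x :: 'a using that \<tau>_nonneg[of x] by linarith
    then have "\<tau> -` {..X} = ({} :: 'a set)" by auto
    then show ?thesis by (subst emeasure_distr) auto
  qed
  fix Y assume "Y \<in> range (\<lambda>a::real. {..a})"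
  then obtain X where Y: "Y = {..X}" by blast
  show "emeasure ?L Y = emeasure ?R Y"
  proof (cases "0 \<le> X")
    case True
    have "emeasure ?R {..X} = (\<integral>\<^sup>+t. ennreal (radial_weight n t) * indicator {0..X} t \<partial>lborel)"
      by (subst emeasure_density) (auto intro!: nn_integral_cong simp: indicator_def)
    also have "\<dots> = ennreal (unit_ball_vol n * X ^ (n - 1) - unit_ball_vol n * 0 ^ (n - 1))"
    proof (rule nn_integral_FTC_Icc[where F = "\<lambda>t. unit_ball_vol n * t ^ (n - 1)"])
      fix t assume "t \<in> {0..X}"
      then show "0 \<le> radial_weight n t" by (simp add: radial_weight_nonneg)
      have "n - Suc (Suc 0) = n - 2" by simp
      then show "((\<lambda>t. unit_ball_vol n * t ^ (n - 1)) has_real_derivative radial_weight n t) (at t)"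
        using dim by (auto intro!: derivative_eq_intros simp: radial_weight_def of_nat_diff)
    qed (use True in auto)
    finally show ?thesis using L[OF True] dim by (simp add: Y power_0_left)
  next
    case False
    have "emeasure ?R {..X} = (\<integral>\<^sup>+t. ennreal (radial_weight n t) * indicator {0..} t * indicator {..X} t \<partial>lborel)"
      by (rule emeasure_density) measurable
    also have "\<dots> = (\<integral>\<^sup>+t. 0 \<partial>(lborel :: real measure))"
      by (rule nn_integral_cong) (use False in \<open>auto simp: indicator_def\<close>)
    finally have "emeasure ?R {..X} = 0" by simp
    then show ?thesis using L0[of X] False Y by simp
  qed
next
  have "emeasure ?L {..real i} = ennreal (unit_ball_vol n * real i ^ (n - 1))" for i
  proof -
    have "emeasure ?L {..real i} = emeasure lborel {x::'a. \<tau> x \<le> real i}"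
      by (subst emeasure_distr) (auto intro!: arg_cong2[where f = emeasure])
    then show ?thesis using emeasure_\<tau>_le[of "real i"] by simp
  qed
  then show "emeasure ?L {..real i} \<noteq> \<infinity>" for i by simp
  show "(\<Union>i. {..real i}) = (UNIV :: real set)"
    using real_arch_simple by auto
qed auto

lemma nn_integral_radial:
  assumes [measurable]: "h \<in> borel_measurable borel"
  shows "(\<integral>\<^sup>+x. h (\<tau> (x::'a)) \<partial>lborel) = (\<integral>\<^sup>+t. h t * (ennreal (radial_weight n t) * indicator {0..} t) \<partial>lborel)"
proof -
  have "(\<integral>\<^sup>+x. h (\<tau> (x::'a)) \<partial>lborel) = (\<integral>\<^sup>+t. h t \<partial>distr (lborel :: 'a measure) borel \<tau>)"
    by (subst nn_integral_distr) auto
  also have "\<dots> = (\<integral>\<^sup>+t. h t * (ennreal (radial_weight n t) * indicator {0..} t) \<partial>lborel)"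
    by (subst distr_\<tau>, subst nn_integral_density) (auto simp: mult.commute)
  finally show ?thesis .
qed

lemma radial_integral_le:
  fixes h Q :: "real \<Rightarrow> real"
  assumes [measurable]: "h \<in> borel_measurable borel" and X: "0 \<le> X"
    and h: "\<And>t. 0 \<le> t \<Longrightarrow> t \<le> X \<Longrightarrow> 0 \<le> h t"
    and Q: "\<And>t. 0 \<le> t \<Longrightarrow> t \<le> X \<Longrightarrow> (Q has_real_derivative (real n - 1) * t ^ (n - 2) * h t) (at t)"
  shows "has_bochner_integral lborel (\<lambda>x::'a. indicator {x. \<tau> x \<le> X} x * h (\<tau> x)) (unit_ball_vol n * (Q X - Q 0))"
proof (rule has_bochner_integral_nn_integral)
  have "(\<integral>\<^sup>+x. ennreal (indicator {x::'a. \<tau> x \<le> X} x * h (\<tau> x)) \<partial>lborel)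
      = (\<integral>\<^sup>+x. ennreal (indicator {..X} (\<tau> x) * h (\<tau> x)) \<partial>(lborel :: 'a measure))"
    by (intro nn_integral_cong) (simp add: indicator_def)
  also have "\<dots> = (\<integral>\<^sup>+t. ennreal (indicator {..X} t * h t) * (ennreal (radial_weight n t) * indicator {0..} t) \<partial>lborel)"
    by (rule nn_integral_radial) measurable
  also have "\<dots> = (\<integral>\<^sup>+t. ennreal (unit_ball_vol n * ((real n - 1) * t ^ (n - 2) * h t)) * indicator {0..X} t \<partial>lborel)"
    by (intro nn_integral_cong)
       (use h in \<open>auto simp: indicator_def radial_weight_mult simp del: of_nat_Suc\<close>)
  also have "\<dots> = ennreal (unit_ball_vol n * Q X - unit_ball_vol n * Q 0)"
    using dim h
    by (intro nn_integral_FTC_Icc[OF _ _ _ X])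
       (auto intro!: mult_nonneg_nonneg DERIV_cmult DERIV_subset[OF Q])
  finally show "(\<integral>\<^sup>+x. ennreal (indicator {x::'a. \<tau> x \<le> X} x * h (\<tau> x)) \<partial>lborel)
      = ennreal (unit_ball_vol n * (Q X - Q 0))"
    by (simp add: right_diff_distrib)
  have "Q 0 \<le> Q X"
    using dim h by (intro DERIV_nonneg_imp_nondecreasing[OF X]) (use Q in \<open>fastforce intro!: mult_nonneg_nonneg\<close>)
  then show "0 \<le> unit_ball_vol n * (Q X - Q 0)" by (intro mult_nonneg_nonneg) auto
  show "AE x in lborel. 0 \<le> indicator {x::'a. \<tau> x \<le> X} x * h (\<tau> x)"
    using h by (auto simp: indicator_def)
qed measurable

lemma mass_integral_le:
  assumes "0 < a" "0 \<le> X"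
  shows "has_bochner_integral lborel (\<lambda>x::'a. indicator {x. \<tau> x \<le> X} x * (1 / (a + \<tau> x) ^ n))
    (unit_ball_vol n * ((X / (a + X)) ^ (n - 1) / a))"
  using radial_integral_le[of "\<lambda>t. 1 / (a + t) ^ n" X "\<lambda>t. (t / (a + t)) ^ (n - 1) / a"] DERIV_mass[OF dim assms(1)]
    assms dim by (auto simp: power_0_left)

lemma energy_integral_le:
  assumes "0 < a" "0 \<le> X"
  shows "has_bochner_integral lborel (\<lambda>x::'a. indicator {x. \<tau> x \<le> X} x * (\<tau> x / (a + \<tau> x) ^ n))
    (unit_ball_vol n * (log_profile n a X - log_profile n a 0))"
  using radial_integral_le[of "\<lambda>t. t / (a + t) ^ n" X "log_profile n a"] DERIV_log_profile[OF dim assms(1)]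
    assms by auto

text \<open>The primitive of \<open>DERIV_mass\<close> tends to 1/a at infinity. So the total mass
  determines \<open>a\<close>, and \<open>log a\<close> is a constant minus the logarithm of the
  mass.\<close>

lemma mass_integral:
  assumes "0 < a"
  shows "has_bochner_integral lborel (\<lambda>x::'a. 1 / (a + \<tau> x) ^ n) (unit_ball_vol n / a)"
proof (rule has_bochner_integral_nn_integral)
  have "(\<integral>\<^sup>+x. ennreal (1 / (a + \<tau> (x::'a)) ^ n) \<partial>lborel)
      = (\<integral>\<^sup>+t. ennreal (1 / (a + t) ^ n) * (ennreal (radial_weight n t) * indicator {0..} t) \<partial>lborel)"
    by (rule nn_integral_radial) measurable
  also have "\<dots> = (\<integral>\<^sup>+t. ennreal (unit_ball_vol n * ((real n - 1) * t ^ (n - 2) * (1 / (a + t) ^ n))) * indicator {0..} t \<partial>lborel)"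
    by (intro nn_integral_cong)
       (use assms in \<open>auto simp: indicator_def radial_weight_mult\<close>)
  also have "\<dots> = ennreal (unit_ball_vol n * (1 ^ (n - 1) / a) - unit_ball_vol n * ((0 / (a + 0)) ^ (n - 1) / a))"
  proof (rule nn_integral_FTC_atLeast[where F = "\<lambda>t. unit_ball_vol n * ((t / (a + t)) ^ (n - 1) / a)"])
    fix t :: real assume t: "0 \<le> t"
    show "((\<lambda>t. unit_ball_vol n * ((t / (a + t)) ^ (n - 1) / a)) has_real_derivative
      unit_ball_vol n * ((real n - 1) * t ^ (n - 2) * (1 / (a + t) ^ n))) (at t)"
      by (intro DERIV_cmult DERIV_mass dim assms t)
    show "0 \<le> unit_ball_vol n * ((real n - 1) * t ^ (n - 2) * (1 / (a + t) ^ n))"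
      using t dim assms by (intro mult_nonneg_nonneg) auto
  next
    show "((\<lambda>t. unit_ball_vol n * ((t / (a + t)) ^ (n - 1) / a)) \<longlongrightarrow> unit_ball_vol n * (1 ^ (n - 1) / a)) at_top"
      using assms by (intro tendsto_intros ratio_tendsto_1) auto
  qed measurable
  finally show "(\<integral>\<^sup>+x. ennreal (1 / (a + \<tau> (x::'a)) ^ n) \<partial>lborel) = ennreal (unit_ball_vol n / a)"
    using dim by (simp add: power_0_left)
qed (use assms in auto)

end

section \<open>The transport inequality\<close>

lemma power_diff_le_linear:
  fixes x y :: real
  assumes "0 \<le> y" "y \<le> x" "x \<le> 1"
  shows "x ^ k - y ^ k \<le> real k * (x - y)"
proof (induction k)
  case (Suc k)
  have "y ^ k \<le> x ^ k" using assms by (intro power_mono)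
  then have "x * (x ^ k - y ^ k) \<le> 1 * (x ^ k - y ^ k)"
    using assms by (intro mult_right_mono) auto
  moreover have "y ^ k * (x - y) \<le> 1 * (x - y)"
    using assms by (intro mult_right_mono power_le_one) auto
  moreover have "x ^ Suc k - y ^ Suc k = x * (x ^ k - y ^ k) + y ^ k * (x - y)"
    by (simp add: algebra_simps)
  ultimately show ?case using Suc.IH by (simp add: algebra_simps)
qed simp

text \<open>Cleared of denominators the equation is polynomial in \<open>a\<close>: the left side
  vanishes at \<open>a = 0\<close> and is large enough at \<open>a = V / m\<close>. The intermediate
  value theorem on this interval also yields the upper bound.\<close>

lemma exists_matching_parameter:
  fixes V m X :: real
  assumes "0 < V" "0 < m" "0 < X"
  obtains a where "0 < a" "a \<le> V / m" "m = V * ((X / (a + X)) ^ (n - 1) / a)"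
proof -
  have "\<exists>a\<ge>0. a \<le> V / m \<and> a * (a + X) ^ (n - 1) * m = V * X ^ (n - 1)"
  proof (rule IVT')
    have "V * X ^ (n - 1) \<le> V * (V / m + X) ^ (n - 1)"
      using assms by (intro mult_left_mono power_mono) auto
    then show "V * X ^ (n - 1) \<le> V / m * (V / m + X) ^ (n - 1) * m"
      using assms by simp
  qed (use assms in \<open>auto intro!: continuous_intros\<close>)
  then obtain a where a: "0 \<le> a" "a \<le> V / m" "a * (a + X) ^ (n - 1) * m = V * X ^ (n - 1)" by blast
  have "a \<noteq> 0" using a(3) assms by auto
  then have "0 < a" using a(1) by simp
  moreover from this have "m = V * ((X / (a + X)) ^ (n - 1) / a)"
    using a(3) assms by (simp add: power_divide field_simps)
  ultimately show thesis using that a(2) by blast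
qed

text \<open>Up to the factor 1 / \<open>unit_ball_vol\<close> this is the density of exp(u) with
  respect to the Lebesgue measure after weighting with \<open>\<mu>\<close>; the constant factor is
  split off to keep the transport formulas clean.\<close>

definition tilted :: "('a::euclidean_space \<Rightarrow> real) \<Rightarrow> 'a \<Rightarrow> real"
  where "tilted u x = exp (u x) / (1 + \<tau> x) ^ DIM('a)"

text \<open>For $v = u + \log \mu_n$ and $D = \nabla u$ this is $\nabla v / (n p)$ with $p = n/(n-1)$.\<close>

definition slope :: "('a::euclidean_space \<Rightarrow> 'a) \<Rightarrow> 'a \<Rightarrow> 'a"
  where "slope D x = (1 / (real DIM('a) * conj_exp TYPE('a))) *\<^sub>R
    (D x - (real DIM('a) / (1 + \<tau> x)) *\<^sub>R grad_\<tau> x)"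

context
  fixes n :: nat and p :: real
  assumes n: "DIM('a::euclidean_space) = n" and dim: "2 \<le> n" and p: "conj_exp TYPE('a) = p"
begin

lemma \<tau>_le_cball: "0 \<le> X \<Longrightarrow> {x::'a. \<tau> x \<le> X} = cball 0 (X powr (1 / p))"
  by (auto simp: \<tau>_le_iff[OF n dim p])

lemma integrable_bounded_\<tau>_le:
  fixes h :: "'a \<Rightarrow> real"
  assumes [measurable]: "h \<in> borel_measurable borel" and X: "0 \<le> X"
    and h: "AE x in lborel. \<bar>h x\<bar> \<le> C * indicator {x. \<tau> x \<le> X} x"
  shows "integrable lborel h"
proof (rule Bochner_Integration.integrable_bound)
  show "integrable lborel (\<lambda>x::'a. C * indicator {x. \<tau> x \<le> X} x :: real)"
    unfolding \<tau>_le_cball[OF X]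
    by (intro integrable_mult_right integrable_real_indicator) (auto simp: emeasure_cball)
  show "AE x in lborel. norm (h x) \<le> norm (C * indicator {x. \<tau> x \<le> X} x :: real)"
    using h by eventually_elim auto
qed simp

lemma integrable_continuous_\<tau>_le:
  fixes h :: "'a \<Rightarrow> real"
  assumes "continuous_on UNIV h" "0 \<le> X"
  shows "integrable lborel (\<lambda>x. indicator {x. \<tau> x \<le> X} x * h x)"
  unfolding \<tau>_le_cball[OF assms(2)]
  using borel_integrable_compact[of "cball 0 (X powr (1 / p))" h] assms(1) continuous_on_subset by auto

lemma GDERIV_inverse_power_\<tau>:
  "GDERIV (\<lambda>x::'a. 1 / (1 + \<tau> x) ^ k) x :> (- real k / (1 + \<tau> x) ^ Suc k) *\<^sub>R grad_\<tau> x"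
proof -
  have "1 + \<tau> x \<noteq> 0" using \<tau>_nonneg[of x] by linarith
  from GDERIV_comp_\<tau>[OF n dim p DERIV_inverse_power[OF this, of k]] show ?thesis .
qed

lemma continuous_inverse_power_\<tau>: "continuous_on S (\<lambda>x::'a. 1 / (1 + \<tau> x) ^ k)"
  using \<tau>_nonneg
  by (intro continuous_intros continuous_\<tau>[OF n dim p]) (auto simp: add_nonneg_eq_0_iff)

lemma norm_slope_0: "norm (slope (\<lambda>_. 0) (x::'a)) ^ n = \<tau> x / (1 + \<tau> x) ^ n"
proof -
  have \<tau>1: "0 < 1 + \<tau> x" by (rule add_pos_nonneg) auto
  have p1: "1 < p" by (rule conj_exp_gt_1[OF n dim p])
  have "norm (slope (\<lambda>_. 0) x) = norm (grad_\<tau> x) / (p * (1 + \<tau> x))"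
    using \<tau>1 p1 dim by (simp add: slope_def n p)
  then show ?thesis
    using p1 by (simp add: power_divide power_mult_distrib norm_grad_\<tau>_power[OF n dim p])
qed

end

context
  fixes n :: nat and p :: real and u :: "'a::euclidean_space \<Rightarrow> real" and D :: "'a \<Rightarrow> 'a"
  assumes n: "DIM('a) = n" and dim: "2 \<le> n" and p: "conj_exp TYPE('a) = p"
    and u: "bump u D"
begin

lemma slope_continuous: "continuous_on S (slope D)"
  unfolding slope_def[abs_def]
  using continuous_on_subset[OF bump_continuous(2)[OF u], of S] \<tau>_nonneg
  by (intro continuous_intros continuous_grad_\<tau>[OF n dim p] continuous_\<tau>[OF n dim p])
     (auto simp: add_nonneg_eq_0_iff)

lemma tilted_continuous: "continuous_on S (tilted u)"
  unfolding tilted_def[abs_def]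
  using continuous_on_subset[OF bump_continuous(1)[OF u], of S] \<tau>_nonneg
  by (intro continuous_intros continuous_\<tau>[OF n dim p]) (auto simp: add_nonneg_eq_0_iff)

lemma tilted_pos: "0 < tilted u x"
  unfolding tilted_def by (intro divide_pos_pos zero_less_power add_pos_nonneg) auto

lemma tilted_borel [measurable]: "tilted u \<in> borel_measurable borel"
  by (rule borel_measurable_continuous_onI[OF tilted_continuous])

text \<open>Write Q for the transported energy, the integral of the source density times
  \<open>\<tau> (T x)\<close>. The n-th root of the density ratio contributes n a (mass) + n Q,
  Young's inequality uses up (n-1) Q, and one Q remains, which is the \<open>log_profile\<close>
  term because \<open>T\<close> transports to the explicit target. The summand
  \<open>n * unit_ball_vol n\<close> comes from the gradient of the cutoff, and
  \<open>\<delta>\<close> bounds the mass lost by cutting off.\<close>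

lemma transport_inequality:
  fixes a X :: real
  assumes X: "1 \<le> X" and supp: "\<And>x. X - 1 \<le> \<tau> x \<Longrightarrow> u x = 0"
    and a: "0 < a"
    and mass: "(LINT x|lborel. indicator {x. \<tau> x \<le> X} x * tilted u x)
      = unit_ball_vol n * ((X / (a + X)) ^ (n - 1) / a)"
  defines "\<delta> \<equiv> unit_ball_vol n * (real n - 1) / (X * (1 + X))"
  shows "n * a * (unit_ball_vol n * ((X / (a + X)) ^ (n - 1) / a) - \<delta>)
      + unit_ball_vol n * (log_profile n a X - log_profile n a 0) - X * \<delta>
    \<le> (LINT x|lborel. indicator {x. \<tau> x \<le> X} x * norm (slope D x) ^ n) + n * unit_ball_vol n"
proof -
  let ?I = "\<lambda>x::'a. indicator {x. \<tau> x \<le> X} x :: real"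
  note comm = n dim p
  have p1: "1 < p" by (rule conj_exp_gt_1[OF comm])
  have p_eq: "p = real n / (real n - 1)" by (rule conj_exp_eq[OF comm])
  have np: "1 / real n + 1 / p = 1" "real n / p = real n - 1" "p * (real n - 1) = real n"
    using dim by (auto simp: p_eq field_simps)
  have X0: "0 \<le> X" using X by simp
  define R where "R = X powr (1 / p)"
  have ball: "\<tau> x \<le> X \<longleftrightarrow> norm x \<le> R" for x :: 'a
    using \<tau>_le_iff[OF comm X0] by (simp add: R_def)
  define e where "e = tilted u"
  have e_eq: "e x = exp (u x) / (1 + \<tau> x) ^ n" for x by (simp add: e_def tilted_def n)
  have epos: "0 < e x" for x by (simp add: e_def tilted_pos)
  have [measurable]: "e \<in> borel_measurable borel" by (simp add: e_def tilted_borel)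
  obtain C where C: "\<And>x. \<tau> x \<le> X \<Longrightarrow> e x \<le> C"
  proof -
    have "compact (e ` cball 0 R)"
      unfolding e_def by (intro compact_continuous_image tilted_continuous) auto
    then obtain C where C: "\<forall>y\<in>e ` cball 0 R. norm y \<le> C"
      using compact_imp_bounded bounded_iff by blast
    show thesis
    proof (rule that[of C])
      fix x :: 'a assume "\<tau> x \<le> X"
      then have "x \<in> cball 0 R" using ball[of x] by simp
      with C have "norm (e x) \<le> C" by blast
      then show "e x \<le> C" by simp
    qed
  qed
  define \<rho> where "\<rho> x = ?I x * e x" for x
  define g where "g y = ?I y * (1 / (a + \<tau> y) ^ n)" for y
  have [measurable]: "\<rho> \<in> borel_measurable borel" "g \<in> borel_measurable borel"
    unfolding \<rho>_def[abs_def] g_def[abs_def] by measurable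
  have \<rho>_bound: "0 \<le> \<rho> x \<and> \<rho> x \<le> C \<and> (\<rho> x \<noteq> 0 \<longrightarrow> norm x \<le> R)" for x
    using C[of x] C[of 0] epos[of x] epos[of 0] X0 less_imp_le[OF epos[of x]] ball[of x]
    by (auto simp: \<rho>_def indicator_def \<tau>_def)
  have g_bound: "0 \<le> g x \<and> g x \<le> 1 / a ^ n \<and> (g x \<noteq> 0 \<longrightarrow> norm x \<le> R)" for x
  proof -
    have "a ^ n \<le> (a + \<tau> x) ^ n" using a by (intro power_mono) auto
    then have "1 / (a + \<tau> x) ^ n \<le> 1 / a ^ n"
      using a by (intro divide_left_mono) (auto intro!: mult_pos_pos zero_less_power add_pos_nonneg)
    then show ?thesis using a ball[of x] by (auto simp: g_def indicator_def)
  qed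
  have \<rho>_int: "integrable lborel \<rho>"
    unfolding \<rho>_def e_def by (intro integrable_continuous_\<tau>_le[OF n dim p] tilted_continuous X0)
  have \<rho>_mass: "(\<integral>\<^sup>+x. ennreal (\<rho> x) \<partial>lborel) = (\<integral>\<^sup>+x. ennreal (g x) \<partial>lborel)"
  proof -
    have "(\<integral>\<^sup>+x. ennreal (\<rho> x) \<partial>lborel) = ennreal (LINT x|lborel. \<rho> x)"
      using \<rho>_bound by (intro nn_integral_eq_integral \<rho>_int) auto
    also have "\<dots> = ennreal (LINT x|lborel. g x)"
      using mass mass_integral_le[OF comm a X0] by (simp add: \<rho>_def e_def g_def has_bochner_integral_iff)
    also have "\<dots> = (\<integral>\<^sup>+x. ennreal (g x) \<partial>lborel)"
      using mass_integral_le[OF comm a X0] g_bound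
      by (intro nn_integral_eq_integral[symmetric]) (auto simp: g_def has_bochner_integral_iff)
    finally show ?thesis .
  qed
  obtain T where T [measurable]: "T \<in> borel_measurable borel"
    and T_bound: "\<And>x b. b \<in> Basis \<Longrightarrow> \<bar>T x \<bullet> b\<bar> \<le> R"
    and push: "\<And>\<phi>. \<phi> \<in> borel_measurable borel \<Longrightarrow>
      (\<integral>\<^sup>+x. \<phi> (T x) * ennreal (\<rho> x) \<partial>lborel) = (\<integral>\<^sup>+y. \<phi> y * ennreal (g y) \<partial>lborel)"
    and weak: "\<And>(\<psi> :: 'a \<Rightarrow> real) G. bump \<psi> G \<Longrightarrow> (\<And>x. 0 \<le> \<psi> x) \<Longrightarrow>
      (\<integral>\<^sup>+x. ennreal (real DIM('a) * \<psi> x * (\<rho> x / g (T x)) powr (1 / DIM('a))) \<partial>lborel)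
        \<le> ennreal (- (LINT x|lborel. G x \<bullet> T x))"
    using knothe_transport[of \<rho> g C R "1 / a ^ n"] \<rho>_bound g_bound \<rho>_mass
    by (auto simp: R_def)
  \<comment> \<open>The coordinate bound only confines \<open>T\<close> to a cube; that almost every
    point of the ball is mapped into the ball follows because the target density vanishes outside
    it.\<close>
  have T_in: "AE x in lborel. \<tau> x \<le> X \<longrightarrow> \<tau> (T x) \<le> X"
  proof -
    have "(\<integral>\<^sup>+x. indicator {y. X < \<tau> y} (T x) * ennreal (\<rho> x) \<partial>lborel)
        = (\<integral>\<^sup>+y. indicator {y. X < \<tau> y} y * ennreal (g y) \<partial>lborel)"
      by (rule push) measurable
    also have "\<dots> = (\<integral>\<^sup>+y. 0 \<partial>(lborel :: 'a measure))"
      by (intro nn_integral_cong) (auto simp: g_def indicator_def)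
    finally have 0: "(\<integral>\<^sup>+x. indicator {y. X < \<tau> y} (T x) * ennreal (\<rho> x) \<partial>lborel) = 0" by simp
    have m: "(\<lambda>x. indicator {y. X < \<tau> y} (T x) * ennreal (\<rho> x)) \<in> borel_measurable lborel" by measurable
    have "AE x in lborel. indicator {y. X < \<tau> y} (T x) * ennreal (\<rho> x) = 0"
      using nn_integral_0_iff_AE[OF m] 0 by simp
    then show ?thesis
    proof eventually_elim
      case (elim x)
      show ?case
      proof
        assume "\<tau> x \<le> X"
        then have "ennreal (\<rho> x) \<noteq> 0" using epos[of x] by (simp add: \<rho>_def)
        then show "\<tau> (T x) \<le> X" using elim by (auto simp: indicator_def not_less split: if_splits)
      qed
    qed
  qed

  \<comment> \<open>This is \<open>e\<close> to the power (n-1)/n = 1/p. The exponent serves twice: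
    times the n-th root of \<open>e\<close> it gives \<open>e\<close>, and its p-th power, which
    Young's inequality produces, is \<open>e\<close> as well.\<close>
  define W where "W x = exp (u x / p) * (1 / (1 + \<tau> x) ^ (n - 1))" for x
  have \<tau>1: "0 < 1 + \<tau> x" for x :: 'a by (rule add_pos_nonneg) auto
  have Wpos: "0 < W x" for x using \<tau>1[of x] by (simp add: W_def)
  have W_e: "W x powr p = e x" "W x * e x powr (1 / n) = e x" for x
  proof -
    have *: "((1 + \<tau> x) ^ (n - 1)) powr p = (1 + \<tau> x) ^ n"
    proof -
      have "((1 + \<tau> x) ^ (n - 1)) powr p = (1 + \<tau> x) powr (real (n - 1) * p)"
        using \<tau>1[of x] by (simp add: powr_realpow[symmetric] powr_powr)
      also have "real (n - 1) * p = real n" using dim np(3) by (simp add: mult.commute)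
      finally show ?thesis using \<tau>1[of x] by (simp add: powr_realpow)
    qed
    show "W x powr p = e x"
      using p1 \<tau>1[of x] by (simp add: W_def e_eq powr_mult powr_divide *[unfolded One_nat_def] exp_powr_real)
    have "e x powr (1 / n) = exp (u x / n) / (1 + \<tau> x)"
      using dim \<tau>1[of x] by (simp add: e_eq powr_divide exp_powr_real powr_realpow[symmetric] powr_powr)
    moreover have "exp (u x / p) * exp (u x / n) = exp (u x)"
    proof -
      have "u x / p + u x / n = u x * (1 / real n + 1 / p)" by (simp add: field_simps)
      then show ?thesis using np(1) by (simp add: exp_add[symmetric])
    qed
    moreover have "(1 + \<tau> x) ^ n = (1 + \<tau> x) ^ (n - 1) * (1 + \<tau> x)"
      using dim by (metis power_Suc2 Suc_diff_1 less_le_trans zero_less_numeral)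
    ultimately show "W x * e x powr (1 / n) = e x"
      by (simp add: W_def e_eq)
  qed
  \<comment> \<open>The test function must have compact support. The cutoff acts only in the shell
    where \<open>\<tau>\<close> lies between \<open>X - 1\<close> and \<open>X\<close>, and there
    \<open>u\<close> vanishes.\<close>
  define \<eta> where "\<eta> x = ramp (X - \<tau> x)" for x :: 'a
  have \<eta>: "0 \<le> \<eta> x" "\<eta> x \<le> 1" for x by (simp_all add: \<eta>_def ramp_bounds)
  have \<eta>_0: "\<eta> x = 0" if "X \<le> \<tau> x" for x using that by (simp add: \<eta>_def ramp_eq_0)
  have \<eta>_1: "\<eta> x = 1" if "\<tau> x \<le> X - 1" for x using that by (simp add: \<eta>_def ramp_eq_1)
  define DW where "DW x = (W x / p) *\<^sub>R (D x - (real n / (1 + \<tau> x)) *\<^sub>R grad_\<tau> x)" for x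
  have GW: "GDERIV W x :> DW x" for x
  proof -
    have 1: "GDERIV (\<lambda>x. exp (u x / p)) x :> (exp (u x / p) * (1 / p)) *\<^sub>R D x"
    proof (rule GDERIV_DERIV_compose[where f = u and g = "\<lambda>t. exp (t / p)"])
      show "GDERIV u x :> D x" using u by (simp add: bump_def)
      show "((\<lambda>t. exp (t / p)) has_real_derivative exp (u x / p) * (1 / p)) (at (u x))"
        using p1 by (auto intro!: derivative_eq_intros)
    qed
    have 2: "GDERIV (\<lambda>x. 1 / (1 + \<tau> x) ^ (n - 1)) x :> (- (real n - 1) / (1 + \<tau> x) ^ n) *\<^sub>R grad_\<tau> x"
    proof (rule GDERIV_comp_\<tau>[OF comm])
      show "((\<lambda>t. 1 / (1 + t) ^ (n - 1)) has_real_derivative - (real n - 1) / (1 + \<tau> x) ^ n) (at (\<tau> x))"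
        using DERIV_inverse_power[of "\<tau> x" "n - 1"] \<tau>1[of x] dim by (simp add: of_nat_diff)
    qed
    have "DW x = exp (u x / p) *\<^sub>R ((- (real n - 1) / (1 + \<tau> x) ^ n) *\<^sub>R grad_\<tau> x)
        + (1 / (1 + \<tau> x) ^ (n - 1)) *\<^sub>R ((exp (u x / p) * (1 / p)) *\<^sub>R D x)"
    proof -
      have "W x / p * (real n / (1 + \<tau> x)) = exp (u x / p) * (real n - 1) / (1 + \<tau> x) ^ n"
      proof -
        have "(1 + \<tau> x) ^ n = (1 + \<tau> x) ^ (n - 1) * (1 + \<tau> x)"
          using dim by (metis power_Suc2 Suc_diff_1 less_le_trans zero_less_numeral)
        then show ?thesis by (simp add: W_def np(2)[symmetric])
      qed
      then have "DW x = (W x / p) *\<^sub>R D x - (exp (u x / p) * (real n - 1) / (1 + \<tau> x) ^ n) *\<^sub>R grad_\<tau> x"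
        by (simp add: DW_def scaleR_diff_right)
      moreover have "- (real n - 1) / (1 + \<tau> x) ^ n = - ((real n - 1) / (1 + \<tau> x) ^ n)"
        by (rule minus_divide_left[symmetric])
      ultimately show ?thesis by (simp only:) (simp add: W_def mult.commute)
    qed
    then show ?thesis
      unfolding W_def[abs_def] using GDERIV_mult[OF 1 2] by simp
  qed
  have G\<eta>: "GDERIV \<eta> x :> (- ramp' (X - \<tau> x)) *\<^sub>R grad_\<tau> x" for x
  proof -
    have "((\<lambda>t. ramp (X - t)) has_real_derivative ramp' (X - \<tau> x) * (- 1)) (at (\<tau> x))"
      by (rule DERIV_chain2[OF DERIV_ramp]) (auto intro!: derivative_eq_intros)
    from GDERIV_comp_\<tau>[OF comm this] show ?thesis by (simp add: \<eta>_def[abs_def])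
  qed
  define G where "G x = \<eta> x *\<^sub>R DW x + W x *\<^sub>R ((- ramp' (X - \<tau> x)) *\<^sub>R grad_\<tau> x)" for x
  have W_cont: "continuous_on UNIV W"
    unfolding W_def[abs_def]
    using bump_continuous(1)[OF u] p1 \<tau>_nonneg
    by (intro continuous_intros continuous_\<tau>[OF comm]) (auto simp: add_nonneg_eq_0_iff)
  have \<eta>_cont: "continuous_on UNIV \<eta>"
  proof -
    have "continuous_on UNIV ramp"
      using DERIV_ramp by (intro continuous_at_imp_continuous_on ballI DERIV_isCont)
    then show ?thesis
      unfolding \<eta>_def[abs_def]
      by (rule continuous_on_compose2) (auto intro!: continuous_intros continuous_\<tau>[OF comm])
  qed
  have bump: "bump (\<lambda>x. \<eta> x * W x) G"
    unfolding bump_def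
  proof (intro conjI allI exI impI)
    fix x show "GDERIV (\<lambda>x. \<eta> x * W x) x :> G x"
      unfolding G_def by (rule GDERIV_mult[OF G\<eta> GW])
  next
    have "continuous_on UNIV (\<lambda>x::'a. ramp' (X - \<tau> x))"
      by (rule continuous_on_compose2[OF continuous_ramp'[of UNIV]])
         (auto intro!: continuous_intros continuous_\<tau>[OF comm])
    moreover have "continuous_on UNIV DW"
      unfolding DW_def[abs_def]
      using bump_continuous(2)[OF u] p1 \<tau>_nonneg
      by (intro continuous_intros continuous_\<tau>[OF comm] continuous_grad_\<tau>[OF comm] W_cont)
         (auto simp: add_nonneg_eq_0_iff)
    ultimately show "continuous_on UNIV G"
      unfolding G_def[abs_def]
      by (intro continuous_intros W_cont \<eta>_cont continuous_grad_\<tau>[OF comm])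
  next
    fix x :: 'a assume "R < norm x"
    then have "X \<le> \<tau> x" using ball[of x] by simp
    then show "\<eta> x * W x = 0" "G x = 0" by (simp_all add: \<eta>_0 G_def ramp'_eq_0)
  qed
  have [measurable]: "\<eta> \<in> borel_measurable borel" "W \<in> borel_measurable borel"
    by (intro borel_measurable_continuous_onI \<eta>_cont W_cont)+
  define f where "f x = \<eta> x * e x" for x
  have [measurable]: "f \<in> borel_measurable borel" unfolding f_def[abs_def] by measurable
  have C0: "0 \<le> C" using \<rho>_bound[of 0] by simp
  have f_bound: "0 \<le> f x" "f x \<le> \<rho> x" "f x \<le> C * ?I x" for x
  proof -
    show "0 \<le> f x" using \<eta>[of x] epos[of x] by (simp add: f_def)
    show "f x \<le> \<rho> x"
      using \<eta>[of x] epos[of x] \<eta>_0[of x] by (cases "\<tau> x \<le> X") (auto simp: f_def \<rho>_def)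
    also have "\<rho> x \<le> C * ?I x" using C[of x] by (auto simp: \<rho>_def indicator_def)
    finally show "f x \<le> C * ?I x" .
  qed
  have fT_bound: "AE x in lborel. \<bar>f x * \<tau> (T x)\<bar> \<le> (C * X) * ?I x"
    using T_in
  proof eventually_elim
    case (elim x)
    show ?case
    proof (cases "\<tau> x \<le> X")
      case True
      have "f x * \<tau> (T x) \<le> C * X"
        using f_bound[of x] True elim C0 by (intro mult_mono) auto
      then show ?thesis using True f_bound(1)[of x] by (simp add: abs_mult)
    next
      case False
      then show ?thesis using \<eta>_0[of x] by (simp add: f_def)
    qed
  qed
  have f_int: "integrable lborel f"
    using f_bound by (intro integrable_bounded_\<tau>_le[OF n dim p _ X0, where C = C]) auto
  have fT_int: "integrable lborel (\<lambda>x. f x * \<tau> (T x))"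
    by (rule integrable_bounded_\<tau>_le[OF n dim p _ X0 fT_bound]) measurable

  define s where "s x = \<eta> x * norm (slope D x) ^ n" for x
  have s_int: "integrable lborel s"
  proof -
    have "integrable lborel (\<lambda>x. ?I x * s x)"
      unfolding s_def by (intro integrable_continuous_\<tau>_le[OF n dim p] X0 continuous_intros \<eta>_cont slope_continuous)
    moreover have "(\<lambda>x. ?I x * s x) = s"
      using \<eta>_0 by (fastforce simp: s_def indicator_def)
    ultimately show ?thesis by simp
  qed
  \<comment> \<open>Chosen so that (n-1) t^(n-2) h(t) is the derivative of -n ramp(X-t). The
    integral of \<open>B\<close> is then n times the ball volume, whatever \<open>X\<close> is. A
    division by zero at t = 0 is harmless, as \<open>ramp' X = 0\<close>.\<close>
  define h where "h t = real n * ramp' (X - t) / ((real n - 1) * t ^ (n - 2))" for t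
  define B where "B x = ?I x * h (\<tau> x)" for x
  have B: "has_bochner_integral lborel B (unit_ball_vol n * real n)"
  proof -
    have "has_bochner_integral lborel B (unit_ball_vol n * (- real n * ramp (X - X) - (- real n * ramp (X - 0))))"
      unfolding B_def
    proof (rule radial_integral_le[OF comm _ X0])
      show "h \<in> borel_measurable borel"
        unfolding h_def[abs_def] using borel_measurable_continuous_onI[OF continuous_ramp'] by measurable
      fix t assume t: "0 \<le> t" "t \<le> X"
      show "0 \<le> h t"
        unfolding h_def using t dim ramp'_bounds(1)
        by (intro divide_nonneg_nonneg mult_nonneg_nonneg) auto
      have "((\<lambda>t. - real n * ramp (X - t)) has_real_derivative - real n * (ramp' (X - t) * (- 1))) (at t)"
        by (intro DERIV_cmult DERIV_chain2[OF DERIV_ramp]) (auto intro!: derivative_eq_intros)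
      also have "- real n * (ramp' (X - t) * (- 1)) = (real n - 1) * t ^ (n - 2) * h t"
      proof (cases "t = 0")
        case True
        then show ?thesis using X by (simp add: h_def ramp'_eq_0)
      next
        case False
        then show ?thesis using dim by (simp add: h_def)
      qed
      finally show "((\<lambda>t. - real n * ramp (X - t)) has_real_derivative (real n - 1) * t ^ (n - 2) * h t) (at t)" .
    qed
    then show ?thesis using X by (simp add: ramp_eq_0 ramp_eq_1)
  qed

  have pointwise: "AE x in lborel. - (G x \<bullet> T x) \<le> s x + (real n - 1) * (f x * \<tau> (T x)) + B x"
    using T_in
  proof eventually_elim
    case (elim x)
    show ?case
    proof (cases "\<tau> x \<le> X")
      case False
      then show ?thesis by (simp add: G_def s_def f_def B_def \<eta>_0 ramp'_eq_0)
    next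
      case True
      then have TX: "\<tau> (T x) \<le> X" "norm (T x) \<le> R" using elim ball by auto
      have DW: "DW x = (real n * W x) *\<^sub>R slope D x"
        using dim p1 by (simp add: DW_def slope_def n p)
      have "- (\<eta> x *\<^sub>R DW x \<bullet> T x) \<le> s x + (real n - 1) * (f x * \<tau> (T x))"
      proof -
        \<comment> \<open>Young's inequality with the conjugate exponents n and p; the p-th power of
          \<open>W x * norm (T x)\<close> is \<open>e x * \<tau> (T x)\<close>.\<close>
        have "norm (slope D x) * (W x * norm (T x))
            \<le> norm (slope D x) powr real n / real n + (W x * norm (T x)) powr p / p"
          using dim p1 np(1) Wpos[of x] by (intro Youngs_inequality) auto
        also have "norm (slope D x) powr real n = norm (slope D x) ^ n"
          using dim by (intro powr_realpow') auto
        also have "(W x * norm (T x)) powr p = e x * \<tau> (T x)"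
          using Wpos[of x] by (simp add: powr_mult W_e \<tau>_def p)
        finally have "real n * (norm (slope D x) * (W x * norm (T x)))
            \<le> real n * (norm (slope D x) ^ n / real n + e x * \<tau> (T x) / p)"
          by (intro mult_left_mono) auto
        also have "\<dots> = norm (slope D x) ^ n + (real n / p) * (e x * \<tau> (T x))"
          using dim by (simp add: distrib_left)
        finally have Y: "real n * (norm (slope D x) * (W x * norm (T x)))
            \<le> norm (slope D x) ^ n + (real n - 1) * (e x * \<tau> (T x))"
          by (simp only: np(2))
        have "- (DW x \<bullet> T x) \<le> norm (DW x) * norm (T x)"
          using norm_cauchy_schwarz[of "- DW x" "T x"] by simp
        also have "\<dots> = real n * (norm (slope D x) * (W x * norm (T x)))"
          using Wpos[of x] by (simp add: DW)
        also note Y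
        finally have "\<eta> x * - (DW x \<bullet> T x) \<le> \<eta> x * (norm (slope D x) ^ n + (real n - 1) * (e x * \<tau> (T x)))"
          using \<eta>(1) by (rule mult_left_mono)
        then show ?thesis by (simp add: s_def f_def algebra_simps)
      qed
      \<comment> \<open>The boundary term. In the shell \<open>u = 0\<close>, so \<open>W\<close> is
        explicit; moreover |grad| |T x| is at most p \<tau>^(1/n) X^(1/p), and \<tau> \<le> X < 1 +
        \<tau>, so the powers of X and 1 + \<tau> cancel and leave \<open>h\<close>.\<close>
      moreover have "- (W x *\<^sub>R ((- ramp' (X - \<tau> x)) *\<^sub>R grad_\<tau> x) \<bullet> T x) \<le> B x"
      proof (cases "X - 1 < \<tau> x \<and> 0 < \<tau> x")
        case False
        then have "ramp' (X - \<tau> x) = 0" using X \<tau>_nonneg[of x] by (intro ramp'_eq_0) linarith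
        then show ?thesis by (simp add: B_def h_def)
      next
        case shell: True
        have tp: "0 < \<tau> x" using shell by simp
        have W1: "W x = 1 / (1 + \<tau> x) ^ (n - 1)" using supp[of x] shell by (simp add: W_def)
        have "grad_\<tau> x \<bullet> T x \<le> norm (grad_\<tau> x) * norm (T x)" by (rule norm_cauchy_schwarz)
        also have "\<dots> \<le> (p * \<tau> x powr (1 / n)) * X powr (1 / p)"
          using TX(2) p1 unfolding norm_grad_\<tau>[OF comm] \<tau>_powr[OF comm]
          by (intro mult_left_mono) (auto simp: R_def)
        finally have g1: "grad_\<tau> x \<bullet> T x \<le> p * (\<tau> x powr (1 / n) * X powr (1 / p))" by (simp add: mult.assoc)
        have "\<tau> x powr (1 / n) * X powr (1 / p) * \<tau> x ^ (n - 2) \<le> X powr (1 / n) * X powr (1 / p) * X ^ (n - 2)"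
          using True X dim p1 by (intro mult_mono powr_mono2 power_mono) auto
        also have "\<dots> = X * X ^ (n - 2)"
          using X np(1) by (simp add: powr_add[symmetric])
        also have "\<dots> = X ^ (n - 1)"
          using dim by (metis power_Suc Suc_diff_le diff_Suc_Suc numeral_2_eq_2 One_nat_def)
        also have "\<dots> \<le> (1 + \<tau> x) ^ (n - 1)"
          using shell X by (intro power_mono) auto
        finally have "\<tau> x powr (1 / n) * X powr (1 / p) \<le> (1 + \<tau> x) ^ (n - 1) / \<tau> x ^ (n - 2)"
          using tp by (simp add: pos_le_divide_eq)
        then have "p * (\<tau> x powr (1 / n) * X powr (1 / p)) \<le> p * ((1 + \<tau> x) ^ (n - 1) / \<tau> x ^ (n - 2))"
          using p1 by (intro mult_left_mono) auto
        with g1 have "grad_\<tau> x \<bullet> T x \<le> p * ((1 + \<tau> x) ^ (n - 1) / \<tau> x ^ (n - 2))" by linarith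
        then have "(W x * ramp' (X - \<tau> x)) * (grad_\<tau> x \<bullet> T x)
            \<le> (W x * ramp' (X - \<tau> x)) * (p * ((1 + \<tau> x) ^ (n - 1) / \<tau> x ^ (n - 2)))"
          using Wpos[of x] ramp'_bounds(1) by (intro mult_left_mono) auto
        also have "\<dots> = h (\<tau> x)"
          using \<tau>1[of x] by (simp add: W1 h_def p_eq)
        finally show ?thesis using True by (simp add: B_def mult.assoc)
      qed
      ultimately show ?thesis by (simp add: G_def inner_add_left inner_diff_left)
    qed
  qed
  have GT_int: "integrable lborel (\<lambda>x. G x \<bullet> T x)"
  proof -
    have "integrable lborel (\<lambda>x. \<Sum>b\<in>Basis. (G x \<bullet> b) * (T x \<bullet> b))"
      using T_bound by (intro Bochner_Integration.integrable_sum bump_integrable_inner[OF bump]) auto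
    then show ?thesis by (simp add: euclidean_inner[symmetric])
  qed
  define U where "U = (LINT x|lborel. s x + (real n - 1) * (f x * \<tau> (T x)) + B x)"
  have U_eq: "U = (LINT x|lborel. s x) + (real n - 1) * (LINT x|lborel. f x * \<tau> (T x)) + unit_ball_vol n * real n"
    unfolding U_def using s_int fT_int B by (simp add: has_bochner_integral_iff)
  have "- (LINT x|lborel. G x \<bullet> T x) = (LINT x|lborel. - (G x \<bullet> T x))" by simp
  also have "\<dots> \<le> U"
    unfolding U_def using s_int fT_int B GT_int
    by (intro integral_mono_AE pointwise) (auto simp: has_bochner_integral_iff)
  finally have upper: "- (LINT x|lborel. G x \<bullet> T x) \<le> U" .
  have U_nonneg: "0 \<le> U"
  proof -
    have "0 \<le> B x" for x
      using dim ramp'_bounds(1) unfolding B_def h_def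
      by (intro mult_nonneg_nonneg divide_nonneg_nonneg) (auto simp: indicator_def)
    then show ?thesis
      unfolding U_def using dim f_bound(1) \<eta>(1)
      by (intro integral_nonneg_AE AE_I2 add_nonneg_nonneg mult_nonneg_nonneg) (auto simp: s_def)
  qed
  define L where "L = (LINT x|lborel. real n * (a * f x + f x * \<tau> (T x)))"
  have L_eq: "L = real n * (a * (LINT x|lborel. f x) + (LINT x|lborel. f x * \<tau> (T x)))"
    unfolding L_def using f_int fT_int by simp
  have "ennreal L = (\<integral>\<^sup>+x. ennreal (real n * (a * f x + f x * \<tau> (T x))) \<partial>lborel)"
    unfolding L_def using f_int fT_int f_bound(1) a
    by (intro nn_integral_eq_integral[symmetric]) auto
  also have "\<dots> = (\<integral>\<^sup>+x. ennreal (real DIM('a) * (\<eta> x * W x) * (\<rho> x / g (T x)) powr (1 / DIM('a))) \<partial>lborel)"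
  proof (rule nn_integral_cong_AE)
    show "AE x in lborel. ennreal (real n * (a * f x + f x * \<tau> (T x)))
        = ennreal (real DIM('a) * (\<eta> x * W x) * (\<rho> x / g (T x)) powr (1 / DIM('a)))"
      using T_in
    proof eventually_elim
      case (elim x)
      show ?case
      proof (cases "\<tau> x \<le> X")
        case False
        then show ?thesis by (simp add: f_def \<eta>_0)
      next
        case True
        then have TX: "\<tau> (T x) \<le> X" using elim by simp
        have aT: "0 < a + \<tau> (T x)" using a by (intro add_pos_nonneg) auto
        \<comment> \<open>The target is an inverse n-th power, so the n-th root of the ratio is
          affine in \<open>\<tau> (T x)\<close>.\<close>
        have "\<rho> x / g (T x) = e x * (a + \<tau> (T x)) ^ n"
          using True TX by (simp add: \<rho>_def g_def)
        also have "\<dots> powr (1 / n) = e x powr (1 / n) * (a + \<tau> (T x))"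
          using aT dim epos[of x] by (simp add: powr_mult powr_realpow[symmetric] powr_powr)
        finally have "W x * (\<rho> x / g (T x)) powr (1 / n) = e x * (a + \<tau> (T x))"
          using W_e(2)[of x] by (simp add: mult.assoc[symmetric])
        then have "real n * (\<eta> x * W x) * (\<rho> x / g (T x)) powr (1 / n) = real n * \<eta> x * (e x * (a + \<tau> (T x)))"
          by (simp add: mult.assoc)
        then show ?thesis by (simp add: n f_def algebra_simps)
      qed
    qed
  qed
  also have "\<dots> \<le> ennreal (- (LINT x|lborel. G x \<bullet> T x))"
    by (rule weak[OF bump]) (use \<eta>(1) Wpos less_imp_le in \<open>auto intro!: mult_nonneg_nonneg\<close>)
  also have "\<dots> \<le> ennreal U" using upper by (rule ennreal_leI)
  finally have "L \<le> U" using U_nonneg by simp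
  \<comment> \<open>The transported energy occurs n times on the left and n - 1 times on the right;
    one copy survives.\<close>
  then have key: "real n * a * (LINT x|lborel. f x) + (LINT x|lborel. f x * \<tau> (T x))
      \<le> (LINT x|lborel. s x) + unit_ball_vol n * real n"
    unfolding L_eq U_eq by (simp add: algebra_simps)

  \<comment> \<open>Only the shell contributes to the lost mass, and there the source is the
    untilted density. Its mass is a difference of (n-1)-st powers of X/(1+X) and (X-1)/X, whose
    bases differ by 1/(X (1+X)); hence the form of \<open>\<delta>\<close>.\<close>
  define loss where "loss = (LINT x|lborel. \<rho> x - f x)"
  have loss_le: "loss \<le> \<delta>"
  proof -
    let ?k = "\<lambda>x::'a. 1 / (1 + \<tau> x) ^ n"
    let ?J = "\<lambda>x::'a. indicator {x. \<tau> x \<le> X - 1} x :: real"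
    have m1: "has_bochner_integral lborel (\<lambda>x. ?I x * ?k x) (unit_ball_vol n * ((X / (1 + X)) ^ (n - 1) / 1))"
      by (rule mass_integral_le[OF comm]) (use X in auto)
    have m2: "has_bochner_integral lborel (\<lambda>x. ?J x * ?k x)
        (unit_ball_vol n * (((X - 1) / (1 + (X - 1))) ^ (n - 1) / 1))"
      by (rule mass_integral_le[OF comm]) (use X in auto)
    have "loss \<le> (LINT x|lborel. ?I x * ?k x - ?J x * ?k x)"
      unfolding loss_def
    proof (rule integral_mono)
      show "integrable lborel (\<lambda>x. \<rho> x - f x)" using \<rho>_int f_int by simp
      show "integrable lborel (\<lambda>x. ?I x * ?k x - ?J x * ?k x)"
        using m1 m2 by (simp add: has_bochner_integral_iff)
      fix x :: 'a
      consider "\<tau> x \<le> X - 1" | "X - 1 < \<tau> x" "\<tau> x \<le> X" | "X < \<tau> x" by linarith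
      then show "\<rho> x - f x \<le> ?I x * ?k x - ?J x * ?k x"
      proof cases
        case 1
        then show ?thesis by (simp add: \<rho>_def f_def \<eta>_1)
      next
        case 2
        then have "e x = ?k x" using supp[of x] by (simp add: e_eq)
        moreover have "0 \<le> ?k x * \<eta> x" using \<tau>1[of x] \<eta>(1) by (intro mult_nonneg_nonneg) auto
        ultimately show ?thesis using 2 by (simp add: \<rho>_def f_def)
      next
        case 3
        then show ?thesis by (simp add: \<rho>_def f_def \<eta>_0)
      qed
    qed
    also have "\<dots> = unit_ball_vol n * ((X / (1 + X)) ^ (n - 1) - ((X - 1) / X) ^ (n - 1))"
      using m1 m2 by (simp add: has_bochner_integral_iff right_diff_distrib)
    also have "\<dots> \<le> unit_ball_vol n * (real (n - 1) * (X / (1 + X) - (X - 1) / X))"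
      using X by (intro mult_left_mono power_diff_le_linear) (auto simp: field_simps)
    also have "X / (1 + X) - (X - 1) / X = 1 / (X * (1 + X))"
      using X by (simp add: field_simps)
    finally show ?thesis using dim by (simp add: \<delta>_def of_nat_diff)
  qed
  have f_ge: "(LINT x|lborel. \<rho> x) - \<delta> \<le> (LINT x|lborel. f x)"
    using loss_le \<rho>_int f_int by (simp add: loss_def)
  have \<rho>T: "integrable lborel (\<lambda>x. \<rho> x * \<tau> (T x))"
    "(LINT x|lborel. \<rho> x * \<tau> (T x)) = unit_ball_vol n * (log_profile n a X - log_profile n a 0)"
  proof -
    have E: "has_bochner_integral lborel (\<lambda>y. \<tau> y * g y) (unit_ball_vol n * (log_profile n a X - log_profile n a 0))"
      using energy_integral_le[OF comm a X0] by (simp add: g_def mult_ac)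
    have "has_bochner_integral lborel (\<lambda>x. \<tau> (T x) * \<rho> x) (unit_ball_vol n * (log_profile n a X - log_profile n a 0))"
    proof (rule has_bochner_integral_nn_integral)
      have "(\<integral>\<^sup>+x. ennreal (\<tau> (T x) * \<rho> x) \<partial>lborel) = (\<integral>\<^sup>+x. ennreal (\<tau> (T x)) * ennreal (\<rho> x) \<partial>lborel)"
        using \<rho>_bound by (intro nn_integral_cong ennreal_mult) auto
      also have "\<dots> = (\<integral>\<^sup>+y. ennreal (\<tau> y) * ennreal (g y) \<partial>lborel)" by (rule push) measurable
      also have "\<dots> = (\<integral>\<^sup>+y. ennreal (\<tau> y * g y) \<partial>lborel)"
        using g_bound by (intro nn_integral_cong ennreal_mult[symmetric]) auto
      also have "\<dots> = ennreal (LINT y|lborel. \<tau> y * g y)"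
        using E g_bound by (intro nn_integral_eq_integral) (auto simp: has_bochner_integral_iff)
      finally show "(\<integral>\<^sup>+x. ennreal (\<tau> (T x) * \<rho> x) \<partial>lborel)
          = ennreal (unit_ball_vol n * (log_profile n a X - log_profile n a 0))"
        using E by (simp add: has_bochner_integral_iff)
      have "0 \<le> (LINT y|lborel. \<tau> y * g y)"
        using g_bound by (intro integral_nonneg_AE) auto
      then show "0 \<le> unit_ball_vol n * (log_profile n a X - log_profile n a 0)"
        using E by (simp add: has_bochner_integral_iff)
    qed (use \<rho>_bound in auto)
    then show "integrable lborel (\<lambda>x. \<rho> x * \<tau> (T x))"
      "(LINT x|lborel. \<rho> x * \<tau> (T x)) = unit_ball_vol n * (log_profile n a X - log_profile n a 0)"
      by (simp_all add: has_bochner_integral_iff mult.commute)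
  qed
  \<comment> \<open>As \<open>T\<close> stays in the ball, the lost transported energy is at most
    \<open>X\<close> times the lost mass. \<open>X * \<delta>\<close> is of order 1/X, so this error
    still vanishes in the limit.\<close>
  have "(LINT x|lborel. \<rho> x * \<tau> (T x) - f x * \<tau> (T x)) \<le> (LINT x|lborel. X * (\<rho> x - f x))"
  proof (rule integral_mono_AE)
    show "AE x in lborel. \<rho> x * \<tau> (T x) - f x * \<tau> (T x) \<le> X * (\<rho> x - f x)"
      using T_in
    proof eventually_elim
      case (elim x)
      show ?case
      proof (cases "\<tau> x \<le> X")
        case True
        then have "(\<rho> x - f x) * \<tau> (T x) \<le> (\<rho> x - f x) * X"
          using elim f_bound(2)[of x] by (intro mult_left_mono) auto
        then show ?thesis by (simp add: algebra_simps)
      next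
        case False
        then show ?thesis by (simp add: \<rho>_def f_def \<eta>_0)
      qed
    qed
  qed (use \<rho>T fT_int \<rho>_int f_int in auto)
  then have fT_ge: "unit_ball_vol n * (log_profile n a X - log_profile n a 0) - X * loss
      \<le> (LINT x|lborel. f x * \<tau> (T x))"
    using \<rho>T fT_int by (simp add: loss_def)
  have "X * loss \<le> X * \<delta>" using loss_le X0 by (rule mult_left_mono)
  moreover have "real n * a * ((LINT x|lborel. \<rho> x) - \<delta>) \<le> real n * a * (LINT x|lborel. f x)"
    using f_ge a by (intro mult_left_mono) auto
  moreover have "(LINT x|lborel. s x) \<le> (LINT x|lborel. ?I x * norm (slope D x) ^ n)"
  proof (rule integral_mono[OF s_int])
    show "integrable lborel (\<lambda>x. ?I x * norm (slope D x) ^ n)"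
      by (intro integrable_continuous_\<tau>_le[OF n dim p] X0 continuous_intros slope_continuous)
    fix x :: 'a
    have "\<eta> x \<le> ?I x" using \<eta>(2)[of x] \<eta>_0[of x] by (cases "\<tau> x \<le> X") auto
    then show "s x \<le> ?I x * norm (slope D x) ^ n" unfolding s_def by (rule mult_right_mono) simp
  qed
  moreover have "(LINT x|lborel. \<rho> x) = unit_ball_vol n * ((X / (a + X)) ^ (n - 1) / a)"
    using mass by (simp add: \<rho>_def e_def)
  ultimately show ?thesis
    using key fT_ge by (simp add: mult.commute[of _ "real n"])
qed

end

section \<open>The lower bound for the energy\<close>

text \<open>The matched parameter \<open>a\<close> varies with \<open>X\<close>, and only
  \<open>a \<le> A\<close> is known. The quotient (a+X)/a decreases in \<open>a\<close>, and the
  powers of X/(a+X) are at most 1; the resulting harmonic sum cancels against the profile with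
  parameter 1 as \<open>X\<close> grows.\<close>

lemma log_profile_diff_ge:
  fixes a A X :: real
  assumes dim: "2 \<le> n" and "0 < a" "a \<le> A" "0 < X"
  shows "(real n - 1) * (ln (A + X) - ln A - (\<Sum>j=1..n-1. 1 / real j))
    \<le> log_profile n a X - log_profile n a 0"
proof -
  have "(\<Sum>j=1..n-1. (0 / (a + 0)) ^ j / real j) = 0"
    by (intro sum.neutral) auto
  then have z: "log_profile n a 0 = (real n - 1) * (ln (a + 0) - 0)"
    by (simp only: log_profile_def)
  have "(\<Sum>j=1..n-1. (X / (a + X)) ^ j / real j) \<le> (\<Sum>j=1..n-1. 1 / real j)"
    using assms by (intro sum_mono divide_right_mono power_le_one) auto
  moreover have "ln (A + X) - ln A \<le> ln (a + X) - ln a"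
  proof -
    have "(A + X) / A \<le> (a + X) / a" using assms by (simp add: field_simps)
    then have "ln ((A + X) / A) \<le> ln ((a + X) / a)" using assms by (intro ln_mono) auto
    then show ?thesis using assms by (simp add: ln_div)
  qed
  ultimately have "ln (A + X) - ln A - (\<Sum>j=1..n-1. 1 / real j)
      \<le> (ln (a + X) - (\<Sum>j=1..n-1. (X / (a + X)) ^ j / real j)) - (ln (a + 0) - 0)"
    by simp
  from mult_left_mono[OF this, of "real n - 1"] show ?thesis
    using dim unfolding z by (simp add: log_profile_def right_diff_distrib)
qed

context
  fixes n :: nat and p :: real and u :: "'a::euclidean_space \<Rightarrow> real" and D :: "'a \<Rightarrow> 'a"
  assumes n: "DIM('a) = n" and dim: "2 \<le> n" and p: "conj_exp TYPE('a) = p"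
    and u: "bump u D"
begin

lemma bump_abs_bound:
  obtains M where "\<And>x. \<bar>u x\<bar> \<le> M"
proof -
  obtain K where K: "\<And>x. K < norm x \<Longrightarrow> u x = 0"
    using u unfolding bump_def by blast
  have "compact (u ` cball 0 \<bar>K\<bar>)"
    by (intro compact_continuous_image continuous_on_subset[OF bump_continuous(1)[OF u]]) auto
  then obtain M where M: "\<forall>y\<in>u ` cball 0 \<bar>K\<bar>. norm y \<le> M"
    using compact_imp_bounded bounded_iff by blast
  have "\<bar>u x\<bar> \<le> \<bar>M\<bar>" for x
  proof (cases "x \<in> cball 0 \<bar>K\<bar>")
    case True
    then have "norm (u x) \<le> M" using M by blast
    then show ?thesis by simp
  next
    case False
    then have "K < norm x" by simp
    then show ?thesis using K by simp
  qed
  then show thesis by (rule that)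
qed

lemma bump_\<tau>_support:
  obtains X where "1 \<le> X" "\<And>x. X - 1 \<le> \<tau> x \<Longrightarrow> u x = 0 \<and> D x = 0"
proof -
  obtain K where K: "\<And>x. K < norm x \<Longrightarrow> u x = 0 \<and> D x = 0"
    using u unfolding bump_def by blast
  have p1: "1 < p" by (rule conj_exp_gt_1[OF n dim p])
  let ?X = "1 + (\<bar>K\<bar> + 1) powr p"
  show thesis
  proof (rule that)
    show "1 \<le> ?X" by simp
    fix x :: 'a assume "?X - 1 \<le> \<tau> x"
    then have "((\<bar>K\<bar> + 1) powr p) powr (1 / p) \<le> \<tau> x powr (1 / p)"
      using p1 by (intro powr_mono2) auto
    then have "\<bar>K\<bar> + 1 \<le> norm x"
      using p1 by (simp add: \<tau>_powr_inverse[OF n dim p] powr_powr)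
    then show "u x = 0 \<and> D x = 0" by (intro K) linarith
  qed
qed

lemma tilted_integrable: "integrable lborel (tilted u)"
proof -
  obtain M where M: "\<And>x. \<bar>u x\<bar> \<le> M" using bump_abs_bound by blast
  show ?thesis
  proof (rule Bochner_Integration.integrable_bound)
    show "integrable lborel (\<lambda>x::'a. exp M * (1 / (1 + \<tau> x) ^ n))"
      using mass_integral[OF n dim p, of 1]
      by (intro integrable_mult_right) (simp add: has_bochner_integral_iff)
    show "tilted u \<in> borel_measurable lborel"
      using tilted_borel[OF n dim p u] by simp
    have "tilted u x \<le> exp M * (1 / (1 + \<tau> x) ^ n)" for x
    proof -
      have "u x \<le> M" using M[of x] by simp
      moreover have "0 < (1 + \<tau> x) ^ n" by (intro zero_less_power add_pos_nonneg) auto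
      ultimately show ?thesis by (simp add: tilted_def n divide_right_mono)
    qed
    then show "AE x in lborel. norm (tilted u x) \<le> norm (exp M * (1 / (1 + \<tau> x) ^ n))"
      using tilted_pos[OF n dim p u]
      by (intro AE_I2) (metis real_norm_def abs_of_pos abs_ge_self order_trans)
  qed
qed

lemma tilted_mass_ge:
  assumes M: "\<And>x. \<bar>u x\<bar> \<le> M" and X: "0 \<le> X"
  shows "exp (- M) * (unit_ball_vol n * (X / (1 + X)) ^ (n - 1))
    \<le> (LINT x|lborel. indicator {x. \<tau> x \<le> X} x * tilted u x)"
proof -
  let ?I = "\<lambda>x::'a. indicator {x. \<tau> x \<le> X} x :: real"
  have m: "has_bochner_integral lborel (\<lambda>x. ?I x * (1 / (1 + \<tau> x) ^ n)) (unit_ball_vol n * ((X / (1 + X)) ^ (n - 1) / 1))"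
    by (rule mass_integral_le[OF n dim p _ X]) simp
  have "(LINT x|lborel. exp (- M) * (?I x * (1 / (1 + \<tau> x) ^ n))) \<le> (LINT x|lborel. ?I x * tilted u x)"
  proof (rule integral_mono)
    show "integrable lborel (\<lambda>x. exp (- M) * (?I x * (1 / (1 + \<tau> x) ^ n)))"
      using m by (intro integrable_mult_right) (simp add: has_bochner_integral_iff)
    show "integrable lborel (\<lambda>x. ?I x * tilted u x)"
      by (intro integrable_continuous_\<tau>_le[OF n dim p] tilted_continuous[OF n dim p u] X)
    fix x :: 'a
    have "- M \<le> u x" using M[of x] by linarith
    moreover have "0 < (1 + \<tau> x) ^ n" by (intro zero_less_power add_pos_nonneg) auto
    ultimately show "exp (- M) * (?I x * (1 / (1 + \<tau> x) ^ n)) \<le> ?I x * tilted u x"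
      by (auto simp: tilted_def n divide_right_mono indicator_def)
  qed
  then show ?thesis
    by (simp only: integral_mult_right_zero has_bochner_integral_integral_eq[OF m] div_by_1)
qed

lemma tilted_mass_tendsto:
  "(\<lambda>k. LINT x|lborel. indicator {x. \<tau> x \<le> real k} x * tilted u x) \<longlonglongrightarrow> (LINT x|lborel. tilted u x)"
proof (rule integral_dominated_convergence[OF _ _ tilted_integrable])
  show "(\<lambda>x. indicator {x. \<tau> x \<le> real k} x * tilted u x) \<in> borel_measurable lborel" for k
    using tilted_borel[OF n dim p u] by measurable
  show "tilted u \<in> borel_measurable lborel" using tilted_borel[OF n dim p u] by simp
  show "AE x in lborel. norm (indicator {x. \<tau> x \<le> real k} x * tilted u x) \<le> tilted u x" for k
    using tilted_pos[OF n dim p u] by (intro AE_I2) (auto simp: indicator_def less_imp_le)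
  show "AE x in lborel. (\<lambda>k. indicator {x. \<tau> x \<le> real k} x * tilted u x) \<longlonglongrightarrow> tilted u x"
  proof (rule AE_I2)
    fix x :: 'a
    obtain k0 :: nat where "\<tau> x \<le> real k0" using real_arch_simple by blast
    then have "indicator {x. \<tau> x \<le> real k} x * tilted u x = tilted u x" if "k0 \<le> k" for k
      using that by (auto simp: indicator_def)
    then have "\<forall>\<^sub>F k in sequentially. indicator {x. \<tau> x \<le> real k} x * tilted u x = tilted u x"
      by (rule eventually_mono[OF eventually_ge_at_top[of k0]])
    then show "(\<lambda>k. indicator {x. \<tau> x \<le> real k} x * tilted u x) \<longlonglongrightarrow> tilted u x"
      by (rule tendsto_eventually)
  qed
qed

text \<open>Outside the support the two slopes coincide. The difference is therefore integrable
  although each of the two energies diverges.\<close>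

lemma energy_difference:
  assumes X: "0 \<le> X" and supp: "\<And>x. X \<le> \<tau> x \<Longrightarrow> D x = 0"
  shows "integrable lborel (\<lambda>x. norm (slope D x) ^ n - norm (slope (\<lambda>_. 0) x) ^ n)"
    and "(LINT x|lborel. norm (slope D x) ^ n - norm (slope (\<lambda>_. 0) x) ^ n)
      = (LINT x|lborel. indicator {x. \<tau> x \<le> X} x * norm (slope D x) ^ n)
        - unit_ball_vol n * (log_profile n 1 X - log_profile n 1 0)"
proof -
  let ?I = "\<lambda>x::'a. indicator {x. \<tau> x \<le> X} x :: real"
  have eq: "norm (slope D x) ^ n - norm (slope (\<lambda>_. 0) x) ^ n
      = ?I x * norm (slope D x) ^ n - ?I x * (\<tau> x / (1 + \<tau> x) ^ n)" for x
    using supp[of x] norm_slope_0[OF n dim p, of x] by (cases "\<tau> x \<le> X") (auto simp: slope_def)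
  have 1: "integrable lborel (\<lambda>x. ?I x * norm (slope D x) ^ n)"
    by (intro integrable_continuous_\<tau>_le[OF n dim p] X continuous_intros slope_continuous[OF n dim p u])
  have 2: "has_bochner_integral lborel (\<lambda>x. ?I x * (\<tau> x / (1 + \<tau> x) ^ n))
      (unit_ball_vol n * (log_profile n 1 X - log_profile n 1 0))"
    by (rule energy_integral_le[OF n dim p _ X]) simp
  show "integrable lborel (\<lambda>x. norm (slope D x) ^ n - norm (slope (\<lambda>_. 0) x) ^ n)"
    unfolding eq using 1 2 by (simp add: has_bochner_integral_iff)
  show "(LINT x|lborel. norm (slope D x) ^ n - norm (slope (\<lambda>_. 0) x) ^ n)
      = (LINT x|lborel. ?I x * norm (slope D x) ^ n)
        - unit_ball_vol n * (log_profile n 1 X - log_profile n 1 0)"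
    unfolding eq using 1 2 by (simp add: has_bochner_integral_iff)
qed

text \<open>The strict inequality for \<open>A\<close> leaves room: the mass on large balls is close
  to the total mass, so the matched parameters are eventually at most \<open>A\<close>. This makes
  the lower bound depend on the radius alone, and its limit can be taken.\<close>

lemma energy_lower_bound_aux:
  assumes A: "unit_ball_vol n / (LINT x|lborel. tilted u x) < A"
  shows "- (unit_ball_vol n * (real n - 1) * ln A)
    \<le> (LINT x|lborel. norm (slope D x) ^ n - norm (slope (\<lambda>_. 0) x) ^ n)" (is "?L \<le> ?E")
proof -
  let ?V = "unit_ball_vol (real n)"
  let ?S = "LINT x|lborel. tilted u x"
  define m where "m X = (LINT x|lborel. indicator {x. \<tau> x \<le> X} x * tilted u x)" for X
  have V: "0 < ?V" by simp
  obtain M where M: "\<And>x. \<bar>u x\<bar> \<le> M" using bump_abs_bound by blast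
  have m_pos: "0 < m X" if "0 < X" for X
  proof -
    have "0 < exp (- M) * (?V * (X / (1 + X)) ^ (n - 1))" using V that by (intro mult_pos_pos zero_less_power) auto
    then show ?thesis
      unfolding m_def using tilted_mass_ge[OF M less_imp_le[OF that]] by (rule less_le_trans)
  qed
  have m_mono: "m X \<le> m Y" if "0 \<le> X" "X \<le> Y" for X Y
    unfolding m_def using that tilted_pos[OF n dim p u]
    by (intro integral_mono integrable_continuous_\<tau>_le[OF n dim p] tilted_continuous[OF n dim p u])
       (auto simp: indicator_def less_imp_le)
  have m_lim: "(\<lambda>k. m (real k)) \<longlonglongrightarrow> ?S"
    unfolding m_def by (rule tilted_mass_tendsto)
  have S: "0 < ?S"
  proof -
    have "m 1 \<le> ?S"
    proof (rule LIMSEQ_le_const[OF m_lim], intro exI[of _ 1] allI impI)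
      fix k :: nat assume "1 \<le> k"
      then show "m 1 \<le> m (real k)" by (intro m_mono) auto
    qed
    then show ?thesis using m_pos[of 1] by simp
  qed
  have A0: "0 < A" using A V S by (meson divide_pos_pos less_trans)
  have "?V / A < ?S" using A A0 S by (simp add: field_simps)
  then have ev: "\<forall>\<^sub>F k in sequentially. ?V / A < m (real k)"
    by (rule order_tendstoD(1)[OF m_lim])
  obtain X0 where X0: "1 \<le> X0" and supp: "\<And>x. X0 - 1 \<le> \<tau> x \<Longrightarrow> u x = 0 \<and> D x = 0"
    using bump_\<tau>_support by blast
  define H where "H = (\<Sum>j=1..n-1. 1 / real j)"
  \<comment> \<open>The bound from the transport inequality with \<open>a\<close> replaced by
    \<open>A\<close> and the profile with parameter 1 subtracted. It is arranged in the quotients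
    X/(1+X) and X/(A+X), which tend to 1, so that only \<open>- ln A\<close> survives: the harmonic
    sums cancel, and so do the boundary term and the limit of the mass term.\<close>
  define \<Psi> where "\<Psi> X = ?V * ((real n - 1) * (ln (X / (1 + X)) - ln (X / (A + X)) - ln A - H
        + (\<Sum>j=1..n-1. (X / (1 + X)) ^ j / real j)))
      + real n * ?V * ((X / (A + X)) ^ (n - 1) - 1)
      - ?V * (real n - 1) * (real n * A * inverse X * inverse (1 + X) + inverse (1 + X))" for X
  have lower: "\<Psi> X \<le> ?E" if X: "X0 \<le> X" "?V / A < m X" for X
  proof -
    have X1: "1 \<le> X" "0 < X" "0 \<le> X" using X X0 by auto
    obtain a where a: "0 < a" "a \<le> ?V / m X" "m X = ?V * ((X / (a + X)) ^ (n - 1) / a)"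
      using exists_matching_parameter[OF V m_pos[OF X1(2)] X1(2)] by blast
    have "?V / m X \<le> A" using X(2) A0 m_pos[OF X1(2)] by (simp add: field_simps)
    then have aA: "a \<le> A" using a(2) by linarith
    define \<delta> where "\<delta> = ?V * (real n - 1) / (X * (1 + X))"
    have \<delta>0: "0 \<le> \<delta>" unfolding \<delta>_def using V dim X1 by (intro divide_nonneg_nonneg mult_nonneg_nonneg) auto
    have "real n * a * (?V * ((X / (a + X)) ^ (n - 1) / a) - \<delta>)
        + ?V * (log_profile n a X - log_profile n a 0) - X * \<delta>
      \<le> (LINT x|lborel. indicator {x. \<tau> x \<le> X} x * norm (slope D x) ^ n) + real n * ?V"
      unfolding \<delta>_def
    proof (rule transport_inequality[OF n dim p u X1(1) _ a(1)])
      show "u x = 0" if "X - 1 \<le> \<tau> x" for x using supp[of x] that X(1) by simp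
      show "(LINT x|lborel. indicator {x. \<tau> x \<le> X} x * tilted u x) = ?V * ((X / (a + X)) ^ (n - 1) / a)"
        using a(3) by (simp add: m_def)
    qed
    moreover have "(LINT x|lborel. indicator {x. \<tau> x \<le> X} x * norm (slope D x) ^ n)
        = ?E + ?V * (log_profile n 1 X - log_profile n 1 0)"
    proof -
      have "D x = 0" if "X \<le> \<tau> x" for x using supp[of x] that X(1) by simp
      from energy_difference(2)[OF X1(3) this] show ?thesis by simp
    qed
    ultimately have 1: "real n * a * (?V * ((X / (a + X)) ^ (n - 1) / a)) - real n * a * \<delta>
        + ?V * (log_profile n a X - log_profile n a 0) - X * \<delta>
      \<le> ?E + ?V * (log_profile n 1 X - log_profile n 1 0) + real n * ?V"
      by (simp add: right_diff_distrib)
    have 2: "real n * a * (?V * ((X / (a + X)) ^ (n - 1) / a)) = real n * ?V * (X / (a + X)) ^ (n - 1)"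
      using a(1) by simp
    have "(X / (A + X)) ^ (n - 1) \<le> (X / (a + X)) ^ (n - 1)"
      using a(1) aA X1 by (intro power_mono divide_left_mono) auto
    then have 3: "real n * ?V * (X / (A + X)) ^ (n - 1) \<le> real n * ?V * (X / (a + X)) ^ (n - 1)"
      using V by (intro mult_left_mono) auto
    have 4: "?V * ((real n - 1) * (ln (A + X) - ln A - H)) \<le> ?V * (log_profile n a X - log_profile n a 0)"
      unfolding H_def using V by (intro mult_left_mono log_profile_diff_ge dim a(1) aA X1(2)) auto
    have 5: "real n * a * \<delta> \<le> real n * A * \<delta>"
      using aA \<delta>0 by (intro mult_right_mono mult_left_mono) auto
    have 6: "log_profile n 1 X - log_profile n 1 0 = (real n - 1) * (ln (1 + X) - (\<Sum>j=1..n-1. (X / (1 + X)) ^ j / real j))"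
    proof -
      have "(\<Sum>j=1..n-1. (0 / (1 + 0)) ^ j / real j) = 0" by (intro sum.neutral) auto
      then have "log_profile n 1 0 = 0" by (simp add: log_profile_def)
      then show ?thesis by (simp add: log_profile_def)
    qed
    have 7: "ln (X / (1 + X)) - ln (X / (A + X)) = ln (A + X) - ln (1 + X)"
      using X1 A0 by (simp add: ln_div)
    have 8: "real n * A * \<delta> + X * \<delta> = ?V * (real n - 1) * (real n * A * inverse X * inverse (1 + X) + inverse (1 + X))"
    proof -
      have \<delta>': "\<delta> = ?V * (real n - 1) * inverse X * inverse (1 + X)"
        by (simp add: \<delta>_def divide_inverse)
      have "X * \<delta> = ?V * (real n - 1) * (X * inverse X) * inverse (1 + X)"
        unfolding \<delta>' by (simp only: mult_ac)
      then have "X * \<delta> = ?V * (real n - 1) * inverse (1 + X)" using X1 by simp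
      then show ?thesis unfolding \<delta>' by (simp add: algebra_simps)
    qed
    have "\<Psi> X = ?V * ((real n - 1) * (ln (A + X) - ln A - H)) - ?V * (log_profile n 1 X - log_profile n 1 0)
        + real n * ?V * (X / (A + X)) ^ (n - 1) - real n * ?V - (real n * A * \<delta> + X * \<delta>)"
      unfolding \<Psi>_def 7 8 6 by (simp add: algebra_simps)
    then show ?thesis using 1 2 3 4 5 by linarith
  qed
  have inv: "((\<lambda>X. inverse X) \<longlongrightarrow> 0) (at_top :: real filter)"
    "((\<lambda>X. inverse (1 + X)) \<longlongrightarrow> 0) (at_top :: real filter)"
    by (intro tendsto_inverse_0_at_top filterlim_tendsto_add_at_top[OF tendsto_const] filterlim_ident)+
  have "(\<Psi> \<longlongrightarrow> ?V * ((real n - 1) * (ln 1 - ln 1 - ln A - H + (\<Sum>j=1..n-1. 1 ^ j / real j)))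
      + real n * ?V * (1 ^ (n - 1) - 1) - ?V * (real n - 1) * (real n * A * 0 * 0 + 0)) at_top"
    unfolding \<Psi>_def
    by (intro tendsto_intros ratio_tendsto_1 inv) (use A0 in auto)
  moreover have "?V * ((real n - 1) * (ln 1 - ln 1 - ln A - H + (\<Sum>j=1..n-1. 1 ^ j / real j)))
      + real n * ?V * (1 ^ (n - 1) - 1) - ?V * (real n - 1) * (real n * A * 0 * 0 + 0) = ?L"
    by (simp add: H_def)
  ultimately have "(\<Psi> \<longlongrightarrow> ?L) at_top" by simp
  then have "(\<lambda>k. \<Psi> (real k)) \<longlonglongrightarrow> ?L"
    by (rule filterlim_compose) (rule filterlim_real_sequentially)
  then show ?thesis
  proof (rule tendsto_upperbound)
    obtain k0 :: nat where k0: "X0 \<le> real k0" using real_arch_simple by blast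
    show "\<forall>\<^sub>F k in sequentially. \<Psi> (real k) \<le> ?E"
      using ev eventually_ge_at_top[of k0] by eventually_elim (use k0 in \<open>auto intro!: lower\<close>)
  qed simp
qed

lemma tilted_mass_pos: "0 < (LINT x|lborel. tilted u x)"
proof -
  obtain M where M: "\<And>x. \<bar>u x\<bar> \<le> M" using bump_abs_bound by blast
  have "0 < exp (- M) * (unit_ball_vol n * (1 / (1 + 1)) ^ (n - 1))" by simp
  also have "\<dots> \<le> (LINT x|lborel. indicator {x. \<tau> x \<le> 1} x * tilted u x)"
    by (rule tilted_mass_ge[OF M]) simp
  also have "\<dots> \<le> (LINT x|lborel. tilted u x)"
    using tilted_pos[OF n dim p u]
    by (intro integral_mono tilted_integrable integrable_continuous_\<tau>_le[OF n dim p] tilted_continuous[OF n dim p u])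
       (auto simp: indicator_def less_imp_le)
  finally show ?thesis .
qed

text \<open>The limit of the preceding bound as \<open>A\<close> decreases to the critical value; a
  number strictly between the two sides of a violated inequality supplies a contradicting
  \<open>A\<close>.\<close>

theorem energy_lower_bound:
  "unit_ball_vol n * (real n - 1) * ln ((LINT x|lborel. tilted u x) / unit_ball_vol n)
    \<le> (LINT x|lborel. norm (slope D x) ^ n - norm (slope (\<lambda>_. 0) x) ^ n)" (is "_ \<le> ?E")
proof -
  let ?V = "unit_ball_vol (real n)" and ?S = "LINT x|lborel. tilted u x"
  let ?k = "?V * (real n - 1)"
  have k: "0 < ?k" using dim by simp
  have c: "0 < ?V / ?S" using tilted_mass_pos by simp
  have "- ?E / ?k \<le> ln (?V / ?S)"
  proof (rule ccontr)
    assume "\<not> - ?E / ?k \<le> ln (?V / ?S)"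
    then obtain l where l: "ln (?V / ?S) < l" "l < - ?E / ?k"
      using dense[of "ln (?V / ?S)" "- ?E / ?k"] by auto
    have "?V / ?S < exp l" using l(1) c by (metis exp_less_cancel_iff exp_ln)
    from energy_lower_bound_aux[OF this] have "- (?k * l) \<le> ?E" by simp
    then have "- ?E \<le> l * ?k" by (metis minus_le_iff mult.commute)
    then have "- ?E / ?k \<le> l" by (simp only: pos_divide_le_eq[OF k])
    with l(2) show False by simp
  qed
  then have "- ?E \<le> ln (?V / ?S) * ?k" by (simp only: pos_divide_le_eq[OF k])
  then have "- ?E \<le> ?k * ln (?V / ?S)" by (simp only: mult.commute)
  moreover have "ln (?V / ?S) = - ln (?S / ?V)"
    using tilted_mass_pos by (simp add: ln_div)
  ultimately show ?thesis by simp
qed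

end

section \<open>Integration by parts and the concentrating family\<close>

lemma GDERIV_inner_right: "GDERIV (\<lambda>x. x \<bullet> b) x :> b"
  unfolding gderiv_def by (auto intro!: derivative_eq_intros)

context
  fixes n :: nat and p :: real and u :: "'a::euclidean_space \<Rightarrow> real" and D :: "'a \<Rightarrow> 'a"
  assumes n: "DIM('a) = n" and dim: "2 \<le> n" and p: "conj_exp TYPE('a) = p"
    and u: "bump u D"
begin

lemma bump_integrable:
  assumes "continuous_on UNIV h"
  shows "integrable lborel (\<lambda>x. u x * h x)"
proof -
  obtain K where K: "\<And>x. K < norm x \<Longrightarrow> u x = 0"
    using u unfolding bump_def by blast
  have "integrable lborel (\<lambda>x. indicator (cball 0 \<bar>K\<bar>) x *\<^sub>R (u x * h x))"
    by (rule borel_integrable_compact)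
       (auto intro!: continuous_intros continuous_on_subset[OF bump_continuous(1)[OF u]]
         continuous_on_subset[OF assms])
  moreover have "(\<lambda>x. indicator (cball 0 \<bar>K\<bar>) x *\<^sub>R (u x * h x)) = (\<lambda>x. u x * h x)"
    using K by (fastforce simp: indicator_def)
  ultimately show ?thesis by simp
qed

text \<open>The vector field $x (1 + \tau)^{-(n-1)}$ is, up to a factor, $|\nabla f|^{n-2} \nabla f$ for
  $f = \log \mu_n$, and its divergence is $n (1 + \tau)^{-n}$: the $n$-Laplacian of $\log\mu_n$ is
  a multiple of $\mu_n$.\<close>

lemma integration_by_parts:
  "integrable lborel (\<lambda>x. (x \<bullet> D x) / (1 + \<tau> x) ^ (n - 1))"
  "(LINT x|lborel. (x \<bullet> D x) / (1 + \<tau> x) ^ (n - 1)) = - (real n * (LINT x|lborel. u x * (1 / (1 + \<tau> x) ^ n)))"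
proof -
  let ?q = "\<lambda>x::'a. 1 / (1 + \<tau> x) ^ (n - 1)"
  let ?Dq = "\<lambda>x::'a. (- (real n - 1) / (1 + \<tau> x) ^ n) *\<^sub>R grad_\<tau> x"
  \<comment> \<open>The gradient of \<open>u\<close> times the \<open>b\<close>-th component of the
    vector field. Its \<open>b\<close>-th components add up to the divergence of the product, and
    each of them has integral zero.\<close>
  let ?G = "\<lambda>b x. u x *\<^sub>R ((x \<bullet> b) *\<^sub>R ?Dq x + ?q x *\<^sub>R b) + ((x \<bullet> b) * ?q x) *\<^sub>R D x"
  have Dq: "GDERIV ?q x :> ?Dq x" for x
    using GDERIV_inverse_power_\<tau>[OF n dim p, of "n - 1" x] dim by (simp add: of_nat_diff)
  have D: "GDERIV u x :> D x" for x using u by (simp add: bump_def)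
  obtain K where K: "\<And>x. K < norm x \<Longrightarrow> u x = 0 \<and> D x = 0"
    using u unfolding bump_def by blast
  have Dq_cont: "continuous_on UNIV ?Dq"
    using \<tau>_nonneg
    by (intro continuous_intros continuous_\<tau>[OF n dim p] continuous_grad_\<tau>[OF n dim p])
       (auto simp: add_nonneg_eq_0_iff)
  have bump: "bump (\<lambda>x. u x * ((x \<bullet> b) * ?q x)) (?G b)" for b
    unfolding bump_def
  proof (intro conjI allI exI impI)
    show "GDERIV (\<lambda>x. u x * ((x \<bullet> b) * ?q x)) x :> ?G b x" for x
      by (intro GDERIV_mult D Dq GDERIV_inner_right)
    show "continuous_on UNIV (?G b)"
      by (intro continuous_intros continuous_inverse_power_\<tau>[OF n dim p] Dq_cont bump_continuous[OF u])
    fix x :: 'a assume "K < norm x"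
    with K show "u x * ((x \<bullet> b) * ?q x) = 0" "?G b x = 0" by auto
  qed
  have G_int: "integrable lborel (\<lambda>x. ?G b x \<bullet> b)" for b
    using bump_integrable_inner[OF bump, of "\<lambda>_. 1" 1 b b] by simp
  have sum: "(\<Sum>b\<in>Basis. ?G b x \<bullet> b) = (x \<bullet> D x) / (1 + \<tau> x) ^ (n - 1) + real n * (u x * (1 / (1 + \<tau> x) ^ n))" for x
  proof -
    have t1: "1 + \<tau> x \<noteq> 0" using \<tau>_nonneg[of x] by linarith
    have "(\<Sum>b\<in>Basis. ?G b x \<bullet> b)
        = (\<Sum>b\<in>Basis. (u x * (- (real n - 1) / (1 + \<tau> x) ^ n)) * ((x \<bullet> b) * (grad_\<tau> x \<bullet> b))
            + u x * ?q x + ?q x * ((x \<bullet> b) * (D x \<bullet> b)))"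
      by (intro sum.cong) (auto simp: inner_add_left algebra_simps)
    also have "\<dots> = (u x * (- (real n - 1) / (1 + \<tau> x) ^ n)) * (x \<bullet> grad_\<tau> x) + real n * (u x * ?q x) + ?q x * (x \<bullet> D x)"
      by (simp only: sum.distrib sum_distrib_left[symmetric] euclidean_inner[symmetric] sum_constant n)
         (simp only: mult_ac)
    also have "x \<bullet> grad_\<tau> x = p * \<tau> x" by (rule inner_grad_\<tau>[OF n dim p])
    also have "(u x * (- (real n - 1) / (1 + \<tau> x) ^ n)) * (p * \<tau> x)
        = - ((p * (real n - 1)) * (u x * \<tau> x / (1 + \<tau> x) ^ n))"
      by (simp add: divide_inverse algebra_simps)
    \<comment> \<open>This identity makes the contribution of the radial factor cancel the \<tau> in
      (1 + \<tau>) / (1 + \<tau>)^n, so the divergence is exactly n (1 + \<tau>)^(-n).\<close>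
    also have "p * (real n - 1) = real n" by (rule conj_exp_powers(1)[OF n dim p])
    finally have eq: "(\<Sum>b\<in>Basis. ?G b x \<bullet> b)
        = - (real n * (u x * \<tau> x / (1 + \<tau> x) ^ n)) + real n * (u x * ?q x) + ?q x * (x \<bullet> D x)" .
    have q: "?q x = (1 + \<tau> x) / (1 + \<tau> x) ^ n"
    proof -
      have "(1 + \<tau> x) ^ n = (1 + \<tau> x) * (1 + \<tau> x) ^ (n - 1)"
        using dim by (metis power_Suc Suc_diff_1 less_le_trans zero_less_numeral)
      then show ?thesis using t1 by simp
    qed
    have "real n * (u x * ?q x) - real n * (u x * \<tau> x / (1 + \<tau> x) ^ n) = real n * (u x * (1 / (1 + \<tau> x) ^ n))"
      unfolding q by (simp add: divide_inverse algebra_simps)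
    then show ?thesis unfolding eq by simp
  qed
  have ui: "integrable lborel (\<lambda>x. u x * (1 / (1 + \<tau> x) ^ n))"
    by (rule bump_integrable[OF continuous_inverse_power_\<tau>[OF n dim p]])
  have "integrable lborel (\<lambda>x. \<Sum>b\<in>Basis. ?G b x \<bullet> b)"
    by (intro Bochner_Integration.integrable_sum G_int)
  then have si: "integrable lborel (\<lambda>x. (x \<bullet> D x) / (1 + \<tau> x) ^ (n - 1) + real n * (u x * (1 / (1 + \<tau> x) ^ n)))"
    unfolding sum .
  then have "integrable lborel (\<lambda>x. ((x \<bullet> D x) / (1 + \<tau> x) ^ (n - 1) + real n * (u x * (1 / (1 + \<tau> x) ^ n)))
      - real n * (u x * (1 / (1 + \<tau> x) ^ n)))"
    by (intro Bochner_Integration.integrable_diff integrable_mult_right ui)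
  then show 1: "integrable lborel (\<lambda>x. (x \<bullet> D x) / (1 + \<tau> x) ^ (n - 1))" by (simp only: add_diff_cancel_right')
  have "0 = (LINT x|lborel. (\<Sum>b\<in>Basis. ?G b x \<bullet> b))"
    using bump_integral_inner[OF bump] by (subst Bochner_Integration.integral_sum[OF G_int]) simp
  also have "\<dots> = (LINT x|lborel. (x \<bullet> D x) / (1 + \<tau> x) ^ (n - 1)) + real n * (LINT x|lborel. u x * (1 / (1 + \<tau> x) ^ n))"
    unfolding sum by (subst Bochner_Integration.integral_add[OF 1 integrable_mult_right[OF ui]])
      (simp only: integral_mult_right_zero)
  finally show "(LINT x|lborel. (x \<bullet> D x) / (1 + \<tau> x) ^ (n - 1)) = - (real n * (LINT x|lborel. u x * (1 / (1 + \<tau> x) ^ n)))"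
    by linarith
qed

end

text \<open>Truncation of the extremal $\log\bigl((1+t)/(a+t)\bigr)^n$, which is not compactly supported.\<close>

definition conc :: "nat \<Rightarrow> real \<Rightarrow> real \<Rightarrow> real"
  where "conc n a t = real n * (ramp (2 - t) * (ln (1 + t) - ln (a + t)))"

definition conc' :: "nat \<Rightarrow> real \<Rightarrow> real \<Rightarrow> real"
  where "conc' n a t = real n * (ramp (2 - t) * (1 / (1 + t) - 1 / (a + t)) - ramp' (2 - t) * (ln (1 + t) - ln (a + t)))"

section \<open>Estimates along the concentrating family\<close>

context
  fixes n :: nat and a :: real
  assumes a: "0 < a" "a < 1"
begin

lemma DERIV_conc:
  assumes "0 \<le> t"
  shows "(conc n a has_real_derivative conc' n a t) (at t)"
proof -
  have r: "((\<lambda>t. ramp (2 - t)) has_real_derivative ramp' (2 - t) * (- 1)) (at t)"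
    by (rule DERIV_chain2[OF DERIV_ramp]) (auto intro!: derivative_eq_intros)
  have l: "((\<lambda>t. ln (1 + t) - ln (a + t)) has_real_derivative 1 / (1 + t) - 1 / (a + t)) (at t)"
    using a assms by (auto intro!: derivative_eq_intros)
  show ?thesis
    unfolding conc_def[abs_def]
    using DERIV_cmult[OF DERIV_mult[OF r l], of "real n"]
    by (simp add: conc'_def algebra_simps)
qed

lemma conc_eq_0: "2 \<le> t \<Longrightarrow> conc n a t = 0" "2 \<le> t \<Longrightarrow> conc' n a t = 0"
  by (simp_all add: conc_def conc'_def ramp_eq_0 ramp'_eq_0)

lemma conc_inner:
  assumes "0 \<le> t" "t \<le> 1"
  shows "conc n a t = real n * (ln (1 + t) - ln (a + t))"
    "conc' n a t - real n / (1 + t) = - (real n / (a + t))"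
  using assms by (simp_all add: conc_def conc'_def ramp_eq_1 ramp'_eq_0 algebra_simps)

text \<open>Two upper bounds for two regions: near the origin \<open>- ln a\<close>, which blows up
  as \<open>a\<close> tends to 0, and for \<open>t \<ge> s\<close> a bound free of
  \<open>a\<close>.\<close>

lemma ln_ratio:
  assumes "0 \<le> t"
  shows "0 \<le> ln (1 + t) - ln (a + t)" "ln (1 + t) - ln (a + t) \<le> - ln a"
    "0 < s \<Longrightarrow> s \<le> t \<Longrightarrow> ln (1 + t) - ln (a + t) \<le> ln (1 + 1 / s)"
proof -
  show "0 \<le> ln (1 + t) - ln (a + t)" using a assms by simp
  have "(1 + t) / (a + t) \<le> 1 / a" using a assms by (simp add: field_simps mult_left_le_one_le)
  then have "ln ((1 + t) / (a + t)) \<le> ln (1 / a)" using a assms by (intro ln_mono) auto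
  then show "ln (1 + t) - ln (a + t) \<le> - ln a" using a assms by (simp add: ln_div)
  assume s: "0 < s" "s \<le> t"
  have "(1 + t) / (a + t) \<le> (1 + t) / t" using a s by (intro divide_left_mono) auto
  also have "\<dots> = 1 + 1 / t" using s by (simp add: field_simps)
  also have "\<dots> \<le> 1 + 1 / s" using s by (intro add_left_mono divide_left_mono) auto
  finally have "ln ((1 + t) / (a + t)) \<le> ln (1 + 1 / s)" using a assms by (intro ln_mono) auto
  then show "ln (1 + t) - ln (a + t) \<le> ln (1 + 1 / s)" using a assms by (simp add: ln_div)
qed

lemma conc_le:
  assumes "0 \<le> t"
  shows "conc n a t \<le> real n * (ln (1 + t) - ln (a + t))"
  unfolding conc_def using ramp_bounds ln_ratio(1)[OF assms]
  by (intro mult_left_mono mult_left_le_one_le) auto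

text \<open>The constant is 4 = 1 + 2 + 1: the derivative of the logarithm, the derivative of the
  cutoff times a logarithm of at most ln 2, and 1/(1+t). It does not depend on
  \<open>a\<close>.\<close>

lemma conc'_shell:
  assumes "1 \<le> t"
  shows "\<bar>conc' n a t - real n / (1 + t)\<bar> \<le> 4 * real n"
proof -
  let ?l = "ln (1 + t) - ln (a + t)" and ?r = "1 / (1 + t) - 1 / (a + t)"
  have "?l \<le> ln (1 + 1 / 1)" using assms by (intro ln_ratio(3)) auto
  also have "\<dots> \<le> 1" using ln_add_one_self_le_self[of 1] by simp
  finally have l: "0 \<le> ?l" "?l \<le> 1" using ln_ratio(1)[of t] assms by auto
  have "1 / (a + t) \<le> 1" "0 \<le> 1 / (a + t)" "1 / (1 + t) \<le> 1" "0 \<le> 1 / (1 + t)"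
    using a assms by auto
  then have r: "\<bar>?r\<bar> \<le> 1" "\<bar>1 / (1 + t)\<bar> \<le> 1" by linarith+
  have "\<bar>ramp (2 - t) * ?r\<bar> \<le> 1 * 1"
    unfolding abs_mult using ramp_bounds[of "2 - t"] r by (intro mult_mono) auto
  moreover have "\<bar>ramp' (2 - t) * ?l\<bar> \<le> 2 * 1"
    unfolding abs_mult using ramp'_bounds[of "2 - t"] l by (intro mult_mono) auto
  ultimately have "\<bar>ramp (2 - t) * ?r - ramp' (2 - t) * ?l - 1 / (1 + t)\<bar> \<le> 4"
    using r(2) by linarith
  then have "real n * \<bar>ramp (2 - t) * ?r - ramp' (2 - t) * ?l - 1 / (1 + t)\<bar> \<le> real n * 4"
    by (intro mult_left_mono) auto
  moreover have "conc' n a t - real n / (1 + t) = real n * (ramp (2 - t) * ?r - ramp' (2 - t) * ?l - 1 / (1 + t))"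
    by (simp add: conc'_def right_diff_distrib)
  ultimately show ?thesis by (simp add: abs_mult)
qed

context
  fixes p :: real
  assumes n: "DIM('a::euclidean_space) = n" and dim: "2 \<le> n" and p: "conj_exp TYPE('a) = p"
begin

lemma bump_conc: "bump (\<lambda>x::'a. conc n a (\<tau> x)) (\<lambda>x. conc' n a (\<tau> x) *\<^sub>R grad_\<tau> x)"
  unfolding bump_def
proof (intro conjI allI exI impI)
  show "GDERIV (\<lambda>x::'a. conc n a (\<tau> x)) x :> conc' n a (\<tau> x) *\<^sub>R grad_\<tau> x" for x
    by (intro GDERIV_comp_\<tau>[OF n dim p] DERIV_conc) simp
  have "continuous_on UNIV ramp"
    using DERIV_ramp by (intro continuous_at_imp_continuous_on ballI DERIV_isCont)
  then have "continuous_on UNIV (\<lambda>x::'a. ramp (2 - \<tau> x))"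
    by (rule continuous_on_compose2) (auto intro!: continuous_intros continuous_\<tau>[OF n dim p])
  moreover have "continuous_on UNIV (\<lambda>x::'a. ramp' (2 - \<tau> x))"
    by (rule continuous_on_compose2[OF continuous_ramp'[of UNIV]])
       (auto intro!: continuous_intros continuous_\<tau>[OF n dim p])
  moreover have "a + \<tau> x \<noteq> 0" "1 + \<tau> x \<noteq> 0" for x :: 'a
    using a \<tau>_nonneg[of x] by linarith+
  ultimately show "continuous_on UNIV (\<lambda>x::'a. conc' n a (\<tau> x) *\<^sub>R grad_\<tau> x)"
    unfolding conc'_def
    by (intro continuous_intros continuous_\<tau>[OF n dim p] continuous_grad_\<tau>[OF n dim p]) auto
  fix x :: 'a assume "2 powr (1 / p) < norm x"
  then have "2 \<le> \<tau> x" using \<tau>_le_iff[OF n dim p, of 2 x] by simp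
  then show "conc n a (\<tau> x) = 0" "conc' n a (\<tau> x) *\<^sub>R grad_\<tau> x = 0"
    by (simp_all add: conc_eq_0)
qed

text \<open>Where \<tau> is at most 1 the tilted density is exactly (a + \<tau>)^(-n), whose energy
  is a difference of \<open>log_profile\<close> values and gives the \<open>- ln a\<close>. The
  shell up to \<tau> = 2 costs a bounded amount, and beyond it the difference of the energies is
  zero.\<close>

lemma conc_energy_le:
  "(LINT x|lborel. norm (slope (\<lambda>x. conc' n a (\<tau> x) *\<^sub>R grad_\<tau> x) x) ^ n - norm (slope (\<lambda>_. 0) (x::'a)) ^ n)
    \<le> unit_ball_vol n * (real n - 1) * (ln 2 - ln a) + 2 * 4 ^ n * (unit_ball_vol n * 2 ^ (n - 1))"
proof -
  let ?D = "\<lambda>x::'a. conc' n a (\<tau> x) *\<^sub>R grad_\<tau> x"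
  let ?I = "\<lambda>X x::'a. indicator {x. \<tau> x \<le> X} x :: real"
  have p1: "1 < p" by (rule conj_exp_gt_1[OF n dim p])
  have slope_eq: "norm (slope ?D x) ^ n = \<bar>conc' n a (\<tau> x) - real n / (1 + \<tau> x)\<bar> ^ n * \<tau> x / real n ^ n" for x
  proof -
    have "slope ?D x = ((conc' n a (\<tau> x) - real n / (1 + \<tau> x)) / (real n * p)) *\<^sub>R grad_\<tau> x"
      by (simp add: slope_def n p scaleR_diff_left[symmetric])
    then have "norm (slope ?D x) ^ n = \<bar>(conc' n a (\<tau> x) - real n / (1 + \<tau> x)) / (real n * p)\<bar> ^ n * (p ^ n * \<tau> x)"
      by (simp only: norm_scaleR power_mult_distrib norm_grad_\<tau>_power[OF n dim p])
    then show ?thesis using p1 dim by (simp add: abs_mult power_divide power_mult_distrib)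
  qed
  have zero: "norm (slope (\<lambda>_. 0) x) ^ n = \<tau> x / (1 + \<tau> x) ^ n" for x :: 'a
    by (rule norm_slope_0[OF n dim p])
  have e: "has_bochner_integral lborel (\<lambda>x::'a. ?I 1 x * (\<tau> x / (a + \<tau> x) ^ n))
      (unit_ball_vol n * (log_profile n a 1 - log_profile n a 0))"
    by (rule energy_integral_le[OF n dim p a(1)]) simp
  have I2: "has_bochner_integral lborel (?I 2) (unit_ball_vol n * 2 ^ (n - 1))"
    using has_bochner_integral_real_indicator[of "{x::'a. \<tau> x \<le> 2}" lborel] emeasure_\<tau>_le[OF n dim p, of 2]
    by (simp add: measure_def)
  have bound: "norm (slope ?D x) ^ n - norm (slope (\<lambda>_. 0) x) ^ n \<le> ?I 1 x * (\<tau> x / (a + \<tau> x) ^ n) + 2 * 4 ^ n * ?I 2 x" for x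
  proof -
    have t: "0 \<le> \<tau> x" by simp
    have nn: "0 \<le> \<tau> x / (1 + \<tau> x) ^ n" "0 \<le> \<tau> x / (a + \<tau> x) ^ n" using a by (auto intro!: divide_nonneg_nonneg)
    consider "\<tau> x \<le> 1" | "1 < \<tau> x" "\<tau> x \<le> 2" | "2 < \<tau> x" by linarith
    then show ?thesis
    proof cases
      case 1
      have "\<bar>conc' n a (\<tau> x) - real n / (1 + \<tau> x)\<bar> = real n / (a + \<tau> x)"
        unfolding conc_inner(2)[OF t 1] using a t by simp
      then have "norm (slope ?D x) ^ n = \<tau> x / (a + \<tau> x) ^ n"
        using dim unfolding slope_eq by (simp add: power_divide)
      moreover have I: "?I 1 x = 1" "?I 2 x = 1" using 1 by auto
      moreover have "0 \<le> (2 :: real) * 4 ^ n" by simp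
      ultimately show ?thesis using nn(1) unfolding zero I mult_1 mult_1_right by linarith
    next
      case 2
      have "\<bar>conc' n a (\<tau> x) - real n / (1 + \<tau> x)\<bar> ^ n * \<tau> x \<le> (4 * real n) ^ n * 2"
        using 2 by (intro mult_mono power_mono conc'_shell) auto
      then have "norm (slope ?D x) ^ n \<le> (4 * real n) ^ n * 2 / real n ^ n"
        unfolding slope_eq by (intro divide_right_mono) auto
      also have "\<dots> = 2 * 4 ^ n" using dim by (simp add: power_mult_distrib)
      finally have "norm (slope ?D x) ^ n \<le> 2 * 4 ^ n" .
      moreover have I: "?I 1 x = 0" "?I 2 x = 1" using 2 by auto
      ultimately show ?thesis using nn(1) unfolding zero I mult_zero_left mult_1_right by linarith
    next
      case 3
      then have "norm (slope ?D x) ^ n = norm (slope (\<lambda>_. 0) x) ^ n" by (simp add: slope_def conc_eq_0)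
      then show ?thesis using 3 by simp
    qed
  qed
  have "(LINT x|lborel. norm (slope ?D x) ^ n - norm (slope (\<lambda>_. 0) x) ^ n)
      \<le> (LINT x|lborel. ?I 1 x * (\<tau> x / (a + \<tau> x) ^ n) + 2 * 4 ^ n * ?I 2 x)"
  proof (rule integral_mono[OF _ _ bound])
    show "integrable lborel (\<lambda>x. norm (slope ?D x) ^ n - norm (slope (\<lambda>_. 0) x) ^ n)"
      by (rule energy_difference(1)[OF n dim p bump_conc, of 2]) (auto simp: conc_eq_0)
    show "integrable lborel (\<lambda>x. ?I 1 x * (\<tau> x / (a + \<tau> x) ^ n) + 2 * 4 ^ n * ?I 2 x)"
      using e I2 by (intro Bochner_Integration.integrable_add integrable_mult_right) (auto simp: has_bochner_integral_iff)
  qed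
  also have "\<dots> = unit_ball_vol n * (log_profile n a 1 - log_profile n a 0) + 2 * 4 ^ n * (unit_ball_vol n * 2 ^ (n - 1))"
    by (rule has_bochner_integral_integral_eq)
       (intro has_bochner_integral_add has_bochner_integral_mult_right e I2)
  finally have le: "(LINT x|lborel. norm (slope ?D x) ^ n - norm (slope (\<lambda>_. 0) x) ^ n)
    \<le> unit_ball_vol n * (log_profile n a 1 - log_profile n a 0) + 2 * 4 ^ n * (unit_ball_vol n * 2 ^ (n - 1))" .
  have "log_profile n a 1 - log_profile n a 0 \<le> (real n - 1) * (ln 2 - ln a)"
  proof -
    have "(\<Sum>j=1..n-1. (0 / (a + 0)) ^ j / real j) = 0"
      by (intro sum.neutral) auto
    then have z: "log_profile n a 0 = (real n - 1) * (ln (a + 0) - 0)"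
      by (simp only: log_profile_def)
    have "0 \<le> (\<Sum>j=1..n-1. (1 / (a + 1)) ^ j / real j)" using a by (intro sum_nonneg) auto
    moreover have "ln (a + 1) \<le> ln 2" using a by simp
    ultimately have "(ln (a + 1) - (\<Sum>j=1..n-1. (1 / (a + 1)) ^ j / real j)) - ln a \<le> ln 2 - ln a" by linarith
    then have "(real n - 1) * ((ln (a + 1) - (\<Sum>j=1..n-1. (1 / (a + 1)) ^ j / real j)) - ln a) \<le> (real n - 1) * (ln 2 - ln a)"
      using dim by (intro mult_left_mono) auto
    then show ?thesis unfolding z by (simp add: log_profile_def right_diff_distrib)
  qed
  then have "unit_ball_vol n * (log_profile n a 1 - log_profile n a 0) \<le> unit_ball_vol n * ((real n - 1) * (ln 2 - ln a))"
    by (intro mult_left_mono) auto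
  with le show ?thesis by (simp only: mult.assoc)
qed

text \<open>The singularity is only logarithmic, so it averages out: the part with \<tau> at most
  \<open>s\<close> has relative mass at most \<open>s\<close>, and the rest is bounded independently
  of \<open>a\<close>. The coefficient of \<open>- ln a\<close> is made small by the choice of
  \<open>s\<close>.\<close>

lemma conc_average_le:
  assumes s: "0 < s"
  shows "(LINT x|lborel. conc n a (\<tau> (x::'a)) * (1 / (1 + \<tau> x) ^ n))
    \<le> unit_ball_vol n * (real n * s * (- ln a) + real n * ln (1 + 1 / s))"
proof -
  let ?k = "\<lambda>x::'a. 1 / (1 + \<tau> x) ^ n"
  let ?I = "\<lambda>x::'a. indicator {x. \<tau> x \<le> s} x :: real"
  have m1: "has_bochner_integral lborel (\<lambda>x. ?I x * ?k x) (unit_ball_vol n * ((s / (1 + s)) ^ (n - 1) / 1))"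
    by (rule mass_integral_le[OF n dim p]) (use s in auto)
  have m2: "has_bochner_integral lborel ?k (unit_ball_vol n / 1)"
    by (rule mass_integral[OF n dim p]) simp
  have L: "0 \<le> - ln a" "0 \<le> ln (1 + 1 / s)" using a s by auto
  have "(LINT x|lborel. conc n a (\<tau> x) * ?k x) \<le> (LINT x|lborel. (real n * - ln a) * (?I x * ?k x) + (real n * ln (1 + 1 / s)) * ?k x)"
  proof (rule integral_mono)
    show "integrable lborel (\<lambda>x. conc n a (\<tau> x) * ?k x)"
      by (rule bump_integrable[OF n dim p bump_conc continuous_inverse_power_\<tau>[OF n dim p]])
    show "integrable lborel (\<lambda>x. (real n * - ln a) * (?I x * ?k x) + (real n * ln (1 + 1 / s)) * ?k x)"
      using m1 m2 by (intro Bochner_Integration.integrable_add integrable_mult_right) (auto simp: has_bochner_integral_iff)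
    fix x :: 'a
    have "conc n a (\<tau> x) \<le> (real n * - ln a) * ?I x + real n * ln (1 + 1 / s)"
    proof (cases "\<tau> x \<le> s")
      case True
      have "conc n a (\<tau> x) \<le> real n * (ln (1 + \<tau> x) - ln (a + \<tau> x))" by (rule conc_le) simp
      also have "\<dots> \<le> real n * (- ln a)" by (intro mult_left_mono ln_ratio(2)) auto
      also have "\<dots> \<le> (real n * - ln a) * ?I x + real n * ln (1 + 1 / s)"
        using True L by simp
      finally show ?thesis .
    next
      case False
      have "conc n a (\<tau> x) \<le> real n * (ln (1 + \<tau> x) - ln (a + \<tau> x))" by (rule conc_le) simp
      also have "\<dots> \<le> real n * ln (1 + 1 / s)" using False s by (intro mult_left_mono ln_ratio(3)) auto
      finally show ?thesis using False by simp
    qed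
    moreover have "0 \<le> ?k x" by simp
    ultimately have "conc n a (\<tau> x) * ?k x \<le> ((real n * - ln a) * ?I x + real n * ln (1 + 1 / s)) * ?k x"
      by (rule mult_right_mono)
    then show "conc n a (\<tau> x) * ?k x \<le> (real n * - ln a) * (?I x * ?k x) + (real n * ln (1 + 1 / s)) * ?k x"
      by (simp only: distrib_right mult.assoc)
  qed
  also have "\<dots> = (real n * - ln a) * (unit_ball_vol n * ((s / (1 + s)) ^ (n - 1) / 1)) + (real n * ln (1 + 1 / s)) * (unit_ball_vol n / 1)"
    by (rule has_bochner_integral_integral_eq)
       (intro has_bochner_integral_add has_bochner_integral_mult_right m1 m2)
  finally have le: "(LINT x|lborel. conc n a (\<tau> x) * ?k x)
    \<le> (real n * - ln a) * (unit_ball_vol n * ((s / (1 + s)) ^ (n - 1) / 1)) + (real n * ln (1 + 1 / s)) * (unit_ball_vol n / 1)" .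
  have "(s / (1 + s)) ^ (n - 1) \<le> s"
  proof -
    have "(s / (1 + s)) ^ (n - 1) \<le> (s / (1 + s)) ^ 1"
      using s dim by (intro power_decreasing) auto
    also have "\<dots> \<le> s" using s by (simp add: divide_le_eq)
    finally show ?thesis .
  qed
  then have "(real n * - ln a) * (unit_ball_vol n * ((s / (1 + s)) ^ (n - 1) / 1)) \<le> (real n * - ln a) * (unit_ball_vol n * (s / 1))"
    using L by (intro mult_left_mono divide_right_mono mult_nonneg_nonneg) auto
  with le have "(LINT x|lborel. conc n a (\<tau> x) * ?k x)
    \<le> (real n * - ln a) * (unit_ball_vol n * (s / 1)) + (real n * ln (1 + 1 / s)) * (unit_ball_vol n / 1)"
    by linarith
  also have "\<dots> = unit_ball_vol n * (real n * s * (- ln a) + real n * ln (1 + 1 / s))"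
    by (simp add: algebra_simps)
  finally show ?thesis .
qed

text \<open>On the ball where \<tau> is at most 1 the factors (1 + \<tau>)^n cancel and leave (a +
  \<tau>)^(-n), whose mass is known; \<open>a < 1\<close> gives the factor 1/2.\<close>

lemma conc_mass_ge:
  "unit_ball_vol n * ((1 / 2) ^ (n - 1) / a) \<le> (LINT x|lborel. tilted (\<lambda>x::'a. conc n a (\<tau> x)) x)"
proof -
  let ?I = "\<lambda>x::'a. indicator {x. \<tau> x \<le> 1} x :: real"
  let ?u = "\<lambda>x::'a. conc n a (\<tau> x)"
  have m: "has_bochner_integral lborel (\<lambda>x. ?I x * (1 / (a + \<tau> x) ^ n)) (unit_ball_vol n * ((1 / (a + 1)) ^ (n - 1) / a))"
    by (rule mass_integral_le[OF n dim p a(1)]) simp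
  have "unit_ball_vol n * ((1 / 2) ^ (n - 1) / a) \<le> unit_ball_vol n * ((1 / (a + 1)) ^ (n - 1) / a)"
    using a by (intro mult_left_mono divide_right_mono power_mono divide_left_mono) auto
  also have "\<dots> = (LINT x|lborel. ?I x * (1 / (a + \<tau> x) ^ n))"
    using m by (simp only: has_bochner_integral_integral_eq)
  also have "\<dots> \<le> (LINT x|lborel. tilted ?u x)"
  proof (rule integral_mono)
    show "integrable lborel (\<lambda>x. ?I x * (1 / (a + \<tau> x) ^ n))" using m by (simp only: has_bochner_integral_iff)
    show "integrable lborel (tilted ?u)" by (rule tilted_integrable[OF n dim p bump_conc])
    fix x :: 'a
    show "?I x * (1 / (a + \<tau> x) ^ n) \<le> tilted ?u x"
    proof (cases "\<tau> x \<le> 1")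
      case True
      have pos: "0 < 1 + \<tau> x" "0 < a + \<tau> x" using a \<tau>_nonneg[of x] by linarith+
      have "exp (?u x) = exp (ln (1 + \<tau> x) - ln (a + \<tau> x)) ^ n"
        using True by (simp add: conc_inner exp_of_nat_mult)
      also have "\<dots> = (1 + \<tau> x) ^ n / (a + \<tau> x) ^ n"
        using pos by (simp add: exp_diff power_divide)
      finally show ?thesis using True pos by (simp add: tilted_def n)
    next
      case False
      then show ?thesis using tilted_pos[OF n dim p bump_conc, of x] by simp
    qed
  qed
  finally show ?thesis .
qed

end

end

section \<open>Onofri's inequality\<close>

lemma GDERIV_differentiable:
  assumes "GDERIV f x :> D"
  shows "f differentiable (at x)"
  using assms by (auto simp: gderiv_def differentiable_def)

text \<open>\<open>grad\<close> is a definite description, so a representing vector must be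
  exhibited; the adjoint of the derivative at 1 is one.\<close>

lemma differentiable_GDERIV_grad:
  fixes f :: "'a::euclidean_space \<Rightarrow> real"
  assumes "f differentiable (at x)"
  shows "GDERIV f x :> grad f x"
proof -
  obtain f' where f': "(f has_derivative f') (at x)"
    using assms by (auto simp: differentiable_def)
  have "linear f'" using f' by (rule has_derivative_linear)
  define D where "D = adjoint f' 1"
  have "f' = (\<lambda>h. h \<bullet> D)"
    using adjoint_works[OF \<open>linear f'\<close>, of _ 1] by (auto simp: D_def)
  with f' have "GDERIV f x :> D" by (simp add: gderiv_def)
  then show ?thesis using grad_eqI by metis
qed

lemma C1c_imp_bump:
  fixes u :: "'a::euclidean_space \<Rightarrow> real"
  assumes "u \<in> C1c"
  shows "bump u (grad u)"
  unfolding bump_def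
proof (intro conjI allI)
  show G: "GDERIV u x :> grad u x" for x
    using assms by (intro differentiable_GDERIV_grad) (simp add: C1c_def)
  show "continuous_on UNIV (grad u)" using assms by (simp add: C1c_def)
  have "bounded (closure {x. u x \<noteq> 0})"
    using assms by (intro compact_imp_bounded) (simp add: C1c_def)
  then obtain K where K: "\<And>x. x \<in> closure {x. u x \<noteq> 0} \<Longrightarrow> norm x \<le> K"
    unfolding bounded_iff by blast
  have z: "u x = 0" if "K < norm x" for x
    using K[of x] that closure_subset[of "{x. u x \<noteq> 0}"] by force
  have "grad u x = 0" if "K < norm x" for x
  proof (rule grad_eqI)
    have "open {x::'a. K < norm x}" by (intro open_Collect_less continuous_intros)
    have "((\<lambda>_. 0) has_derivative (\<lambda>h. h \<bullet> 0)) (at x)" by simp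
    then show "GDERIV u x :> 0"
      unfolding gderiv_def
      by (rule has_derivative_transform_within_open[OF _ \<open>open {x::'a. K < norm x}\<close>])
         (use that z in auto)
  qed
  with z show "\<exists>K. \<forall>x. K < norm x \<longrightarrow> u x = 0 \<and> grad u x = 0" by blast
qed

lemma bump_imp_C1c:
  fixes u :: "'a::euclidean_space \<Rightarrow> real"
  assumes "bump u D"
  shows "u \<in> C1c" "grad u = D"
proof -
  show g: "grad u = D"
    using assms by (auto simp: bump_def intro: grad_eqI)
  obtain K where K: "\<And>x. K < norm x \<Longrightarrow> u x = 0"
    using assms unfolding bump_def by blast
  have "{x. u x \<noteq> 0} \<subseteq> cball 0 K" using K by force
  then have "bounded {x. u x \<noteq> 0}" by (rule bounded_subset[OF bounded_cball])
  then show "u \<in> C1c"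
    using assms GDERIV_differentiable unfolding C1c_def mem_Collect_eq g by (auto simp: bump_def compact_closure)
qed

section \<open>Translation into the functional of the theorem\<close>

context
  fixes n :: nat and p :: real
  assumes n: "CARD('n::finite) = n" and dim: "2 \<le> n" and p: "conj_exp TYPE(real ^ 'n) = p"
begin

lemma DIM_n: "DIM(real ^ 'n) = n"
  using n by simp

lemma unit_ball_vol_nonzero: "unit_ball_vol (real n) \<noteq> 0"
  using unit_ball_vol_pos[of "real n"] by linarith

lemma onofri_exponent: "p = real n / (real n - 1)"
  by (rule conj_exp_eq[OF DIM_n dim p])

lemma \<omega>_eq: "\<omega> TYPE('n) = real n * unit_ball_vol n"
  by (simp add: \<omega>_eq_unit_ball_vol n)

lemma \<mu>_eq: "\<mu> (x :: real ^ 'n) = 1 / (unit_ball_vol n * (1 + \<tau> x) ^ n)"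
  using dim by (simp add: \<mu>_def Let_def n \<omega>_eq \<tau>_def p onofri_exponent)

lemma \<beta>_eq: "\<beta> TYPE('n) = real n ^ n * p ^ (n - 1) * (real n * unit_ball_vol n)"
  by (simp add: \<beta>_def Let_def n \<omega>_eq onofri_exponent)

lemma \<mu>_nonneg: "0 \<le> \<mu> (x :: real ^ 'n)"
  by (simp add: \<mu>_eq)

lemma \<mu>_borel: "(\<mu> :: real ^ 'n \<Rightarrow> real) \<in> borel_measurable borel"
  unfolding \<mu>_eq[abs_def] by measurable

lemma integral_M\<mu>:
  fixes h :: "real ^ 'n \<Rightarrow> real"
  assumes "h \<in> borel_measurable borel"
  shows "(LINT x|M\<mu>. h x) = (LINT x|lborel. h x * (1 / (1 + \<tau> x) ^ n)) / unit_ball_vol n"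
proof -
  have "(LINT x|M\<mu>. h x) = (LINT x|lborel. \<mu> x *\<^sub>R h x)"
    unfolding M\<mu>_def using assms \<mu>_borel \<mu>_nonneg by (intro integral_density) auto
  also have "\<dots> = (LINT x|lborel. h x * (1 / (1 + \<tau> x) ^ n) / unit_ball_vol n)"
    by (intro Bochner_Integration.integral_cong) (auto simp: \<mu>_eq)
  finally show ?thesis by (simp only: integral_divide_zero)
qed

lemma grad_ln_\<mu>: "grad (\<lambda>y. ln (\<mu> y)) (x :: real ^ 'n) = - ((real n / (1 + \<tau> x)) *\<^sub>R grad_\<tau> x)"
proof (rule grad_eqI)
  have "ln (\<mu> y) = - ln (unit_ball_vol n) - real n * ln (1 + \<tau> y)" for y :: "real ^ 'n"
  proof -
    have "0 < 1 + \<tau> y" by (rule add_pos_nonneg) auto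
    then show ?thesis using unit_ball_vol_nonzero by (simp add: \<mu>_eq ln_div ln_mult ln_realpow)
  qed
  then have eq: "(\<lambda>y :: real ^ 'n. ln (\<mu> y)) = (\<lambda>y. (\<lambda>t. - ln (unit_ball_vol n) - real n * ln (1 + t)) (\<tau> y))"
    by auto
  have "0 < 1 + \<tau> x" by (rule add_pos_nonneg) auto
  then have "((\<lambda>t. - ln (unit_ball_vol n) - real n * ln (1 + t)) has_real_derivative - (real n / (1 + \<tau> x))) (at (\<tau> x))"
    by (auto intro!: derivative_eq_intros)
  from GDERIV_comp_\<tau>[OF DIM_n dim p this]
  show "GDERIV (\<lambda>y. ln (\<mu> y)) x :> - ((real n / (1 + \<tau> x)) *\<^sub>R grad_\<tau> x)"
    unfolding eq by simp
qed

text \<open>The powers of |x| cancel because (n-2)(p-1) + (p-2) = (n-1)(p-1) - 1 = 0. The flux of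
  the n-Laplacian of \<open>\<tau>\<close> is thus a multiple of the identity field.\<close>

lemma norm_power_grad_\<tau>: "norm (grad_\<tau> (x :: real ^ 'n)) ^ (n - 2) *\<^sub>R grad_\<tau> x = p ^ (n - 1) *\<^sub>R x"
proof (cases "x = 0")
  case False
  have e: "real (n - 2) * (p - 1) + (p - 2) = 0"
    using dim by (simp add: onofri_exponent of_nat_diff field_simps)
  have "(norm x powr (p - 1)) ^ (n - 2) * norm x powr (p - 2) = norm x powr (real (n - 2) * (p - 1) + (p - 2))"
    using False by (simp only: powr_power powr_add norm_eq_zero not_False_eq_True)
  then have "(norm x powr (p - 1)) ^ (n - 2) * norm x powr (p - 2) = 1"
    unfolding e using False by simp
  moreover have "p ^ (n - 1) = p ^ (n - 2) * p"
    using dim by (metis power_Suc2 Suc_diff_le diff_Suc_Suc numeral_2_eq_2 One_nat_def)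
  moreover have "norm (grad_\<tau> x) ^ (n - 2) *\<^sub>R grad_\<tau> x
      = (p ^ (n - 2) * p * ((norm x powr (p - 1)) ^ (n - 2) * norm x powr (p - 2))) *\<^sub>R x"
    unfolding norm_grad_\<tau>[OF DIM_n dim p] by (simp add: grad_\<tau>_def p power_mult_distrib mult_ac)
  ultimately show ?thesis by simp
qed (simp add: grad_\<tau>_def)

text \<open>The first two terms of \<open>H\<close> are energies, rescaled by the factor n p in
  \<open>slope\<close>. The linear term is the field of the preceding lemma, in the form to which
  integration by parts applies.\<close>

lemma H_eq:
  "H u \<mu> (x :: real ^ 'n) = (real n * p) ^ n * (norm (slope (grad u) x) ^ n - norm (slope (\<lambda>_. 0) x) ^ n)
    + real n ^ n * p ^ (n - 1) * ((x \<bullet> grad u x) / (1 + \<tau> x) ^ (n - 1))"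
proof -
  let ?k = "real n / (1 + \<tau> x)"
  let ?V = "- (?k *\<^sub>R grad_\<tau> x)"
  have \<tau>1: "0 < 1 + \<tau> x" by (rule add_pos_nonneg) auto
  have k: "0 \<le> ?k" using \<tau>1 by simp
  have p1: "1 < p" by (rule conj_exp_gt_1[OF DIM_n dim p])
  have np: "0 < real n * p" using p1 dim by simp
  have s: "E x + ?V = (real n * p) *\<^sub>R slope E x" for E
    using p1 dim by (simp add: slope_def n p)
  have pw: "norm (E x + ?V) ^ n = (real n * p) ^ n * norm (slope E x) ^ n" for E
    unfolding s using np by (simp add: power_mult_distrib)
  have "norm ?V ^ (n - 2) * (?V \<bullet> grad u x) = - (?k ^ (n - 2) * ?k) * ((norm (grad_\<tau> x) ^ (n - 2) *\<^sub>R grad_\<tau> x) \<bullet> grad u x)"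
  proof -
    have "norm ?V = ?k * norm (grad_\<tau> x)" using k by simp
    then show ?thesis
      by (simp only: power_mult_distrib inner_minus_left inner_scaleR_left mult_minus_left mult_minus_right mult_ac)
  qed
  also have "?k ^ (n - 2) * ?k = ?k ^ (n - 1)"
    using dim by (metis power_Suc2 Suc_diff_le diff_Suc_Suc numeral_2_eq_2 One_nat_def)
  finally have cross: "norm ?V ^ (n - 2) * (?V \<bullet> grad u x) = - (?k ^ (n - 1)) * (p ^ (n - 1) * (x \<bullet> grad u x))"
    by (simp add: norm_power_grad_\<tau>)
  have nn: "real n ^ n = real n * real n ^ (n - 1)"
    using dim by (metis power_Suc Suc_diff_1 less_le_trans zero_less_numeral)
  have "H u \<mu> x = norm (grad u x + ?V) ^ n - norm ?V ^ n - n * (norm ?V ^ (n - 2) * (?V \<bullet> grad u x))"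
    unfolding H_def Let_def n grad_ln_\<mu> by simp
  also have "norm ?V ^ n = (real n * p) ^ n * norm (slope (\<lambda>_. 0) x) ^ n"
    using pw[of "\<lambda>_. 0"] by simp
  finally show ?thesis
    unfolding cross pw nn by (simp add: power_divide algebra_simps)
qed

text \<open>Integration by parts turns the linear term of \<open>H\<close> into a multiple of the
  mean of \<open>u\<close>, with a factor that makes it cancel the mean in the functional exactly
  when b equals \<open>\<beta>\<close>; the inequality is then the energy bound alone. A general
  \<open>b\<close> is kept for the optimality argument. The normalization is (n p)^n =
  \<open>\<beta>\<close> / (V (n-1)), V the volume of the unit ball.\<close>

lemma onofri_functional_eq:
  fixes u :: "real ^ 'n \<Rightarrow> real" and b :: real
  assumes u: "bump u D" and b: "0 < b"
  shows "1 / b * (LINT x|lborel. H u \<mu> x) + (LINT x|M\<mu>. u x) - ln (LINT x|M\<mu>. exp (u x))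
    = \<beta> TYPE('n) / b * ((LINT x|lborel. norm (slope D x) ^ n - norm (slope (\<lambda>_. 0) x) ^ n)
          / (unit_ball_vol n * (real n - 1)))
      + (1 - \<beta> TYPE('n) / b) * ((LINT x|lborel. u x * (1 / (1 + \<tau> x) ^ n)) / unit_ball_vol n)
      - ln ((LINT x|lborel. tilted u x) / unit_ball_vol n)"
proof -
  let ?V = "unit_ball_vol (real n)"
  let ?E = "LINT x|lborel. norm (slope D x) ^ n - norm (slope (\<lambda>_. 0) x) ^ n"
  let ?m = "LINT x|lborel. u x * (1 / (1 + \<tau> x) ^ n)"
  note V = unit_ball_vol_nonzero
  have g: "grad u = D" by (rule bump_imp_C1c(2)[OF u])
  obtain X where X: "1 \<le> X" "\<And>x. X - 1 \<le> \<tau> x \<Longrightarrow> u x = 0 \<and> D x = 0"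
    using bump_\<tau>_support[OF DIM_n dim p u] by blast
  have E: "integrable lborel (\<lambda>x. norm (slope D x) ^ n - norm (slope (\<lambda>_. 0) x) ^ n)"
    by (rule energy_difference(1)[OF DIM_n dim p u, of X]) (use X in auto)
  note ibp = integration_by_parts[OF DIM_n dim p u]
  have "(LINT x|lborel. H u \<mu> x) = (real n * p) ^ n * ?E
      + real n ^ n * p ^ (n - 1) * (LINT x|lborel. (x \<bullet> D x) / (1 + \<tau> x) ^ (n - 1))"
    unfolding H_eq g
    by (subst Bochner_Integration.integral_add[OF integrable_mult_right[OF E] integrable_mult_right[OF ibp(1)]])
       (simp only: integral_mult_right_zero)
  also have "\<dots> = (real n * p) ^ n * ?E - \<beta> TYPE('n) * (?m / ?V)"
    unfolding ibp(2) \<beta>_eq using V by simp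
  also have "(real n * p) ^ n = \<beta> TYPE('n) / (?V * (real n - 1))"
  proof -
    have "p ^ n = p * p ^ (n - 1)"
      using dim by (metis power_Suc Suc_diff_1 less_le_trans zero_less_numeral)
    moreover have "p = real n / (real n - 1)" by (rule onofri_exponent)
    ultimately have "p ^ n = p ^ (n - 1) * (real n / (real n - 1))" by (metis mult.commute)
    then show ?thesis using V dim by (simp add: \<beta>_eq power_mult_distrib)
  qed
  finally have H: "(LINT x|lborel. H u \<mu> x) = \<beta> TYPE('n) * (?E / (?V * (real n - 1)) - ?m / ?V)"
    by (simp add: right_diff_distrib)
  have [measurable]: "u \<in> borel_measurable borel" using bump_borel[OF u] by simp
  have m: "(LINT x|M\<mu>. u x) = ?m / ?V" by (rule integral_M\<mu>) measurable
  have e: "(LINT x|M\<mu>. exp (u x)) = (LINT x|lborel. tilted u x) / ?V"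
    by (subst integral_M\<mu>) (simp_all add: tilted_def[abs_def] n)
  show ?thesis
  proof -
    have "1 / b * (c * (x - y)) + y - z = c / b * x + (1 - c / b) * y - z" for c x y z :: real
      by (simp add: divide_inverse algebra_simps)
    then show ?thesis unfolding H m e .
  qed
qed

lemma \<beta>_pos: "0 < \<beta> TYPE('n)"
  using conj_exp_gt_1[OF DIM_n dim p] dim by (simp add: \<beta>_eq)

lemma onofri_inequality:
  fixes u :: "real ^ 'n \<Rightarrow> real"
  assumes u: "bump u D"
  shows "0 \<le> 1 / \<beta> TYPE('n) * (LINT x|lborel. H u \<mu> x) + (LINT x|M\<mu>. u x) - ln (LINT x|M\<mu>. exp (u x))"
proof -
  have "0 < unit_ball_vol n * (real n - 1)" using dim by simp
  then have "ln ((LINT x|lborel. tilted u x) / unit_ball_vol n)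
      \<le> (LINT x|lborel. norm (slope D x) ^ n - norm (slope (\<lambda>_. 0) x) ^ n) / (unit_ball_vol n * (real n - 1))"
    using energy_lower_bound[OF DIM_n dim p u] by (simp add: pos_le_divide_eq mult.commute)
  then show ?thesis
    unfolding onofri_functional_eq[OF u \<beta>_pos] using \<beta>_pos by simp
qed

text \<open>Along the concentrating family all three terms of the functional are multiples of
  $\log(1/a)$ up to bounded errors.\<close>

lemma onofri_sharp:
  assumes b: "\<beta> TYPE('n) < b"
  obtains u :: "real ^ 'n \<Rightarrow> real" and D where "bump u D"
    "1 / b * (LINT x|lborel. H u \<mu> x) + (LINT x|M\<mu>. u x) - ln (LINT x|M\<mu>. exp (u x)) < 0"
proof -
  let ?V = "unit_ball_vol (real n)"
  define r where "r = \<beta> TYPE('n) / b"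
  have b0: "0 < b" using b \<beta>_pos by linarith
  have r: "0 < r" "r < 1" using b b0 \<beta>_pos by (auto simp: r_def)
  \<comment> \<open>With \<open>n * s = 1/2\<close> the mean of the test function grows at most like
    L/2, half as fast as the logarithm of the mass.\<close>
  define s where "s = 1 / (2 * real n)"
  have s: "0 < s" "real n * s = 1 / 2" using dim by (auto simp: s_def)
  define C1 where "C1 = ln 2 + 2 * 4 ^ n * 2 ^ (n - 1) / (real n - 1)"
  define C2 where "C2 = real n * ln (1 + 1 / s)"
  define C where "C = r * C1 + (1 - r) * C2 + (real n - 1) * ln 2"
  define c where "c = \<bar>C\<bar> + 1"
  \<comment> \<open>The functional is at most C - (1-r) L / 2, where \<open>C\<close> does not
    depend on \<open>L\<close>. This \<open>L\<close> makes the subtracted term |C| + 1.\<close>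
  define L where "L = 2 * c / (1 - r)"
  have L: "0 < L" using r by (simp add: L_def c_def)
  have "(1 - r) / 2 * L = c" using r by (simp add: L_def)
  then have CL: "C < (1 - r) / 2 * L" unfolding c_def by linarith
  define a where "a = exp (- L)"
  have a: "0 < a" "a < 1" "ln a = - L" using L by (auto simp: a_def)
  let ?u = "\<lambda>x :: real ^ 'n. conc n a (\<tau> x)" and ?D = "\<lambda>x :: real ^ 'n. conc' n a (\<tau> x) *\<^sub>R grad_\<tau> x"
  note hyps = a(1,2) DIM_n dim p
  have u: "bump ?u ?D" by (rule bump_conc[OF hyps])
  let ?E = "LINT x|lborel. norm (slope ?D x) ^ n - norm (slope (\<lambda>_. 0) x) ^ n"
  have k: "0 < ?V * (real n - 1)" using dim by simp
  have E: "?E / (?V * (real n - 1)) \<le> L + C1"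
  proof -
    have "?E \<le> ?V * (real n - 1) * (ln 2 + L) + 2 * 4 ^ n * (?V * 2 ^ (n - 1))"
      using conc_energy_le[OF hyps] a(3) by simp
    also have "\<dots> = (L + C1) * (?V * (real n - 1))"
      using dim by (simp add: C1_def field_simps)
    finally show ?thesis using k by (simp only: pos_divide_le_eq)
  qed
  have A: "(LINT x|lborel. ?u x * (1 / (1 + \<tau> x) ^ n)) / ?V \<le> L / 2 + C2"
  proof -
    have "(LINT x|lborel. ?u x * (1 / (1 + \<tau> x) ^ n)) \<le> ?V * (real n * s * L + C2)"
      using conc_average_le[OF hyps s(1)] a(3) by (simp add: C2_def)
    also have "\<dots> = (L / 2 + C2) * ?V" unfolding s(2) by simp
    finally show ?thesis by (subst pos_divide_le_eq) auto
  qed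
  have M: "L - (real n - 1) * ln 2 \<le> ln ((LINT x|lborel. tilted ?u x) / ?V)"
  proof -
    have "(1 / 2) ^ (n - 1) / a \<le> (LINT x|lborel. tilted ?u x) / ?V"
      using conc_mass_ge[OF hyps] by (subst pos_le_divide_eq) (auto simp: mult.commute)
    then have "ln ((1 / 2) ^ (n - 1) / a) \<le> ln ((LINT x|lborel. tilted ?u x) / ?V)"
      using a(1) by (intro ln_mono) auto
    moreover have "ln ((1 / 2) ^ (n - 1) / a) = L - (real n - 1) * ln 2"
      using a dim by (simp add: ln_div ln_realpow of_nat_diff)
    ultimately show ?thesis by simp
  qed
  have "1 / b * (LINT x|lborel. H ?u \<mu> x) + (LINT x|M\<mu>. ?u x) - ln (LINT x|M\<mu>. exp (?u x))
      \<le> r * (L + C1) + (1 - r) * (L / 2 + C2) - (L - (real n - 1) * ln 2)"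
    unfolding onofri_functional_eq[OF u b0] r_def[symmetric]
    using E A M r by (intro diff_mono add_mono mult_left_mono) auto
  also have "\<dots> = C - (1 - r) / 2 * L" by (simp add: C_def algebra_simps)
  also have "\<dots> < 0" using CL by simp
  finally show thesis using that[OF u] by blast
qed

lemma zero_bump: "bump (\<lambda>_ :: real ^ 'n. 0) (\<lambda>_. 0)"
  by (auto simp: bump_def gderiv_def)

lemma onofri_zero:
  "1 / \<beta> TYPE('n) * (LINT x|lborel. H (\<lambda>_. 0) \<mu> (x :: real ^ 'n)) + (LINT x|(M\<mu> :: (real ^ 'n) measure). 0)
    - ln (LINT x|(M\<mu> :: (real ^ 'n) measure). exp 0) = 0"
proof -
  have "(LINT x|lborel. tilted (\<lambda>_ :: real ^ 'n. 0) x) = unit_ball_vol n"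
    using mass_integral[OF DIM_n dim p, of 1] by (simp add: tilted_def n has_bochner_integral_iff)
  then show ?thesis
    using onofri_functional_eq[OF zero_bump \<beta>_pos] by simp
qed

end

theorem theorem4p3:
  assumes "CARD('n::finite) \<ge> 2"
  shows "let J = (\<lambda>b (u :: real ^ 'n \<Rightarrow> real).
            1 / b * (LINT x|lborel. H u \<mu> x) + (LINT x|M\<mu>. u x) - ln (LINT x|M\<mu>. exp (u x)))
         in (\<forall>u \<in> C1c. J (\<beta> TYPE('n)) u \<ge> 0)
          \<and> (\<forall>b > \<beta> TYPE('n). \<not> (\<forall>u \<in> C1c. J b u \<ge> 0))
          \<and> (\<lambda>_. 0) \<in> (C1c :: (real ^ 'n \<Rightarrow> real) set) \<and> J (\<beta> TYPE('n)) (\<lambda>_. 0) = 0"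
  unfolding Let_def
proof (intro conjI ballI allI impI)
  note hyps = refl[of "CARD('n)"] assms refl[of "conj_exp TYPE(real ^ 'n)"]
  show "0 \<le> 1 / \<beta> TYPE('n) * (LINT x|lborel. H u \<mu> x) + (LINT x|M\<mu>. u x) - ln (LINT x|M\<mu>. exp (u x))"
    if "u \<in> C1c" for u :: "real ^ 'n \<Rightarrow> real"
    by (rule onofri_inequality[OF hyps C1c_imp_bump[OF that]])
  show "\<not> (\<forall>u \<in> C1c. 0 \<le> 1 / b * (LINT x|lborel. H u \<mu> (x :: real ^ 'n)) + (LINT x|M\<mu>. u x) - ln (LINT x|M\<mu>. exp (u x)))"
    if b: "\<beta> TYPE('n) < b" for b
  proof -
    obtain u :: "real ^ 'n \<Rightarrow> real" and D where "bump u D"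
      "1 / b * (LINT x|lborel. H u \<mu> x) + (LINT x|M\<mu>. u x) - ln (LINT x|M\<mu>. exp (u x)) < 0"
      using onofri_sharp[OF hyps b] by blast
    then show ?thesis using bump_imp_C1c(1) by (force simp: not_le)
  qed
  show "(\<lambda>_. 0) \<in> (C1c :: (real ^ 'n \<Rightarrow> real) set)"
    by (rule bump_imp_C1c(1)[OF zero_bump[OF hyps]])
  show "1 / \<beta> TYPE('n) * (LINT x|lborel. H (\<lambda>_. 0) \<mu> (x :: real ^ 'n)) + (LINT x|(M\<mu> :: (real ^ 'n) measure). 0)
      - ln (LINT x|(M\<mu> :: (real ^ 'n) measure). exp 0) = 0"
    by (rule onofri_zero[OF hyps])
qed

end
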